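(* Let $V=C^\infty(\mathcal B)$, let $L:TV\to\mathbb R$, $L(\varphi,\nu)=\int_{\mathcal B}\mathfrak L(\varphi(x),\nu(x),\nabla\varphi(x))\,dx$, be a Lagrangian defined through a density $\mathfrak L:\mathbb R\times\mathbb R\times\mathbb R^m\to\mathbb R$, and let $F:TV\to T^\star V$, $F(\varphi,\nu)=(\varphi,\mathcal F(\varphi,\nu),\mathcal F_\partial(\varphi,\nu))$, be an external force. Consider the curves $(\varphi,\nu,\alpha,\alpha_\partial):[t_0,t_1]\to TV\oplus T^\star V$ and $\varphi=\rho_V\circ(\varphi,\nu,\alpha,\alpha_\partial):[t_0,t_1]\to V$, where $\rho_V:TV\oplus T^\star V\to V$ is the natural projection. The following statements are equivalent: (i) The curve $\varphi$ is critical for the Lagrange--d'Alembert principle; namely, it satisfies $$\delta\int_{t_0}^{t_1}L(\varphi,\dot\varphi)\,dt+\int_{t_0}^{t_1}\langle F(\varphi,\dot\varphi),\delta\varphi\rangle\,dt=0$$ for free variations $\delta\varphi$ vanishing at $t=t_0,t_1$. (ii) The curve $\varphi$ is a solution of the Lagrange--d'Alembert equations $$\frac{\partial}{\partial t}\frac{\partial\mathfrak L}{\partial\nu}(\varphi,\dot\varphi,\nabla\varphi)=\frac{\partial\mathfrak L}{\partial\varphi}(\varphi,\dot\varphi,\nabla\varphi)-\operatorname{div}\frac{\partial\mathfrak L}{\partial\nabla\varphi}(\varphi,\dot\varphi,\nabla\varphi)+\mathcal F(\varphi,\dot\varphi),$$ $$\mathcal F_\partial(\varphi,\dot\varphi)=-\left.\frac{\partial\mathfrak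 L}{\partial\nabla\varphi}(\varphi,\dot\varphi,\nabla\varphi)\right|_{\partial\mathcal B}\cdot n.$$ (iii) The curve $(\varphi,\nu,\alpha,\alpha_\partial)$ is critical for the Lagrange--d'Alembert--Pontryagin principle; namely, it satisfies $$\delta\int_{t_0}^{t_1}\big[L(\varphi,\nu)+\langle(\alpha,\alpha_\partial),\dot\varphi-\nu\rangle\big]dt+\int_{t_0}^{t_1}\langle F(\varphi,\nu),\delta\varphi\rangle\,dt=0$$ for free variations $\delta\varphi,\delta\nu,\delta\alpha,\delta\alpha_\partial$ with $\delta\varphi$ vanishing at $t=t_0,t_1$. (iv) The curve $(\varphi,\nu,\alpha,\alpha_\partial)$ is a solution of the Lagrange--d'Alembert--Pontryagin equations $$\dot\varphi=\nu,\qquad \alpha=\frac{\partial\mathfrak L}{\partial\nu}(\varphi,\nu,\nabla\varphi),\qquad \dot\alpha=\frac{\partial\mathfrak L}{\partial\varphi}(\varphi,\nu,\nabla\varphi)-\operatorname{div}\frac{\partial\mathfrak L}{\partial\nabla\varphi}(\varphi,\nu,\nabla\varphi)+\mathcal F(\varphi,\nu),$$ $$\alpha_\partial=0,\qquad \dot\alpha_\partial=\left.\frac{\partial\mathfrak L}{\partial\nabla\varphi}(\varphi,\nu,\nabla\varphi)\right|_{\partial\mathcal B}\cdot n+\mathcal F_\partial(\varphi,\nu).$$ (v) The curve $(\varphi,\nu,\alpha,\alpha_\partial)$ is a solution of the Lagrange--Dirac dynamical system $$\big((\varphi,\alpha,\alpha_\partial,\dot\varphi,\dot\alpha,\dot\alpha_\partial),\,\mathrm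 d_DL(\varphi,\nu)-\widetilde F(\varphi,\nu)\big)\in D_{T^\star V}(\varphi,\alpha,\alpha_\partial).$$
   Context: $\mathcal B\subset\mathbb R^m$ is a bounded domain with smooth boundary $\partial\mathcal B$ (boundary included, so that $\mathcal B$ is compact); $V=C^\infty(\mathcal B)$ is the Fréchet space of smooth functions on $\mathcal B$; $dx$ is the volume form on $\mathcal B$, $ds$ the area element on $\partial\mathcal B$, $n$ the outward-pointing unit normal vector field on the boundary. The restricted dual of $V$ is $V^\star=C^\infty(\mathcal B)\times C^\infty(\partial\mathcal B)$, with pairing $\langle(\alpha,\alpha_\partial),\varphi\rangle=\int_{\mathcal B}\alpha\varphi\,dx+\int_{\partial\mathcal B}\alpha_\partial\varphi\,ds$, by which it is a subspace of the topological dual of $V$. Set $TV=V\times V$, $T^\star V=V\times V^\star$, $TV\oplus T^\star V=V\times V\times V^\star$ (elements $(\varphi,\nu,\alpha,\alpha_\partial)$), $T(T^\star V)=V\times V^\star\times V\times V^\star$, $T^\star(T^\star V)=V\times V^\star\times V^\star\times V$ (in the last two, the first two factors are the base point). The external force has components $\mathcal F:TV\to C^\infty(\mathcal B)$ (body force) and $\mathcal F_\partial:TV\to C^\infty(\partial\mathcal B)$ (boundary force), and $\langle F(\varphi,\nu),\delta\varphi\rangle$ means $\langle(\mathcal F(\varphi,\nu),\mathcal F_\partial(\varphi,\nu)),\delta\varphi\rangle$. The canonical Dirac structure $D_{T^\star V}\subset T(T^\star V)\oplus T^\star(T^\star V)$ is the graph of the flat map of the canonical symplectic form $\Omega_{T^\star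 V}(\varphi,\alpha,\alpha_\partial)((\dot\varphi,\dot\alpha,\dot\alpha_\partial),(\delta\varphi,\delta\alpha,\delta\alpha_\partial))=\langle(\delta\alpha,\delta\alpha_\partial),\dot\varphi\rangle-\langle(\dot\alpha,\dot\alpha_\partial),\delta\varphi\rangle$; explicitly, $D_{T^\star V}(\varphi,\alpha,\alpha_\partial)$ is the set of $(\dot\varphi,\dot\alpha,\dot\alpha_\partial,\delta\alpha,\delta\alpha_\partial,\delta\varphi)\in V\times V^\star\times V^\star\times V$ with $-\dot\alpha=\delta\alpha$, $-\dot\alpha_\partial=\delta\alpha_\partial$, $\dot\varphi=\delta\varphi$. The partial functional derivatives of $L$ are defined by $\frac{\delta L}{\delta\varphi}(\varphi,\nu)(\delta\varphi)=\frac{d}{d\epsilon}\big|_{\epsilon=0}L(\varphi+\epsilon\,\delta\varphi,\nu)$ and $\frac{\delta L}{\delta\nu}(\varphi,\nu)(\delta\nu)=\frac{d}{d\epsilon}\big|_{\epsilon=0}L(\varphi,\nu+\epsilon\,\delta\nu)$; since $L$ is defined through a density they lie in $V^\star$. The Dirac differential is $\mathrm d_DL:TV\to T^\star(T^\star V)$, $\mathrm d_DL(\varphi,\nu)=\big(\varphi,\frac{\delta L}{\delta\nu}(\varphi,\nu),-\frac{\delta L}{\delta\varphi}(\varphi,\nu),\nu\big)$. The Lagrangian force field is $\widetilde F(\varphi,\nu)=\big(\varphi,\frac{\partial\mathfrak L}{\partial\nu}(\varphi,\nu,\nabla\varphi),0,\mathcal F(\varphi,\nu),\mathcal F_\partial(\varphi,\nu),0\big)\in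 T^\star(T^\star V)$, which has the same base point as $\mathrm d_DL(\varphi,\nu)$; the difference is taken in the fiber. The inclusion in (v) includes the requirement that the base point of $\mathrm d_DL(\varphi,\nu)-\widetilde F(\varphi,\nu)$ equal $(\varphi,\alpha,\alpha_\partial)$. Here $\partial\mathfrak L/\partial\varphi$, $\partial\mathfrak L/\partial\nu$, $\partial\mathfrak L/\partial\nabla\varphi$ are the partial derivatives of $\mathfrak L$ in its first, second and third argument; $\dot{(\ )}=\partial_t$; $\delta\int(\cdot)\,dt$ denotes the first variation of the functional. Statements (i) and (ii) concern the curve $\varphi$ in $V$, while (iii)--(v) concern the curve $(\varphi,\nu,\alpha,\alpha_\partial)$ in $TV\oplus T^\star V$. The Lagrangian need not be nondegenerate.
   Formalization: Since (i),(ii) constrain only φ (for L=0, F=0, φ=0, ν=1 they hold but (iii)–(v) fail), the link proved is: (i) holds iff φ is the projection of some smooth curve satisfying (iii); (i)⇔(ii) and (iii)⇔(iv)⇔(v) are for the given curve. Density, force and curves are taken smooth. *)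

theory Defs
  imports "HOL-Analysis.Analysis"
begin

section \<open>Smooth functions\<close>

primrec Ck :: "nat \<Rightarrow> ('a::real_normed_vector \<Rightarrow> 'b::real_normed_vector) \<Rightarrow> bool" where
  "Ck 0 f \<longleftrightarrow> continuous_on UNIV f"
| "Ck (Suc n) f \<longleftrightarrow> (\<forall>x. f differentiable (at x)) \<and>
     (\<forall>v. Ck n (\<lambda>x. frechet_derivative f (at x) v))"

definition smooth :: "('a::real_normed_vector \<Rightarrow> 'b::real_normed_vector) \<Rightarrow> bool" where
  "smooth f \<longleftrightarrow> (\<forall>n. Ck n f)"

text \<open>Smoothness on a closed set: restriction of a smooth function on the whole space. This covers
  compact domains with smooth boundary, their boundaries, and products of these with closed
  intervals.\<close>

definition smooth_within ::
  "'a::real_normed_vector set \<Rightarrow> ('a \<Rightarrow> 'b::real_normed_vector) \<Rightarrow> bool" where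
  "smooth_within S f \<longleftrightarrow> (\<exists>g. smooth g \<and> (\<forall>x\<in>S. g x = f x))"


section \<open>Compact domains with smooth boundary\<close>

definition grad_in :: "(real^'m) set \<Rightarrow> (real^'m \<Rightarrow> real) \<Rightarrow> real^'m \<Rightarrow> real^'m" where
  "grad_in S f x = (\<chi> i. frechet_derivative f (at x within S) (axis i 1))"

definition div_in :: "(real^'m) set \<Rightarrow> (real^'m \<Rightarrow> real^'m) \<Rightarrow> real^'m \<Rightarrow> real" where
  "div_in S X x = (\<Sum>i\<in>UNIV. frechet_derivative X (at x within S) (axis i 1) $ i)"

definition set_coord :: "'m \<Rightarrow> real \<Rightarrow> real^'m \<Rightarrow> real^'m" where
  "set_coord k c y = (\<chi> j. if j = k then c else y $ j)"

text \<open>Inside the open set \<open>U\<close>, the set \<open>B\<close> lies on one side (below for \<open>s = 1\<close>, above for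
  \<open>s = - 1\<close>) of the graph of a smooth function \<open>h\<close> of the coordinates other than the \<open>k\<close>-th.
  Such a function is represented as a function on the whole space not depending on the
  \<open>k\<close>-th coordinate.\<close>

definition graph_patch ::
  "(real^'m) set \<Rightarrow> (real^'m) set \<Rightarrow> 'm \<Rightarrow> real \<Rightarrow> (real^'m \<Rightarrow> real) \<Rightarrow> bool" where
  "graph_patch B U k s h \<longleftrightarrow> open U \<and> (s = 1 \<or> s = - 1) \<and> smooth h \<and>
     (\<forall>y c. h (set_coord k c y) = h y) \<and>
     B \<inter> U = {x \<in> U. s * x $ k \<le> s * h x}"

definition smooth_domain :: "(real^'m) set \<Rightarrow> bool" where
  "smooth_domain B \<longleftrightarrow> compact B \<and> interior B \<noteq> {} \<and> connected (interior B) \<and>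
     (\<forall>p \<in> frontier B. \<exists>U k s h. p \<in> U \<and> graph_patch B U k s h)"

definition boundary_tangent :: "(real^'m) set \<Rightarrow> real^'m \<Rightarrow> real^'m \<Rightarrow> bool" where
  "boundary_tangent B x w \<longleftrightarrow> (\<exists>\<gamma> \<delta>. \<delta> > 0 \<and> (\<forall>t. \<bar>t\<bar> < \<delta> \<longrightarrow> \<gamma> t \<in> frontier B) \<and>
     \<gamma> 0 = x \<and> (\<gamma> has_vector_derivative w) (at 0))"

definition outward_normal :: "(real^'m) set \<Rightarrow> real^'m \<Rightarrow> real^'m" where
  "outward_normal B x = (THE n. norm n = 1 \<and> (\<forall>w. boundary_tangent B x w \<longrightarrow> n \<bullet> w = 0) \<and>
     (\<exists>\<delta>>0. \<forall>t. 0 < t \<and> t < \<delta> \<longrightarrow> x + t *\<^sub>R n \<notin> B))"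


subsection \<open>Integration with respect to the area element of the boundary\<close>

text \<open>The integral of \<open>f\<close> over the graph of \<open>h\<close>, the area element of a graph being the square root
  of \<open>1 + |grad h|^2\<close> times Lebesgue measure in the coordinates other than the \<open>k\<close>-th. The
  integrand does not depend on the \<open>k\<close>-th coordinate, so that integrating over the slab of
  thickness 1 amounts to integrating over these remaining coordinates (for \<open>m = 1\<close>, to
  evaluating at a point).\<close>

definition graph_integral :: "'m \<Rightarrow> (real^'m \<Rightarrow> real) \<Rightarrow> (real^'m \<Rightarrow> real) \<Rightarrow> real" where
  "graph_integral k h f = integral {y. 0 \<le> y $ k \<and> y $ k \<le> 1}
     (\<lambda>y. f (set_coord k (h y) y) * sqrt (1 + (norm (grad_in UNIV h y))\<^sup>2))"

definition boundary_partition ::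
  "(real^'m) set \<Rightarrow> nat \<times> (nat \<Rightarrow> 'm) \<times> (nat \<Rightarrow> real^'m \<Rightarrow> real) \<times> (nat \<Rightarrow> real^'m \<Rightarrow> real) \<Rightarrow> bool"
  where
  "boundary_partition B = (\<lambda>(N, k, h, \<eta>).
     (\<forall>i<N. smooth (\<eta> i) \<and> (\<forall>x. 0 \<le> \<eta> i x) \<and> compact (closure {x. \<eta> i x \<noteq> 0}) \<and>
        (\<exists>U s. graph_patch B U (k i) s (h i) \<and> closure {x. \<eta> i x \<noteq> 0} \<subseteq> U)) \<and>
     (\<forall>x\<in>frontier B. (\<Sum>i<N. \<eta> i x) = 1))"

text \<open>As usual, the integral is defined by a partition of unity subordinate to a cover of the
  boundary by graph patches. For continuous \<open>f\<close> the value does not depend on the choice.\<close>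

definition boundary_integral :: "(real^'m) set \<Rightarrow> (real^'m \<Rightarrow> real) \<Rightarrow> real" where
  "boundary_integral B f =
     (case (SOME P. boundary_partition B P) of (N, k, h, \<eta>) \<Rightarrow>
        \<Sum>i<N. graph_integral (k i) (h i) (\<lambda>x. \<eta> i x * f x))"


section \<open>The space of smooth functions and its restricted dual\<close>

text \<open>Functions on a set \<open>S\<close> are represented by total functions vanishing outside \<open>S\<close>, so that
  equality of representatives is equality of functions on \<open>S\<close>.\<close>

type_synonym 'm fld = "real^'m \<Rightarrow> real"

definition Cinf :: "(real^'m) set \<Rightarrow> 'm fld set" where
  "Cinf S = {f. smooth_within S f \<and> (\<forall>x. x \<notin> S \<longrightarrow> f x = 0)}"

definition restr :: "(real^'m) set \<Rightarrow> 'm fld \<Rightarrow> 'm fld" where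
  "restr S f = (\<lambda>x. if x \<in> S then f x else 0)"

definition Vstar :: "(real^'m) set \<Rightarrow> ('m fld \<times> 'm fld) set" where
  "Vstar B = Cinf B \<times> Cinf (frontier B)"

definition pairing :: "(real^'m) set \<Rightarrow> 'm fld \<times> 'm fld \<Rightarrow> 'm fld \<Rightarrow> real" where
  "pairing B a \<phi> = integral B (\<lambda>x. fst a x * \<phi> x) + boundary_integral B (\<lambda>x. snd a x * \<phi> x)"

definition fadd :: "'m fld \<Rightarrow> real \<Rightarrow> 'm fld \<Rightarrow> 'm fld" where
  "fadd \<phi> \<epsilon> \<delta> = (\<lambda>x. \<phi> x + \<epsilon> * \<delta> x)"

text \<open>Smooth curves in the Frechet space \<open>Cinf S\<close>, parametrized by a closed set \<open>T\<close> of times,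
  are the curves of smooth functions that are jointly smooth in time and space. Only the values
  at times in \<open>T\<close> matter.\<close>

definition smooth_curve :: "real set \<Rightarrow> (real^'m) set \<Rightarrow> (real \<Rightarrow> 'm fld) \<Rightarrow> bool" where
  "smooth_curve T S c \<longleftrightarrow> (\<forall>t\<in>T. c t \<in> Cinf S) \<and> smooth_within (T \<times> S) (\<lambda>(t, x). c t x)"

definition tder :: "real set \<Rightarrow> (real \<Rightarrow> 'm fld) \<Rightarrow> real \<Rightarrow> 'm fld" where
  "tder T c t = (\<lambda>x. vector_derivative (\<lambda>s. c s x) (at t within T))"

definition cadd :: "(real \<Rightarrow> 'm fld) \<Rightarrow> real \<Rightarrow> (real \<Rightarrow> 'm fld) \<Rightarrow> real \<Rightarrow> 'm fld" where
  "cadd c \<epsilon> \<delta> = (\<lambda>t. fadd (c t) \<epsilon> (\<delta> t))"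

text \<open>A map between Frechet spaces is smooth iff it maps smooth curves (on the real line) to smooth
  curves.\<close>

definition smooth_force ::
  "(real^'m) set \<Rightarrow> ('m fld \<Rightarrow> 'm fld \<Rightarrow> 'm fld) \<Rightarrow> ('m fld \<Rightarrow> 'm fld \<Rightarrow> 'm fld) \<Rightarrow> bool" where
  "smooth_force B F Fb \<longleftrightarrow>
     (\<forall>\<phi>\<in>Cinf B. \<forall>\<nu>\<in>Cinf B. (F \<phi> \<nu>, Fb \<phi> \<nu>) \<in> Vstar B) \<and>
     (\<forall>\<phi> \<nu>. smooth_curve UNIV B \<phi> \<and> smooth_curve UNIV B \<nu> \<longrightarrow>
        smooth_curve UNIV B (\<lambda>t. F (\<phi> t) (\<nu> t)) \<and>
        smooth_curve UNIV (frontier B) (\<lambda>t. Fb (\<phi> t) (\<nu> t)))"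


section \<open>Lagrangians defined through a density\<close>

type_synonym 'm density = "real \<times> real \<times> (real^'m) \<Rightarrow> real"

definition Lag :: "(real^'m) set \<Rightarrow> 'm density \<Rightarrow> 'm fld \<Rightarrow> 'm fld \<Rightarrow> real" where
  "Lag B l \<phi> \<nu> = integral B (\<lambda>x. l (\<phi> x, \<nu> x, grad_in B \<phi> x))"

definition d1 :: "(real^'m) set \<Rightarrow> 'm density \<Rightarrow> 'm fld \<Rightarrow> 'm fld \<Rightarrow> 'm fld" where
  "d1 B l \<phi> \<nu> x = deriv (\<lambda>a. l (a, \<nu> x, grad_in B \<phi> x)) (\<phi> x)"

definition d2 :: "(real^'m) set \<Rightarrow> 'm density \<Rightarrow> 'm fld \<Rightarrow> 'm fld \<Rightarrow> 'm fld" where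
  "d2 B l \<phi> \<nu> x = deriv (\<lambda>b. l (\<phi> x, b, grad_in B \<phi> x)) (\<nu> x)"

definition d3 :: "(real^'m) set \<Rightarrow> 'm density \<Rightarrow> 'm fld \<Rightarrow> 'm fld \<Rightarrow> real^'m \<Rightarrow> real^'m" where
  "d3 B l \<phi> \<nu> x = grad_in UNIV (\<lambda>w. l (\<phi> x, \<nu> x, w)) (grad_in B \<phi> x)"

text \<open>The functional derivatives, as elements of the restricted dual.\<close>

definition fder_phi :: "(real^'m) set \<Rightarrow> 'm density \<Rightarrow> 'm fld \<Rightarrow> 'm fld \<Rightarrow> 'm fld \<times> 'm fld" where
  "fder_phi B l \<phi> \<nu> = (THE a. a \<in> Vstar B \<and> (\<forall>\<delta>\<phi>\<in>Cinf B.
     ((\<lambda>\<epsilon>. Lag B l (fadd \<phi> \<epsilon> \<delta>\<phi>) \<nu>) has_real_derivative pairing B a \<delta>\<phi>) (at 0)))"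

definition fder_nu :: "(real^'m) set \<Rightarrow> 'm density \<Rightarrow> 'm fld \<Rightarrow> 'm fld \<Rightarrow> 'm fld \<times> 'm fld" where
  "fder_nu B l \<phi> \<nu> = (THE a. a \<in> Vstar B \<and> (\<forall>\<delta>\<nu>\<in>Cinf B.
     ((\<lambda>\<epsilon>. Lag B l \<phi> (fadd \<nu> \<epsilon> \<delta>\<nu>)) has_real_derivative pairing B a \<delta>\<nu>) (at 0)))"


section \<open>Variational principles and equations of motion\<close>

definition LdA_principle where
  "LdA_principle B l F Fb t0 t1 (\<phi> :: real \<Rightarrow> 'm::finite fld) \<longleftrightarrow>
     (\<forall>\<delta>\<phi>. smooth_curve {t0..t1} B \<delta>\<phi> \<and> \<delta>\<phi> t0 = (\<lambda>x. 0) \<and> \<delta>\<phi> t1 = (\<lambda>x. 0) \<longrightarrow>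
        (\<exists>d. ((\<lambda>\<epsilon>. integral {t0..t1}
                 (\<lambda>t. Lag B l (cadd \<phi> \<epsilon> \<delta>\<phi> t) (tder {t0..t1} (cadd \<phi> \<epsilon> \<delta>\<phi>) t)))
               has_real_derivative d) (at 0) \<and>
             d + integral {t0..t1} (\<lambda>t. pairing B
                   (F (\<phi> t) (tder {t0..t1} \<phi> t), Fb (\<phi> t) (tder {t0..t1} \<phi> t)) (\<delta>\<phi> t)) = 0))"

definition LdA_equations where
  "LdA_equations B l F Fb t0 t1 (\<phi> :: real \<Rightarrow> 'm::finite fld) \<longleftrightarrow>
     (let \<phi>' = tder {t0..t1} \<phi> in
      \<forall>t\<in>{t0..t1}.
        (\<forall>x\<in>B. tder {t0..t1} (\<lambda>s. d2 B l (\<phi> s) (\<phi>' s)) t x =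
             d1 B l (\<phi> t) (\<phi>' t) x - div_in B (d3 B l (\<phi> t) (\<phi>' t)) x + F (\<phi> t) (\<phi>' t) x) \<and>
        (\<forall>x\<in>frontier B. Fb (\<phi> t) (\<phi>' t) x = - (d3 B l (\<phi> t) (\<phi>' t) x \<bullet> outward_normal B x)))"

text \<open>The action functional of the Pontryagin principle, without the force term.\<close>

definition pontryagin_action where
  "pontryagin_action B l t0 t1 (\<phi> :: real \<Rightarrow> 'm::finite fld) \<nu> \<alpha> \<alpha>b =
     integral {t0..t1} (\<lambda>t. Lag B l (\<phi> t) (\<nu> t) +
       pairing B (\<alpha> t, \<alpha>b t) (\<lambda>x. tder {t0..t1} \<phi> t x - \<nu> t x))"

definition LdAP_principle where
  "LdAP_principle B l F Fb t0 t1 (\<phi> :: real \<Rightarrow> 'm::finite fld) \<nu> \<alpha> \<alpha>b \<longleftrightarrow>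
     (\<forall>\<delta>\<phi> \<delta>\<nu> \<delta>\<alpha> \<delta>\<alpha>b.
        smooth_curve {t0..t1} B \<delta>\<phi> \<and> smooth_curve {t0..t1} B \<delta>\<nu> \<and>
        smooth_curve {t0..t1} B \<delta>\<alpha> \<and> smooth_curve {t0..t1} (frontier B) \<delta>\<alpha>b \<and>
        \<delta>\<phi> t0 = (\<lambda>x. 0) \<and> \<delta>\<phi> t1 = (\<lambda>x. 0) \<longrightarrow>
        (\<exists>d. ((\<lambda>\<epsilon>. pontryagin_action B l t0 t1
                 (cadd \<phi> \<epsilon> \<delta>\<phi>) (cadd \<nu> \<epsilon> \<delta>\<nu>) (cadd \<alpha> \<epsilon> \<delta>\<alpha>) (cadd \<alpha>b \<epsilon> \<delta>\<alpha>b))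
               has_real_derivative d) (at 0) \<and>
             d + integral {t0..t1} (\<lambda>t. pairing B (F (\<phi> t) (\<nu> t), Fb (\<phi> t) (\<nu> t)) (\<delta>\<phi> t)) = 0))"

definition LdAP_equations where
  "LdAP_equations B l F Fb t0 t1 (\<phi> :: real \<Rightarrow> 'm::finite fld) \<nu> \<alpha> \<alpha>b \<longleftrightarrow>
     (\<forall>t\<in>{t0..t1}.
        (\<forall>x\<in>B.
           tder {t0..t1} \<phi> t x = \<nu> t x \<and>
           \<alpha> t x = d2 B l (\<phi> t) (\<nu> t) x \<and>
           tder {t0..t1} \<alpha> t x =
             d1 B l (\<phi> t) (\<nu> t) x - div_in B (d3 B l (\<phi> t) (\<nu> t)) x + F (\<phi> t) (\<nu> t) x) \<and>
        (\<forall>x\<in>frontier B.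
           \<alpha>b t x = 0 \<and>
           tder {t0..t1} \<alpha>b t x =
             d3 B l (\<phi> t) (\<nu> t) x \<bullet> outward_normal B x + Fb (\<phi> t) (\<nu> t) x))"


section \<open>The canonical Dirac structure and the Lagrange-Dirac system\<close>

type_synonym 'm base = "'m fld \<times> ('m fld \<times> 'm fld)"
type_synonym 'm tangent = "'m base \<times> ('m fld \<times> ('m fld \<times> 'm fld))"
type_synonym 'm cotangent = "'m base \<times> (('m fld \<times> 'm fld) \<times> 'm fld)"

text \<open>The canonical form does not depend on the base point, which is therefore omitted.\<close>

definition canonical_form ::
  "(real^'m) set \<Rightarrow> 'm fld \<times> ('m fld \<times> 'm fld) \<Rightarrow> 'm fld \<times> ('m fld \<times> 'm fld) \<Rightarrow> real" where
  "canonical_form B = (\<lambda>(\<phi>', a') (\<delta>\<phi>, \<delta>a). pairing B \<delta>a \<phi>' - pairing B a' \<delta>\<phi>)"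

definition cotangent_pairing ::
  "(real^'m) set \<Rightarrow> ('m fld \<times> 'm fld) \<times> 'm fld \<Rightarrow> 'm fld \<times> ('m fld \<times> 'm fld) \<Rightarrow> real" where
  "cotangent_pairing B = (\<lambda>(b, u) (\<delta>\<phi>, \<delta>a). pairing B b \<delta>\<phi> + pairing B \<delta>a u)"

text \<open>The fibre over \<open>p\<close> of the graph of the flat map of the canonical form.\<close>

definition canonical_dirac :: "(real^'m) set \<Rightarrow> 'm base \<Rightarrow> ('m tangent \<times> 'm cotangent) set" where
  "canonical_dirac B p =
     {((p, X), (p, \<xi>)) | X \<xi>. X \<in> Cinf B \<times> Vstar B \<and> \<xi> \<in> Vstar B \<times> Cinf B \<and>
        (\<forall>Y \<in> Cinf B \<times> Vstar B. canonical_form B X Y = cotangent_pairing B \<xi> Y)}"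

definition dirac_differential ::
  "(real^'m) set \<Rightarrow> 'm density \<Rightarrow> 'm fld \<Rightarrow> 'm fld \<Rightarrow> 'm cotangent" where
  "dirac_differential B l \<phi> \<nu> =
     ((\<phi>, fder_nu B l \<phi> \<nu>),
      ((\<lambda>x. - fst (fder_phi B l \<phi> \<nu>) x, \<lambda>x. - snd (fder_phi B l \<phi> \<nu>) x), \<nu>))"

definition force_field where
  "force_field B l F Fb (\<phi> :: 'm::finite fld) \<nu> =
     ((\<phi>, (restr B (d2 B l \<phi> \<nu>), \<lambda>x. 0)),
      ((F \<phi> \<nu>, Fb \<phi> \<nu>), \<lambda>x. 0))"

text \<open>Difference in the fibre; meaningful for arguments with the same base point.\<close>

definition fibre_diff :: "'m cotangent \<Rightarrow> 'm cotangent \<Rightarrow> 'm cotangent" where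
  "fibre_diff = (\<lambda>(p, ((b, bb), u)) (q, ((c, cb), w)).
     (p, ((\<lambda>x. b x - c x, \<lambda>x. bb x - cb x), \<lambda>x. u x - w x)))"

definition Lagrange_Dirac where
  "Lagrange_Dirac B l F Fb t0 t1 (\<phi> :: real \<Rightarrow> 'm::finite fld) \<nu> \<alpha> \<alpha>b \<longleftrightarrow>
     (\<forall>t\<in>{t0..t1}.
        (((\<phi> t, (\<alpha> t, \<alpha>b t)),
          (tder {t0..t1} \<phi> t, (tder {t0..t1} \<alpha> t, tder {t0..t1} \<alpha>b t))),
         fibre_diff (dirac_differential B l (\<phi> t) (\<nu> t)) (force_field B l F Fb (\<phi> t) (\<nu> t)))
        \<in> canonical_dirac B (\<phi> t, (\<alpha> t, \<alpha>b t)))"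

end

theory Submission
  imports Defs
begin

text \<open>Both principles say that a first variation vanishes. Differentiating under the integral and
  integrating by parts, in time with the vanishing endpoint variations and in space by the divergence
  theorem, turns this variation into a sum of one integral over the domain and one over its boundary,
  each of them linear in the test functions. The integrals over the domain and over its boundary
  (and over their products with the time interval) are strictly positive functionals on continuous
  functions, so that testing against a bump function times the residual, first in the interior and
  then on the boundary, shows that the residuals vanish pointwise. The same nondegeneracy of the
  pairing identifies the functional derivatives and unfolds the Dirac inclusion.

  The divergence theorem is obtained from translation invariance of Lebesgue measure: the integral of a
  directional derivative of a compactly supported Lipschitz function is zero. In a graph patch this is
  applied to the vector field cut off by a ramp of width \<open>\<epsilon>\<close> along the boundary, and \<open>\<epsilon>\<close> tends to
  zero; the remainder, which vanishes on the boundary, is Lipschitz after extension by zero.\<close>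


section \<open>Calculus of smooth functions\<close>

text \<open>Two features of the setting shape the work. Fields live only on \<open>B\<close> or on
  \<open>frontier B\<close>, and a derivative relative to a set is a choice among candidates. Every
  field is therefore replaced by a smooth function on the whole space, and uniqueness of derivatives
  at boundary points shows that the values on \<open>B\<close> are those of any such extension. The
  outward normal and the boundary integral come from choice operators. Graph patches turn the normal
  into an explicit formula, and the partition behind the integral is also the one that localises the
  divergence theorem.

  The link between the statements on \<open>\<phi>\<close> alone and those on the full curve rests
  on the boundary momentum. The density contains no spatial derivative of \<open>\<nu>\<close>, so
  stationarity in \<open>\<nu>\<close> yields no boundary term from the Lagrangian and forces
  \<open>\<alpha>b = 0\<close>. The evolution equation of \<open>\<alpha>b\<close> then degenerates
  into the boundary condition of (ii). Hence \<open>\<phi>\<close> determines the remaining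
  components, and the link is the existence of a completion of \<open>\<phi>\<close>.\<close>

lemma Ck_SucI:
  assumes "\<And>x. (f has_derivative f' x) (at x)" and "\<And>v. Ck n (\<lambda>x. f' x v)"
  shows "Ck (Suc n) f"
proof -
  have "frechet_derivative f (at x) = f' x" for x
    using frechet_derivative_at[OF assms(1)] by simp
  then show ?thesis
    using assms by (auto simp: differentiable_def)
qed

lemma Ck_SucD:
  assumes "Ck (Suc n) f"
  shows "(f has_derivative frechet_derivative f (at x)) (at x)"
    and "Ck n (\<lambda>x. frechet_derivative f (at x) v)"
  using assms by (auto simp: frechet_derivative_works)

lemma Ck_continuous: "Ck n f \<Longrightarrow> continuous_on UNIV f"
  by (cases n) (auto simp: continuous_on_eq_continuous_at differentiable_imp_continuous_within)

lemma Ck_lower: "Ck (Suc n) f \<Longrightarrow> Ck n f"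
proof (induction n arbitrary: f)
  case 0
  then show ?case using Ck_continuous[of "Suc 0" f] by simp
next
  case (Suc n)
  then show ?case unfolding Ck.simps(2)[of "Suc n" f] Ck.simps(2)[of n f] by blast
qed

lemma Ck_const: "Ck n (\<lambda>x. c)"
proof (induction n arbitrary: c)
  case (Suc n)
  then show ?case by (intro Ck_SucI[where f' = "\<lambda>x v. 0"]) auto
qed auto

lemma Ck_bounded_linear: "bounded_linear f \<Longrightarrow> Ck n f"
proof (cases n)
  case 0
  assume "bounded_linear f"
  then show ?thesis using 0 by (auto intro: linear_continuous_on)
next
  case (Suc m)
  assume f: "bounded_linear f"
  show ?thesis unfolding Suc
    by (rule Ck_SucI[where f' = "\<lambda>x. f"]) (auto intro: Ck_const f bounded_linear_imp_has_derivative)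
qed

lemma Ck_linear_image:
  assumes "bounded_linear g" "Ck n f"
  shows "Ck n (\<lambda>x. g (f x))"
  using assms(2)
proof (induction n arbitrary: f)
  case 0
  then show ?case using assms(1) by (auto intro: bounded_linear.continuous_on)
next
  case (Suc n)
  show ?case
    by (rule Ck_SucI[where f' = "\<lambda>x v. g (frechet_derivative f (at x) v)"])
      (intro bounded_linear.has_derivative[OF assms(1)] Ck_SucD[OF Suc.prems] Suc.IH)+
qed

lemma Ck_add: "Ck n f \<Longrightarrow> Ck n g \<Longrightarrow> Ck n (\<lambda>x. f x + g x)"
proof (induction n arbitrary: f g)
  case 0
  then show ?case by (auto intro: continuous_intros)
next
  case (Suc n)
  show ?case
    by (rule Ck_SucI[OF has_derivative_add[OF Ck_SucD(1)[OF Suc.prems(1)] Ck_SucD(1)[OF Suc.prems(2)]]])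
      (intro Suc.IH Ck_SucD(2)[OF Suc.prems(1)] Ck_SucD(2)[OF Suc.prems(2)])
qed

lemma Ck_sum: "(\<And>i. i \<in> A \<Longrightarrow> Ck n (f i)) \<Longrightarrow> Ck n (\<lambda>x. \<Sum>i\<in>A. f i x)"
proof (induction A rule: infinite_finite_induct)
  case (insert i A)
  then show ?case by (simp add: Ck_add)
qed (auto intro: Ck_const)

lemma Ck_scaleR: "Ck n a \<Longrightarrow> Ck n f \<Longrightarrow> Ck n (\<lambda>x. a x *\<^sub>R f x)"
proof (induction n arbitrary: a f)
  case 0
  then show ?case by (auto intro: continuous_intros)
next
  case (Suc n)
  show ?case
    by (rule Ck_SucI[OF has_derivative_scaleR[OF Ck_SucD(1)[OF Suc.prems(1)] Ck_SucD(1)[OF Suc.prems(2)]]])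
      (intro Ck_add Suc.IH Ck_SucD(2)[OF Suc.prems(1)] Ck_SucD(2)[OF Suc.prems(2)]
        Ck_lower[OF Suc.prems(1)] Ck_lower[OF Suc.prems(2)])
qed

lemma linear_eq_sum_Basis:
  fixes v :: "'a::euclidean_space"
  assumes "linear f"
  shows "f v = (\<Sum>b\<in>Basis. (v \<bullet> b) *\<^sub>R f b)"
proof -
  have "f v = f (\<Sum>b\<in>Basis. (v \<bullet> b) *\<^sub>R b)"
    by (simp add: euclidean_representation)
  also have "\<dots> = (\<Sum>b\<in>Basis. (v \<bullet> b) *\<^sub>R f b)"
    using assms by (simp add: linear_sum linear_cmul o_def)
  finally show ?thesis .
qed

text \<open>The chain rule applies the derivative of \<open>g\<close> to a direction that varies
  with \<open>x\<close>, whereas \<open>Ck\<close> controls derivatives along fixed directions.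
  Expanding the direction in a basis of the intermediate space, Euclidean for this reason, reduces
  the induction step to sums of products.\<close>

lemma Ck_compose:
  fixes f :: "'a::real_normed_vector \<Rightarrow> 'b::euclidean_space"
  shows "Ck n g \<Longrightarrow> Ck n f \<Longrightarrow> Ck n (\<lambda>x. g (f x))"
proof (induction n arbitrary: f g)
  case 0
  then show ?case by (auto intro: continuous_on_compose2)
next
  case (Suc n)
  have lin: "linear (frechet_derivative g (at y))" for y
    using Ck_SucD(1)[OF Suc.prems(1)] has_derivative_linear by blast
  show ?case
  proof (rule Ck_SucI)
    show "((\<lambda>x. g (f x)) has_derivative
        (\<lambda>v. frechet_derivative g (at (f x)) (frechet_derivative f (at x) v))) (at x)" for x
      by (rule has_derivative_compose[OF Ck_SucD(1)[OF Suc.prems(2)] Ck_SucD(1)[OF Suc.prems(1)]])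
    have "Ck n (\<lambda>x. \<Sum>b\<in>Basis. (frechet_derivative f (at x) v \<bullet> b) *\<^sub>R frechet_derivative g (at (f x)) b)" for v
      by (intro Ck_sum Ck_scaleR Suc.IH Ck_SucD(2)[OF Suc.prems(1)] Ck_lower[OF Suc.prems(2)]
          Ck_linear_image[OF bounded_linear_inner_left] Ck_SucD(2)[OF Suc.prems(2)])
    then show "Ck n (\<lambda>x. frechet_derivative g (at (f x)) (frechet_derivative f (at x) v))" for v
      by (subst linear_eq_sum_Basis[OF lin])
  qed
qed

lemma Ck_inverse:
  fixes f :: "'a::real_normed_vector \<Rightarrow> real"
  shows "Ck n f \<Longrightarrow> (\<And>x. f x \<noteq> 0) \<Longrightarrow> Ck n (\<lambda>x. inverse (f x))"
proof (induction n arbitrary: f)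
  case 0
  then show ?case by (auto intro: continuous_intros)
next
  case (Suc n)
  have inv: "Ck n (\<lambda>x. inverse (f x))"
    using Suc.IH[OF Ck_lower[OF Suc.prems(1)] Suc.prems(2)] .
  show ?case
  proof (rule Ck_SucI)
    show "((\<lambda>x. inverse (f x)) has_derivative
       (\<lambda>h. - (inverse (f x) * frechet_derivative f (at x) h * inverse (f x)))) (at x)" for x
      by (rule Deriv.has_derivative_inverse[OF Suc.prems(2) Ck_SucD(1)[OF Suc.prems(1)]])
    have "Ck n (\<lambda>x. (-1) *\<^sub>R (inverse (f x) *\<^sub>R frechet_derivative f (at x) v *\<^sub>R inverse (f x)))" for v
      by (intro Ck_scaleR Ck_const inv Ck_SucD(2)[OF Suc.prems(1)])
    then show "Ck n (\<lambda>x. - (inverse (f x) * frechet_derivative f (at x) v * inverse (f x)))" for v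
      by (simp add: mult.assoc)
  qed
qed

lemma Ck_sqrt:
  fixes f :: "'a::real_normed_vector \<Rightarrow> real"
  shows "Ck n f \<Longrightarrow> (\<And>x. f x > 0) \<Longrightarrow> Ck n (\<lambda>x. sqrt (f x))"
proof (induction n arbitrary: f)
  case 0
  then show ?case by (auto intro: continuous_intros)
next
  case (Suc n)
  have "Ck n (\<lambda>x. inverse (sqrt (f x)))"
    using Suc.IH[OF Ck_lower[OF Suc.prems(1)] Suc.prems(2)] Suc.prems(2)
    by (intro Ck_inverse) (auto simp: less_imp_neq[symmetric])
  then have *: "Ck n (\<lambda>x. (1 / 2) *\<^sub>R (inverse (sqrt (f x)) *\<^sub>R frechet_derivative f (at x) v))" for v
    by (intro Ck_scaleR Ck_const Ck_SucD(2)[OF Suc.prems(1)])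
  show ?case
  proof (rule Ck_SucI)
    show "((\<lambda>x. sqrt (f x)) has_derivative
        (\<lambda>v. (1 / 2) *\<^sub>R (inverse (sqrt (f x)) *\<^sub>R frechet_derivative f (at x) v))) (at x)" for x
      by (rule has_derivative_eq_rhs[OF has_derivative_real_sqrt[OF _ Ck_SucD(1)[OF Suc.prems(1)]]])
        (use Suc.prems(2) in \<open>auto simp: field_simps\<close>)
  qed (rule *)
qed

section \<open>Smooth maps\<close>

named_theorems smooth_intros

lemma smooth_continuous: "smooth f \<Longrightarrow> continuous_on S f"
  unfolding smooth_def using Ck_continuous continuous_on_subset by blast

lemma smooth_has_derivative:
  "smooth f \<Longrightarrow> (f has_derivative frechet_derivative f (at x)) (at x within S)"
  unfolding smooth_def using Ck_SucD(1) has_derivative_at_withinI by blast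

lemma smooth_differentiable: "smooth f \<Longrightarrow> f differentiable (at x within S)"
  using smooth_has_derivative differentiable_def by blast

lemma smooth_const [smooth_intros]: "smooth (\<lambda>x. c)"
  by (simp add: smooth_def Ck_const)

lemma smooth_linear: "bounded_linear f \<Longrightarrow> smooth f"
  by (simp add: smooth_def Ck_bounded_linear)

lemma smooth_linear_image: "bounded_linear g \<Longrightarrow> smooth f \<Longrightarrow> smooth (\<lambda>x. g (f x))"
  by (simp add: smooth_def Ck_linear_image)

lemma smooth_ident [smooth_intros]: "smooth (\<lambda>x. x)"
  by (intro smooth_linear bounded_linear_ident)

lemma smooth_add [smooth_intros]: "smooth f \<Longrightarrow> smooth g \<Longrightarrow> smooth (\<lambda>x. f x + g x)"
  by (simp add: smooth_def Ck_add)

lemma smooth_minus [smooth_intros]: "smooth f \<Longrightarrow> smooth (\<lambda>x. - f x)"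
  using smooth_linear_image[OF bounded_linear_minus[OF bounded_linear_ident]] .

lemma smooth_diff [smooth_intros]: "smooth f \<Longrightarrow> smooth g \<Longrightarrow> smooth (\<lambda>x. f x - g x)"
  using smooth_add[of f "\<lambda>x. - g x"] smooth_minus[of g] by simp

lemma smooth_sum [smooth_intros]:
  "(\<And>i. i \<in> A \<Longrightarrow> smooth (f i)) \<Longrightarrow> smooth (\<lambda>x. \<Sum>i\<in>A. f i x)"
  by (simp add: smooth_def Ck_sum)

lemma smooth_scaleR [smooth_intros]: "smooth a \<Longrightarrow> smooth f \<Longrightarrow> smooth (\<lambda>x. a x *\<^sub>R f x)"
  by (simp add: smooth_def Ck_scaleR)

lemma smooth_mult [smooth_intros]:
  fixes f :: "'a::real_normed_vector \<Rightarrow> real"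
  shows "smooth f \<Longrightarrow> smooth g \<Longrightarrow> smooth (\<lambda>x. f x * g x)"
  using smooth_scaleR[of f g] by simp

lemma smooth_compose:
  fixes f :: "'a::real_normed_vector \<Rightarrow> 'b::euclidean_space"
  shows "smooth g \<Longrightarrow> smooth f \<Longrightarrow> smooth (\<lambda>x. g (f x))"
  by (simp add: smooth_def Ck_compose)

lemma smooth_divide [smooth_intros]:
  fixes f :: "'a::real_normed_vector \<Rightarrow> real"
  shows "smooth f \<Longrightarrow> smooth g \<Longrightarrow> (\<And>x. g x \<noteq> 0) \<Longrightarrow> smooth (\<lambda>x. f x / g x)"
  unfolding divide_inverse by (intro smooth_mult) (simp_all add: smooth_def Ck_inverse)

lemma smooth_sqrt [smooth_intros]:
  fixes f :: "'a::real_normed_vector \<Rightarrow> real"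
  shows "smooth f \<Longrightarrow> (\<And>x. f x > 0) \<Longrightarrow> smooth (\<lambda>x. sqrt (f x))"
  by (simp add: smooth_def Ck_sqrt)

lemma smooth_Pair [smooth_intros]:
  assumes "smooth f" "smooth g"
  shows "smooth (\<lambda>x. (f x, g x))"
proof -
  have "smooth (\<lambda>x. (f x, 0) + (0, g x))"
    by (intro smooth_add smooth_linear_image[OF _ assms(1)] smooth_linear_image[OF _ assms(2)]
        bounded_linear_Pair bounded_linear_ident bounded_linear_zero)
  then show ?thesis by simp
qed

lemma smooth_fst [smooth_intros]: "smooth f \<Longrightarrow> smooth (\<lambda>x. fst (f x))"
  by (rule smooth_linear_image[OF bounded_linear_fst])

lemma smooth_snd [smooth_intros]: "smooth f \<Longrightarrow> smooth (\<lambda>x. snd (f x))"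
  by (rule smooth_linear_image[OF bounded_linear_snd])

lemma smooth_inner [smooth_intros]:
  fixes f :: "'a::real_normed_vector \<Rightarrow> 'b::euclidean_space"
  assumes "smooth f" "smooth g"
  shows "smooth (\<lambda>x. f x \<bullet> g x)"
proof -
  have "smooth (\<lambda>x. \<Sum>b\<in>Basis. (f x \<bullet> b) * (g x \<bullet> b))"
    by (intro smooth_intros smooth_linear_image[OF bounded_linear_inner_left] assms)
  also have "(\<lambda>x. \<Sum>b\<in>Basis. (f x \<bullet> b) * (g x \<bullet> b)) = (\<lambda>x. f x \<bullet> g x)"
    by (rule ext) (rule euclidean_inner[symmetric])
  finally show ?thesis .
qed

lemma smooth_nth [smooth_intros]:
  fixes f :: "'a::real_normed_vector \<Rightarrow> real^'n"
  shows "smooth f \<Longrightarrow> smooth (\<lambda>x. f x $ i)"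
  by (rule smooth_linear_image[OF bounded_linear_vec_nth])

lemma smooth_vec [smooth_intros]:
  fixes f :: "'n::finite \<Rightarrow> 'a::real_normed_vector \<Rightarrow> real"
  assumes "\<And>i. smooth (f i)"
  shows "smooth (\<lambda>x. \<chi> i. f i x)"
proof -
  have "smooth (\<lambda>x. \<Sum>i\<in>UNIV. f i x *\<^sub>R axis i (1::real))"
    by (intro smooth_intros assms)
  moreover have "(\<Sum>i\<in>UNIV. f i x *\<^sub>R axis i (1::real)) = (\<chi> i. f i x)" for x
    by (simp add: vec_eq_iff axis_def if_distrib cong: if_cong)
  ultimately show ?thesis by simp
qed

text \<open>Smoothness in base point and direction jointly again follows from expanding the
  direction in a basis. This is what makes gradients, divergences and derivatives along jets
  smooth.\<close>

lemma smooth_frechet_derivative [smooth_intros]: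
  fixes f :: "'a::euclidean_space \<Rightarrow> 'b::real_normed_vector" and p :: "'c::real_normed_vector \<Rightarrow> 'a"
  assumes "smooth f" "smooth p" "smooth v"
  shows "smooth (\<lambda>x. frechet_derivative f (at (p x)) (v x))"
proof -
  have "linear (frechet_derivative f (at x))" for x
    using smooth_has_derivative[OF assms(1), of x UNIV] has_derivative_linear by blast
  then have "frechet_derivative f (at (p x)) (v x) =
      (\<Sum>b\<in>Basis. (v x \<bullet> b) *\<^sub>R frechet_derivative f (at (p x)) b)" for x
    by (rule linear_eq_sum_Basis)
  moreover have "smooth (\<lambda>x. frechet_derivative f (at x) b)" for b
    using assms(1) Ck_SucD(2) unfolding smooth_def by blast
  then have "smooth (\<lambda>x. frechet_derivative f (at (p x)) b)" for b
    using assms(2) by (rule smooth_compose)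
  then have "smooth (\<lambda>x. \<Sum>b\<in>Basis. (v x \<bullet> b) *\<^sub>R frechet_derivative f (at (p x)) b)"
    by (intro smooth_sum smooth_scaleR smooth_inner smooth_const assms(3))
  ultimately show ?thesis by simp
qed

lemma smooth_grad [smooth_intros]:
  fixes f :: "real^'m \<Rightarrow> real"
  assumes "smooth f"
  shows "smooth (grad_in UNIV f)"
  unfolding grad_in_def by (intro smooth_intros assms)

lemma smooth_linear_derivative:
  "smooth f \<Longrightarrow> bounded_linear (frechet_derivative f (at x))"
  using smooth_has_derivative[of f x UNIV] has_derivative_bounded_linear by blast

lemma linear_eq_sum_axis:
  fixes f :: "real^'m \<Rightarrow> real"
  assumes "linear f"
  shows "f v = (\<Sum>i\<in>UNIV. v $ i * f (axis i 1))"
  using assms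
  by (subst basis_expansion[of v, symmetric])
    (simp add: linear_sum linear_cmul o_def scalar_mult_eq_scaleR)

lemma smooth_derivative_grad:
  fixes f :: "real^'m \<Rightarrow> real"
  assumes "smooth f"
  shows "frechet_derivative f (at x) v = grad_in UNIV f x \<bullet> v"
  using linear_eq_sum_axis[OF bounded_linear.linear[OF smooth_linear_derivative[OF assms]], of x v]
  by (simp add: grad_in_def inner_vec_def mult.commute)

section \<open>Flat functions and bump functions\<close>

text \<open>The factor \<open>1 / u ^ k\<close> closes the family under differentiation.\<close>

definition flat_exp :: "nat \<Rightarrow> real \<Rightarrow> real" where
  "flat_exp k u = (if u > 0 then exp (- 1 / u) / u ^ k else 0)"

lemma flat_exp_tendsto_0: "(flat_exp k \<longlongrightarrow> 0) (at 0)"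
proof -
  have "((\<lambda>u. inverse u ^ k / exp (inverse u)) \<longlongrightarrow> (0::real)) (at_right 0)"
    by (rule filterlim_compose[OF tendsto_power_div_exp_0 filterlim_inverse_at_top_right])
  moreover have "\<forall>\<^sub>F u::real in at_right 0. inverse u ^ k / exp (inverse u) = flat_exp k u"
    by (rule eventually_mono[OF eventually_at_right_less])
      (simp add: flat_exp_def exp_minus field_simps)
  ultimately have "(flat_exp k \<longlongrightarrow> 0) (at_right 0)"
    by (rule Lim_transform_eventually)
  moreover have "(flat_exp k \<longlongrightarrow> 0) (at_left 0)"
    by (rule tendsto_eventually) (auto simp: eventually_at_left_field flat_exp_def intro!: exI[of _ "-1"])
  ultimately show ?thesis by (intro filterlim_split_at)
qed

lemma flat_exp_has_derivative:
  "(flat_exp k has_real_derivative flat_exp (k + 2) u - real k * flat_exp (k + 1) u) (at u)"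
proof -
  consider "u > 0" | "u < 0" | "u = 0" by linarith
  then show ?thesis
  proof cases
    case 1
    have "((\<lambda>u. exp (- 1 / u)) has_real_derivative exp (- 1 / u) / u\<^sup>2) (at u)"
      using 1 by (auto intro!: derivative_eq_intros simp: power2_eq_square)
    from DERIV_divide[OF this DERIV_pow[of k]] 1
    have "((\<lambda>u. exp (- 1 / u) / u ^ k) has_real_derivative
        (exp (- 1 / u) / u\<^sup>2 * u ^ k - exp (- 1 / u) * (real k * u ^ (k - Suc 0))) / (u ^ k * u ^ k)) (at u)"
      by simp
    also have "(exp (- 1 / u) / u\<^sup>2 * u ^ k - exp (- 1 / u) * (real k * u ^ (k - Suc 0))) / (u ^ k * u ^ k) =
        flat_exp (k + 2) u - real k * flat_exp (k + 1) u"
      using 1 by (cases k) (auto simp: flat_exp_def field_simps power2_eq_square)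
    finally have "((\<lambda>u. exp (- 1 / u) / u ^ k) has_real_derivative
        flat_exp (k + 2) u - real k * flat_exp (k + 1) u) (at u)" .
    then show ?thesis
      by (rule DERIV_cong_ev[THEN iffD1, rotated -1, OF _ refl _ refl])
        (use 1 in \<open>auto simp: flat_exp_def intro!: eventually_mono[OF eventually_nhds_in_open[of "{0<..}" u]]\<close>)
  next
    case 2
    have "((\<lambda>u. 0) has_real_derivative flat_exp (k + 2) u - real k * flat_exp (k + 1) u) (at u)"
      using 2 by (auto simp: flat_exp_def)
    then show ?thesis
      by (rule DERIV_cong_ev[THEN iffD1, rotated -1, OF _ refl _ refl])
        (use 2 in \<open>auto simp: flat_exp_def intro!: eventually_mono[OF eventually_nhds_in_open[of "{..<0}" u]]\<close>)
  next
    case 3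
    \<comment> \<open>Division by \<open>h\<close> raises the index by one, so the difference
      quotient at 0 is itself a member of the family, with limit 0.\<close>
    have "(\<lambda>h. (flat_exp k (0 + h) - flat_exp k 0) / h) = flat_exp (k + 1)"
      by (auto simp: flat_exp_def fun_eq_iff)
    then show ?thesis
      using flat_exp_tendsto_0[of "k + 1"] 3 by (simp add: DERIV_def) (simp add: flat_exp_def)
  qed
qed

lemma Ck_flat_exp: "Ck n (flat_exp k)"
proof (induction n arbitrary: k)
  case 0
  show ?case
    by (simp add: continuous_on_eq_continuous_at) (blast intro: DERIV_isCont flat_exp_has_derivative)
next
  case (Suc n)
  show ?case
  proof (rule Ck_SucI)
    show "(flat_exp k has_derivative (\<lambda>v. (flat_exp (k + 2) u - real k * flat_exp (k + 1) u) * v)) (at u)" for u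
      using flat_exp_has_derivative unfolding has_field_derivative_def .
    have "Ck n (\<lambda>u. v *\<^sub>R (flat_exp (k + 2) u + (- real k) *\<^sub>R flat_exp (k + 1) u))" for v
      by (intro Ck_scaleR Ck_add Ck_const Suc.IH)
    then show "Ck n (\<lambda>u. (flat_exp (k + 2) u - real k * flat_exp (k + 1) u) * v)" for v
      by (simp add: algebra_simps)
  qed
qed

lemma smooth_flat_exp: "smooth (flat_exp k)"
  by (simp add: smooth_def Ck_flat_exp)

lemma flat_exp_0_pos: "flat_exp 0 u > 0 \<longleftrightarrow> u > 0" and flat_exp_0_nonneg: "flat_exp 0 u \<ge> 0"
  by (auto simp: flat_exp_def)

text \<open>The squared distance, unlike the distance, is smooth at the centre.\<close>

definition bump :: "'a::euclidean_space \<Rightarrow> real \<Rightarrow> 'a \<Rightarrow> real" where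
  "bump c r x = flat_exp 0 (r\<^sup>2 - (x - c) \<bullet> (x - c))"

lemma smooth_bump [smooth_intros]: "smooth (bump c r)"
  unfolding bump_def by (intro smooth_compose[OF smooth_flat_exp] smooth_intros)

lemma bump_nonneg: "bump c r x \<ge> 0"
  by (simp add: bump_def flat_exp_0_nonneg)

lemma bump_pos_iff: "r > 0 \<Longrightarrow> bump c r x > 0 \<longleftrightarrow> x \<in> ball c r"
proof -
  assume "r > 0"
  have "bump c r x > 0 \<longleftrightarrow> (norm (c - x))\<^sup>2 < r\<^sup>2"
    by (simp add: bump_def flat_exp_0_pos norm_minus_commute[of c] power2_norm_eq_inner)
  also have "\<dots> \<longleftrightarrow> norm (c - x) < r"
    using \<open>r > 0\<close> power2_less_imp_less[of "norm (c - x)" r] power_strict_mono[of "norm (c - x)" r 2]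
    by (auto simp del: power2_less_imp_less)
  finally show ?thesis by (simp add: dist_norm)
qed

lemma bump_support: "r > 0 \<Longrightarrow> {x. bump c r x \<noteq> 0} = ball c r"
  using bump_pos_iff[of r c] bump_nonneg[of c r] by (force simp: order.order_iff_strict)


section \<open>Geometry of smooth domains\<close>

lemma set_coord_eq: "set_coord k c y = y + (c - y $ k) *\<^sub>R axis k 1"
  by (simp add: set_coord_def vec_eq_iff axis_def)

lemma set_coord_nth [simp]: "set_coord k c y $ k = c"
  by (simp add: set_coord_def)

lemma set_coord_nth' [simp]: "j \<noteq> k \<Longrightarrow> set_coord k c y $ j = y $ j"
  by (simp add: set_coord_def)

lemma set_coord_self [simp]: "set_coord k (y $ k) y = y"
  by (simp add: set_coord_def vec_eq_iff)

lemma set_coord_set_coord [simp]: "set_coord k c (set_coord k d y) = set_coord k c y"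
  by (simp add: set_coord_def vec_eq_iff)

lemma has_derivative_nth: "((\<lambda>x. x $ k) has_derivative (\<lambda>v. v $ k)) F"
  by (rule bounded_linear_imp_has_derivative[OF bounded_linear_vec_nth])

lemma smooth_graph_map [smooth_intros]:
  "smooth c \<Longrightarrow> smooth y \<Longrightarrow> smooth (\<lambda>x. set_coord k (c x) (y x))"
  unfolding set_coord_eq by (intro smooth_intros)

lemma grad_axis_eq_0:
  assumes "smooth h" "\<And>y c. h (set_coord k c y) = h y"
  shows "grad_in UNIV h y $ k = 0"
proof -
  have "((\<lambda>t. h (y + t *\<^sub>R axis k 1)) has_derivative (\<lambda>t. frechet_derivative h (at y) (t *\<^sub>R axis k 1))) (at 0)"
  proof (rule has_derivative_compose[where g = h])
    show "((\<lambda>t. y + t *\<^sub>R axis k 1) has_derivative (\<lambda>t. t *\<^sub>R axis k 1)) (at (0::real))"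
      by (auto intro!: derivative_eq_intros)
    show "(h has_derivative frechet_derivative h (at y)) (at (y + 0 *\<^sub>R axis k 1))"
      using smooth_has_derivative[OF assms(1)] by simp
  qed
  moreover have "h (y + t *\<^sub>R axis k 1) = h y" for t
    using assms(2)[of "y $ k + t" y] by (simp add: set_coord_eq)
  ultimately have "((\<lambda>t::real. h y) has_derivative (\<lambda>t. frechet_derivative h (at y) (t *\<^sub>R axis k 1))) (at 0)"
    by simp
  then have "(\<lambda>t::real. frechet_derivative h (at y) (t *\<^sub>R axis k 1)) = (\<lambda>t. 0)"
    using has_derivative_unique has_derivative_const by blast
  from fun_cong[OF this, of 1] show ?thesis by (simp add: grad_in_def)
qed

text \<open>Translation along the \<open>k\<close>-th axis leaves \<open>h\<close> unchanged, hence
  its derivative too. Area factor and normal may thus be evaluated anywhere on a line parallel to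
  that axis.\<close>

lemma grad_set_coord:
  assumes "smooth h" "\<And>y c. h (set_coord k c y) = h y"
  shows "grad_in UNIV h (set_coord k c y) = grad_in UNIV h y"
proof -
  define a where "a = (c - y $ k) *\<^sub>R (axis k 1 :: real^'a)"
  have inv: "h (x + a) = h x" for x
    using assms(2)[of "x $ k + (c - y $ k)" x] by (simp add: set_coord_eq a_def)
  have "((\<lambda>x. h (x + a)) has_derivative frechet_derivative h (at (y + a))) (at y)"
  proof -
    have "((\<lambda>x. x + a) has_derivative (\<lambda>v. v)) (at y)"
      by (auto intro!: derivative_eq_intros)
    from has_derivative_compose[OF this smooth_has_derivative[OF assms(1)]] show ?thesis .
  qed
  then have "(h has_derivative frechet_derivative h (at (y + a))) (at y)"
    by (simp add: inv)
  then have "frechet_derivative h (at (y + a)) = frechet_derivative h (at y)"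
    by (rule frechet_derivative_at)
  then show ?thesis by (simp add: grad_in_def set_coord_eq a_def)
qed

text \<open>The normalised gradient of \<open>s * (x $ k - h x)\<close>, the function whose sign
  separates \<open>B\<close> from its complement in the patch. The formula makes sense on the whole
  space and there extends the normal smoothly.\<close>

definition patch_normal :: "'m \<Rightarrow> real \<Rightarrow> (real^'m \<Rightarrow> real) \<Rightarrow> real^'m \<Rightarrow> real^'m" where
  "patch_normal k s h x =
     (s / sqrt (1 + (norm (grad_in UNIV h x))\<^sup>2)) *\<^sub>R (axis k 1 - grad_in UNIV h x)"

section \<open>Inside a graph patch: interior, frontier, tangents and normal\<close>

context
  fixes B U :: "(real^'m) set" and k :: 'm and s :: real and h :: "real^'m \<Rightarrow> real"
  assumes patch: "graph_patch B U k s h"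
begin

lemma patchD: "open U" "s = 1 \<or> s = - 1" "smooth h" "h (set_coord k c y) = h y"
    "x \<in> U \<Longrightarrow> x \<in> B \<longleftrightarrow> s * x $ k \<le> s * h x"
  using patch unfolding graph_patch_def by blast+

lemma patch_interior:
  assumes "x \<in> U" "s * x $ k < s * h x"
  shows "x \<in> interior B"
proof (rule interiorI)
  have "open {x. s * x $ k < s * h x}"
    by (intro open_Collect_less continuous_intros smooth_continuous patchD linear_continuous_on[OF bounded_linear_vec_nth])
  then show "open (U \<inter> {x. s * x $ k < s * h x})" using patchD(1) by blast
  show "x \<in> U \<inter> {x. s * x $ k < s * h x}" using assms by simp
  show "U \<inter> {x. s * x $ k < s * h x} \<subseteq> B" using patchD(5) by force
qed

text \<open>The sign of \<open>s * (x $ k - h x)\<close> decides membership in \<open>B\<close>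
  within the patch. From a point where it vanishes, a line enters the interior if the slope is
  negative and leaves \<open>B\<close> if it is positive.\<close>

lemma patch_level_derivative:
  "((\<lambda>t. s * ((x + t *\<^sub>R v) $ k - h (x + t *\<^sub>R v))) has_real_derivative
      s * ((axis k 1 - grad_in UNIV h x) \<bullet> v)) (at 0)"
proof -
  have 1: "((\<lambda>t::real. x + t *\<^sub>R v) has_derivative (\<lambda>t. t *\<^sub>R v)) (at 0)"
    by (auto intro!: derivative_eq_intros)
  have 2: "((\<lambda>t. h (x + t *\<^sub>R v)) has_derivative (\<lambda>t. t * (grad_in UNIV h x \<bullet> v))) (at 0)"
    using has_derivative_compose[OF 1 smooth_has_derivative[OF patchD(3)]]
    by (simp add: smooth_derivative_grad[OF patchD(3)])
  show ?thesis
    unfolding has_field_derivative_def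
    by (rule has_derivative_eq_rhs[OF has_derivative_mult_right[OF has_derivative_diff[OF
          has_derivative_compose[OF 1 has_derivative_nth] 2]]])
      (auto simp: inner_diff_left inner_axis' algebra_simps)
qed

lemma patch_line_in_U:
  assumes "x \<in> U"
  obtains d where "d > 0" "\<And>t. \<bar>t\<bar> < d \<Longrightarrow> x + t *\<^sub>R v \<in> U"
proof -
  have "((\<lambda>t::real. x + t *\<^sub>R v) \<longlongrightarrow> x + 0 *\<^sub>R v) (at 0)"
    by (intro tendsto_intros)
  then have "\<forall>\<^sub>F t in at (0::real). x + t *\<^sub>R v \<in> U"
    using topological_tendstoD[OF _ patchD(1)] assms by fastforce
  then obtain d where "d > 0" "\<And>t. t \<noteq> 0 \<Longrightarrow> \<bar>t\<bar> < d \<Longrightarrow> x + t *\<^sub>R v \<in> U"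
    by (auto simp: eventually_at dist_real_def)
  then show thesis using that[of d] assms by (metis add.right_neutral scaleR_zero_left)
qed

lemma patch_enter:
  assumes "x \<in> U" "x $ k = h x" "s * ((axis k 1 - grad_in UNIV h x) \<bullet> v) < 0"
  obtains d where "d > 0" "\<And>t. 0 < t \<Longrightarrow> t < d \<Longrightarrow> x + t *\<^sub>R v \<in> interior B"
proof -
  obtain d1 where d1: "d1 > 0" "\<And>t. \<bar>t\<bar> < d1 \<Longrightarrow> x + t *\<^sub>R v \<in> U"
    using patch_line_in_U[OF assms(1)] by blast
  obtain d2 where d2: "d2 > 0" "\<And>t. 0 < t \<Longrightarrow> t < d2 \<Longrightarrow>
      s * ((x + t *\<^sub>R v) $ k - h (x + t *\<^sub>R v)) < 0"
    using DERIV_neg_dec_right[OF patch_level_derivative assms(3)] assms(2) by auto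
  show thesis
    by (rule that[of "min d1 d2"], use d1(1) d2(1) in simp, rule patch_interior)
      (use d1(2) d2(2) in \<open>force simp: algebra_simps\<close>)+
qed

lemma patch_leave:
  assumes "x \<in> U" "x $ k = h x" "s * ((axis k 1 - grad_in UNIV h x) \<bullet> v) > 0"
  obtains d where "d > 0" "\<And>t. 0 < t \<Longrightarrow> t < d \<Longrightarrow> x + t *\<^sub>R v \<notin> B"
proof -
  obtain d1 where d1: "d1 > 0" "\<And>t. \<bar>t\<bar> < d1 \<Longrightarrow> x + t *\<^sub>R v \<in> U"
    using patch_line_in_U[OF assms(1)] by blast
  obtain d2 where d2: "d2 > 0" "\<And>t. 0 < t \<Longrightarrow> t < d2 \<Longrightarrow>
      s * ((x + t *\<^sub>R v) $ k - h (x + t *\<^sub>R v)) > 0"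
    using DERIV_pos_inc_right[OF patch_level_derivative assms(3)] assms(2) by auto
  show thesis
  proof (rule that[of "min d1 d2"])
    show "x + t *\<^sub>R v \<notin> B" if "0 < t" "t < min d1 d2" for t
      using d1(2)[of t] d2(2)[of t] that patchD(5)[of "x + t *\<^sub>R v"] by (auto simp: algebra_simps)
  qed (use d1(1) d2(1) in simp)
qed

lemma patch_conormal_sqr:
  "(axis k 1 - grad_in UNIV h x) \<bullet> (axis k 1 - grad_in UNIV h x) = 1 + (norm (grad_in UNIV h x))\<^sup>2"
  using grad_axis_eq_0[of h k, OF patchD(3,4)]
  by (simp add: inner_diff_left inner_diff_right inner_axis inner_axis' power2_norm_eq_inner)

lemma patch_conormal_axis: "(axis k 1 - grad_in UNIV h x) \<bullet> (c *\<^sub>R axis k 1) = c"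
  using grad_axis_eq_0[of h k, OF patchD(3,4)] by (simp add: inner_diff_left inner_axis)

lemma patch_frontier:
  assumes "closed B" "x \<in> U"
  shows "x \<in> frontier B \<longleftrightarrow> x $ k = h x"
proof
  assume "x \<in> frontier B"
  then have "x \<in> B" "x \<notin> interior B" using assms(1) by (auto simp: frontier_def)
  then show "x $ k = h x"
    using patchD(5)[OF assms(2)] patch_interior[OF assms(2)] patchD(2) by force
next
  assume eq: "x $ k = h x"
  \<comment> \<open>The direction \<open>s *\<^sub>R axis k 1\<close> has slope 1 in the level
    function, so points outside \<open>B\<close> accumulate at \<open>x\<close>.\<close>
  obtain d where d: "d > 0" "\<And>t. 0 < t \<Longrightarrow> t < d \<Longrightarrow> x + t *\<^sub>R (s *\<^sub>R axis k 1) \<notin> B"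
    using patch_leave[OF assms(2) eq, of "s *\<^sub>R axis k 1"] patchD(2) patch_conormal_axis[of x s]
    by (metis mult_minus1_right mult_1 mult_minus1 minus_minus zero_less_one)
  have "x \<notin> interior B"
  proof
    assume "x \<in> interior B"
    then obtain e where e: "e > 0" "ball x e \<subseteq> B" by (auto simp: mem_interior)
    define t where "t = min (d / 2) (e / 2)"
    have t: "0 < t" "t < d" "t < e" using d(1) e(1) by (auto simp: t_def min_def)
    have "dist x (x + t *\<^sub>R (s *\<^sub>R axis k 1)) = t"
      using t(1) patchD(2) by (auto simp: dist_norm)
    then have "x + t *\<^sub>R (s *\<^sub>R axis k 1) \<in> ball x e" using t(3) by simp
    then show False using e(2) d(2)[OF t(1,2)] by blast
  qed
  moreover have "x \<in> B" using patchD(5)[OF assms(2)] eq by simp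
  ultimately show "x \<in> frontier B" using closure_subset by (auto simp: frontier_def)
qed

lemma patch_frontier_in_closure:
  assumes "x \<in> U" "x $ k = h x"
  shows "x \<in> closure (interior B)"
proof -
  obtain d where d: "d > 0" "\<And>t. 0 < t \<Longrightarrow> t < d \<Longrightarrow> x + t *\<^sub>R (- s *\<^sub>R axis k 1) \<in> interior B"
    using patch_enter[OF assms, of "- s *\<^sub>R axis k 1"] patchD(2) patch_conormal_axis[of x "- s"]
    by (metis mult_minus1_right mult_1 mult_minus1 minus_minus neg_less_0_iff_less zero_less_one)
  show ?thesis unfolding closure_approachable
  proof (intro allI impI)
    fix e :: real assume "e > 0"
    define t where "t = min (d / 2) (e / 2)"
    have t: "0 < t" "t < d" "t < e" using d(1) \<open>e > 0\<close> by (auto simp: t_def min_def)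
    have "dist (x + t *\<^sub>R (- s *\<^sub>R axis k 1)) x = t"
      using t(1) patchD(2) by (auto simp: dist_norm)
    then show "\<exists>y\<in>interior B. dist y x < e" using d(2)[OF t(1,2)] t(3) by metis
  qed
qed

text \<open>Along a curve in the frontier \<open>x $ k - h x\<close> vanishes, and so does its
  derivative, which is the inner product in question. Conversely, a vector satisfying the equation
  is the velocity of a line projected onto the graph.\<close>

lemma patch_tangent_iff:
  assumes "closed B" "x \<in> U" "x $ k = h x"
  shows "boundary_tangent B x w \<longleftrightarrow> (axis k 1 - grad_in UNIV h x) \<bullet> w = 0"
proof
  assume "boundary_tangent B x w"
  then obtain \<gamma> \<delta> where g: "\<delta> > 0" "\<And>t. \<bar>t\<bar> < \<delta> \<Longrightarrow> \<gamma> t \<in> frontier B" "\<gamma> 0 = x"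
      "(\<gamma> has_vector_derivative w) (at 0)"
    unfolding boundary_tangent_def by blast
  have "(\<gamma> \<longlongrightarrow> x) (at 0)"
    using has_vector_derivative_continuous[OF g(4)] g(3) by (simp add: continuous_within)
  then have "\<forall>\<^sub>F t in at 0. \<gamma> t \<in> U"
    using topological_tendstoD[OF _ patchD(1)] assms(2) by blast
  moreover have "\<forall>\<^sub>F t in at (0::real). \<bar>t\<bar> < \<delta>"
    using g(1) by (auto simp: eventually_at dist_real_def)
  ultimately have "\<forall>\<^sub>F t in at 0. (\<gamma> t) $ k - h (\<gamma> t) = 0"
    by eventually_elim (use patch_frontier[OF assms(1)] g(2) in auto)
  then have ev: "\<forall>\<^sub>F t in at 0. 0 = (\<gamma> t) $ k - h (\<gamma> t)" by (rule eventually_mono) simp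
  have D: "(\<gamma> has_derivative (\<lambda>t. t *\<^sub>R w)) (at 0)"
    using g(4) by (simp add: has_vector_derivative_def)
  have "((\<lambda>t. (\<gamma> t) $ k - h (\<gamma> t)) has_derivative (\<lambda>t. t * ((axis k 1 - grad_in UNIV h x) \<bullet> w))) (at 0)"
    by (rule has_derivative_eq_rhs[OF has_derivative_diff[OF
          has_derivative_compose[OF D has_derivative_nth]
          has_derivative_compose[OF D smooth_has_derivative[OF patchD(3)]]]])
      (simp add: g(3) smooth_derivative_grad[OF patchD(3)] inner_diff_left inner_axis' algebra_simps)
  then have "((\<lambda>t. 0) has_derivative (\<lambda>t. t * ((axis k 1 - grad_in UNIV h x) \<bullet> w))) (at (0::real))"
    by (rule has_derivative_transform_eventually)
      (use ev in \<open>auto simp: g(3) assms(3) elim: eventually_mono\<close>)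
  then have "(\<lambda>t::real. t * ((axis k 1 - grad_in UNIV h x) \<bullet> w)) = (\<lambda>t. 0)"
    using has_derivative_unique has_derivative_const by blast
  from fun_cong[OF this, of 1] show "(axis k 1 - grad_in UNIV h x) \<bullet> w = 0" by simp
next
  assume w: "(axis k 1 - grad_in UNIV h x) \<bullet> w = 0"
  \<comment> \<open>The line in direction \<open>w\<close> is moved parallel to the
    \<open>k\<close>-th axis onto the graph. The orthogonality of \<open>w\<close> makes the
    derivative of this correction zero at 0, so the velocity remains \<open>w\<close>.\<close>
  define \<gamma> where "\<gamma> t = set_coord k (h (x + t *\<^sub>R w)) (x + t *\<^sub>R w)" for t
  have \<gamma>: "\<gamma> t = x + t *\<^sub>R w + (h (x + t *\<^sub>R w) - (x + t *\<^sub>R w) $ k) *\<^sub>R axis k 1" for t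
    by (simp add: \<gamma>_def set_coord_eq)
  have 0: "\<gamma> 0 = x" by (simp add: \<gamma> assms(3))
  have 1: "((\<lambda>t::real. x + t *\<^sub>R w) has_derivative (\<lambda>t. t *\<^sub>R w)) (at 0)"
    by (auto intro!: derivative_eq_intros)
  have "((\<lambda>t. h (x + t *\<^sub>R w) - (x + t *\<^sub>R w) $ k) has_derivative (\<lambda>t. 0)) (at 0)"
    by (rule has_derivative_eq_rhs[OF has_derivative_diff[OF
          has_derivative_compose[OF 1 smooth_has_derivative[OF patchD(3)]]
          has_derivative_compose[OF 1 has_derivative_nth]]])
      (use w in \<open>simp add: smooth_derivative_grad[OF patchD(3)] inner_diff_left inner_axis' algebra_simps\<close>)
  from has_derivative_add[OF 1 has_derivative_scaleR_left[OF this, of "axis k 1"]]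
  have D: "(\<gamma> has_vector_derivative w) (at 0)"
    unfolding has_vector_derivative_def \<gamma> by simp
  have "(\<gamma> \<longlongrightarrow> x) (at 0)"
    using has_vector_derivative_continuous[OF D] 0 by (simp add: continuous_within)
  then have "\<forall>\<^sub>F t in at 0. \<gamma> t \<in> U"
    using topological_tendstoD[OF _ patchD(1)] assms(2) by blast
  then obtain d where d: "d > 0" "\<And>t. t \<noteq> 0 \<Longrightarrow> \<bar>t\<bar> < d \<Longrightarrow> \<gamma> t \<in> U"
    by (auto simp: eventually_at dist_real_def)
  have "\<gamma> t \<in> frontier B" if "\<bar>t\<bar> < d" for t
  proof -
    have "\<gamma> t \<in> U" using d(2) that 0 assms(2) by (cases "t = 0") auto
    then show ?thesis using patch_frontier[OF assms(1)] patchD(4) by (simp add: \<gamma>_def)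
  qed
  then show "boundary_tangent B x w"
    unfolding boundary_tangent_def using d(1) 0 D by blast
qed

lemma patch_outward_normal:
  assumes "closed B" "x \<in> U" "x $ k = h x"
  shows "outward_normal B x = patch_normal k s h x"
proof -
  define N where "N = axis k 1 - grad_in UNIV h x"
  define q where "q = sqrt (1 + (norm (grad_in UNIV h x))\<^sup>2)"
  have q: "q > 0" and NN: "N \<bullet> N = q\<^sup>2"
    by (auto simp: q_def N_def patch_conormal_sqr add_pos_nonneg)
  have nN: "norm N = q" using NN q by (simp add: norm_eq_sqrt_inner)
  have P: "patch_normal k s h x = (s / q) *\<^sub>R N" by (simp add: patch_normal_def q_def N_def)
  have tan: "boundary_tangent B x w \<longleftrightarrow> N \<bullet> w = 0" for w
    unfolding N_def by (rule patch_tangent_iff[OF assms])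
  show ?thesis unfolding outward_normal_def P
  proof (rule the_equality)
    have "s * (N \<bullet> ((s / q) *\<^sub>R N)) > 0"
      using q patchD(2) by (auto simp: NN power2_eq_square)
    then obtain d where d: "d > 0" "\<And>t. 0 < t \<Longrightarrow> t < d \<Longrightarrow> x + t *\<^sub>R (s / q) *\<^sub>R N \<notin> B"
      using patch_leave[OF assms(2,3)] unfolding N_def by blast
    show "norm ((s / q) *\<^sub>R N) = 1 \<and> (\<forall>w. boundary_tangent B x w \<longrightarrow> (s / q) *\<^sub>R N \<bullet> w = 0) \<and>
        (\<exists>\<delta>>0. \<forall>t. 0 < t \<and> t < \<delta> \<longrightarrow> x + t *\<^sub>R (s / q) *\<^sub>R N \<notin> B)"
      using nN q patchD(2) d by (auto simp: tan)
  next
    fix n assume n: "norm n = 1 \<and> (\<forall>w. boundary_tangent B x w \<longrightarrow> n \<bullet> w = 0) \<and>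
        (\<exists>\<delta>>0. \<forall>t. 0 < t \<and> t < \<delta> \<longrightarrow> x + t *\<^sub>R n \<notin> B)"
    define c where "c = (N \<bullet> n) / q\<^sup>2"
    define w where "w = n - c *\<^sub>R N"
    have Nw: "N \<bullet> w = 0" using q by (simp add: w_def c_def inner_diff_right NN)
    then have "n \<bullet> w = 0" using n tan by blast
    then have "w \<bullet> w = 0" using Nw by (simp add: w_def inner_diff_left)
    then have nc: "n = c *\<^sub>R N" by (simp add: w_def)
    then have "\<bar>c\<bar> * q = 1" using n nN by simp
    \<comment> \<open>With the opposite sign \<open>n\<close> would point into the interior,
      contradicting that short steps along \<open>n\<close> leave \<open>B\<close>.\<close>
    have "\<not> s * c < 0"
    proof
      assume "s * c < 0"
      then have "s * (N \<bullet> n) < 0"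
        using q by (auto simp: nc NN mult.assoc[symmetric] mult_neg_pos)
      then obtain d where d: "d > 0" "\<And>t. 0 < t \<Longrightarrow> t < d \<Longrightarrow> x + t *\<^sub>R n \<in> interior B"
        using patch_enter[OF assms(2,3)] unfolding N_def by blast
      obtain e where e: "e > 0" "\<And>t. 0 < t \<Longrightarrow> t < e \<Longrightarrow> x + t *\<^sub>R n \<notin> B" using n by blast
      have "x + (min d e / 2) *\<^sub>R n \<in> interior B" "x + (min d e / 2) *\<^sub>R n \<notin> B"
        by (intro d(2) e(2); use d(1) e(1) in \<open>auto simp: min_def\<close>)+
      then show False using interior_subset by blast
    qed
    with \<open>\<bar>c\<bar> * q = 1\<close> q patchD(2) have "c = s / q"
      by (auto simp: field_simps abs_if split: if_splits)
    then show "n = (s / q) *\<^sub>R N" by (simp add: nc)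
  qed
qed

lemma smooth_patch_normal: "smooth (patch_normal k s h)"
proof -
  have pos: "1 + grad_in UNIV h x \<bullet> grad_in UNIV h x > 0" for x
    by (simp add: add_pos_nonneg)
  have "smooth (\<lambda>x. (s / sqrt (1 + grad_in UNIV h x \<bullet> grad_in UNIV h x)) *\<^sub>R (axis k 1 - grad_in UNIV h x))"
    by (intro smooth_intros smooth_grad patchD(3) pos) (use pos in \<open>simp add: less_imp_neq[symmetric]\<close>)
  then show ?thesis by (simp add: patch_normal_def[abs_def] power2_norm_eq_inner)
qed

end

section \<open>From patches to the whole domain\<close>

lemma smooth_domainD:
  assumes "smooth_domain B"
  shows "compact B" "closed B" "bounded B" "interior B \<noteq> {}"
    "p \<in> frontier B \<Longrightarrow> \<exists>U k s h. p \<in> U \<and> graph_patch B U k s h"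
  using assms compact_imp_closed compact_imp_bounded unfolding smooth_domain_def by blast+

text \<open>This excludes lower-dimensional pieces of \<open>B\<close>. A continuous function that
  vanishes in the interior then vanishes on all of \<open>B\<close>.\<close>

lemma smooth_domain_closure:
  assumes "smooth_domain B"
  shows "B \<subseteq> closure (interior B)"
proof
  fix x assume "x \<in> B"
  show "x \<in> closure (interior B)"
  proof (cases "x \<in> interior B")
    case False
    then have "x \<in> frontier B" using \<open>x \<in> B\<close> closure_subset by (auto simp: frontier_def)
    then obtain U k s h where "x \<in> U" "graph_patch B U k s h"
      using smooth_domainD(5)[OF assms] by blast
    then show ?thesis
      using patch_frontier_in_closure patch_frontier smooth_domainD(2)[OF assms] \<open>x \<in> frontier B\<close> by blast
  qed (use closure_subset in blast)
qed

text \<open>At a boundary point the difference of two candidate derivatives is linear and vanishes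
  on the open half-space of inward directions, and these span the space.\<close>

lemma smooth_domain_derivative_unique:
  fixes f :: "real^'m \<Rightarrow> 'b::real_normed_vector"
  assumes B: "smooth_domain B" and x: "x \<in> B"
    and f: "(f has_derivative f') (at x within B)" "(f has_derivative f'') (at x within B)"
  shows "f' = f''"
proof (cases "x \<in> interior B")
  case True
  then show ?thesis using f at_within_interior has_derivative_unique by metis
next
  case False
  then have "x \<in> frontier B" using x closure_subset by (auto simp: frontier_def)
  then obtain U k s h where U: "x \<in> U" and gp: "graph_patch B U k s h"
    using smooth_domainD(5)[OF B] by blast
  have xk: "x $ k = h x"
    using patch_frontier[OF gp smooth_domainD(2)[OF B] U] \<open>x \<in> frontier B\<close> by blast
  define D where "D v = f' v - f'' v" for v
  have D: "((\<lambda>x. 0) has_derivative D) (at x within B)"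
    using has_derivative_diff[OF f] by (simp add: D_def[abs_def])
  interpret D: bounded_linear D by (rule has_derivative_bounded_linear[OF D])
  define N where "N = axis k 1 - grad_in UNIV h x"
  have cone: "D v = 0" if v: "s * (N \<bullet> v) < 0" for v
  proof -
    obtain d where d: "d > 0" "\<And>t. 0 < t \<Longrightarrow> t < d \<Longrightarrow> x + t *\<^sub>R v \<in> interior B"
      using patch_enter[OF gp U xk] v unfolding N_def by blast
    have sub: "(\<lambda>t. x + t *\<^sub>R v) ` {0..d/2} \<subseteq> B"
    proof clarify
      fix t assume "t \<in> {0..d/2}"
      then show "x + t *\<^sub>R v \<in> B"
        using d interior_subset[of B] x by (cases "t = 0") force+
    qed
    have "((\<lambda>t. x + t *\<^sub>R v) has_derivative (\<lambda>t. t *\<^sub>R v)) (at 0 within {0..d/2})"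
      by (auto intro!: derivative_eq_intros)
    moreover have "((\<lambda>x. 0) has_derivative D) (at (x + 0 *\<^sub>R v) within (\<lambda>t. x + t *\<^sub>R v) ` {0..d/2})"
      using has_derivative_subset[OF D sub] by simp
    ultimately have "((\<lambda>t::real. 0) has_derivative (\<lambda>t. D (t *\<^sub>R v))) (at 0 within {0..d/2})"
      using has_derivative_in_compose by blast
    then have "((\<lambda>t::real. 0) has_vector_derivative D v) (at 0 within {0..d/2})"
      by (simp add: has_vector_derivative_def D.scaleR)
    moreover have "((\<lambda>t::real. 0) has_vector_derivative (0::'b)) (at 0 within {0..d/2})"
      by (rule has_vector_derivative_const)
    ultimately show "D v = 0"
      using d(1)
      by (intro vector_derivative_unique_within_closed_interval[of 0 "d/2" 0 "\<lambda>t. 0"]) auto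
  qed
  have "D v = 0" for v
  proof -
    \<comment> \<open>The inward vector \<open>e\<close> contributes \<open>- c\<close> to the
      slope. Exceeding \<open>\<bar>N \<bullet> v\<bar>\<close> by 1 makes
      \<open>v + c *\<^sub>R e\<close> inward for either sign of
      \<open>N \<bullet> v\<close>.\<close>
    define c where "c = \<bar>N \<bullet> v\<bar> + 1"
    define e where "e = (- s) *\<^sub>R (axis k 1 :: real^'m)"
    have Ne: "N \<bullet> e = - s" unfolding e_def N_def by (rule patch_conormal_axis[OF gp])
    have s2: "s = 1 \<or> s = -1" by (rule patchD(2)[OF gp])
    have "D e = 0" by (rule cone) (use s2 in \<open>auto simp: Ne\<close>)
    moreover have "D (v + c *\<^sub>R e) = 0"
      by (rule cone) (use s2 in \<open>auto simp: inner_add_right Ne c_def\<close>)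
    ultimately show ?thesis by (simp add: D.add D.scaleR)
  qed
  then show ?thesis by (auto simp: D_def)
qed

text \<open>The graph is the image of a coordinate hyperplane under a differentiable map, which
  preserves null sets.\<close>

lemma negligible_graph:
  fixes h :: "real^'m \<Rightarrow> real"
  assumes "smooth h" "\<And>y c. h (set_coord k c y) = h y"
  shows "negligible {x. x $ k = h x}"
proof -
  have "negligible {x::real^'m. axis k 1 \<bullet> x = 0}"
    by (rule negligible_hyperplane) simp
  moreover have "(\<lambda>y. set_coord k (h y) y) differentiable_on {x. axis k 1 \<bullet> x = 0}"
    unfolding differentiable_on_def
    by (intro ballI smooth_differentiable smooth_intros assms(1))
  ultimately have "negligible ((\<lambda>y. set_coord k (h y) y) ` {x. axis k 1 \<bullet> x = 0})"
    by (intro negligible_differentiable_image_negligible) auto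
  moreover have "{x. x $ k = h x} \<subseteq> (\<lambda>y. set_coord k (h y) y) ` {x. axis k 1 \<bullet> x = 0}"
  proof
    fix x assume "x \<in> {x. x $ k = h x}"
    then have "x = (\<lambda>y. set_coord k (h y) y) (set_coord k 0 x)"
      by (simp add: assms(2)) (metis set_coord_self)
    moreover have "set_coord k 0 x \<in> {x. axis k 1 \<bullet> x = 0}"
      by (simp add: inner_axis')
    ultimately show "x \<in> (\<lambda>y. set_coord k (h y) y) ` {x. axis k 1 \<bullet> x = 0}" by blast
  qed
  ultimately show ?thesis by (rule negligible_subset)
qed

lemma smooth_domain_negligible_frontier:
  assumes "smooth_domain B"
  shows "negligible (frontier B)"
  unfolding locally_negligible_alt[of "frontier B"]
proof
  fix x assume x: "x \<in> frontier B"
  then obtain U k s h where U: "x \<in> U" and gp: "graph_patch B U k s h"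
    using smooth_domainD(5)[OF assms] by blast
  have "negligible (frontier B \<inter> U)"
    by (rule negligible_subset[OF negligible_graph[OF patchD(3,4)[OF gp]]])
      (use patch_frontier[OF gp smooth_domainD(2)[OF assms]] in auto)
  moreover have "openin (top_of_set (frontier B)) (frontier B \<inter> U)"
    by (rule openin_open_Int[OF patchD(1)[OF gp]])
  ultimately show "\<exists>V. openin (top_of_set (frontier B)) V \<and> x \<in> V \<and> negligible V"
    using x U by blast
qed

lemma boundary_partition_exists:
  assumes "smooth_domain B"
  shows "\<exists>P. boundary_partition B P"
proof -
  \<comment> \<open>Closed balls are placed inside the patches because the closures of the bump
    supports must stay there.\<close>
  have "\<exists>r>0. \<exists>k h s U. cball p r \<subseteq> U \<and> graph_patch B U k s h" if "p \<in> frontier B" for p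
  proof -
    obtain U k s h where "p \<in> U" "graph_patch B U k s h"
      using smooth_domainD(5)[OF assms] \<open>p \<in> frontier B\<close> by blast
    then show ?thesis using open_contains_cball patchD(1) by metis
  qed
  then obtain r k h where r: "\<And>p. p \<in> frontier B \<Longrightarrow> r p > 0"
    and gp: "\<And>p. p \<in> frontier B \<Longrightarrow> \<exists>s U. cball p (r p) \<subseteq> U \<and> graph_patch B U (k p) s (h p)"
    by metis
  have "compact (frontier B)" by (rule compact_frontier[OF smooth_domainD(1)[OF assms]])
  then obtain D where D: "D \<subseteq> frontier B" "finite D" "frontier B \<subseteq> (\<Union>p\<in>D. ball p (r p))"
  proof (rule compactE_image[of "frontier B" "frontier B" "\<lambda>p. ball p (r p)"])
    show "frontier B \<subseteq> (\<Union>p\<in>frontier B. ball p (r p))" using r by force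
  qed auto
  define \<Psi> where "\<Psi> x = (\<Sum>p\<in>D. bump p (r p) x)" for x
  have \<Psi>: "smooth \<Psi>" unfolding \<Psi>_def by (intro smooth_intros)
  have \<Psi>0: "\<Psi> x \<ge> 0" for x unfolding \<Psi>_def by (intro sum_nonneg bump_nonneg)
  have \<Psi>pos: "\<Psi> x > 0" if "x \<in> frontier B" for x
  proof -
    obtain p where "p \<in> D" "x \<in> ball p (r p)" using D(3) \<open>x \<in> frontier B\<close> by blast
    then show ?thesis
      unfolding \<Psi>_def using D(1,2) r bump_nonneg bump_pos_iff by (intro sum_pos2[of _ p]) blast+
  qed
  \<comment> \<open>Compactness of the frontier gives a positive minimum of \<open>\<Psi>\<close>.
    For an empty frontier any positive value will do.\<close>
  obtain c where c: "c > 0" "\<And>x. x \<in> frontier B \<Longrightarrow> c \<le> \<Psi> x"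
  proof (cases "frontier B = {}")
    case False
    then obtain x0 where "x0 \<in> frontier B" "\<And>x. x \<in> frontier B \<Longrightarrow> \<Psi> x0 \<le> \<Psi> x"
      using continuous_attains_inf[OF \<open>compact (frontier B)\<close> _ smooth_continuous[OF \<Psi>]] by blast
    then show thesis using that \<Psi>pos by blast
  qed (use that[of 1] in auto)
  txt \<open>The second summand makes the denominator positive everywhere and vanishes where
    \<open>\<Psi> \<ge> c\<close>, in particular on the boundary.\<close>
  define Q where "Q x = \<Psi> x + flat_exp 0 (c - \<Psi> x)" for x
  have Q: "smooth Q" unfolding Q_def by (intro smooth_intros smooth_compose[OF smooth_flat_exp] \<Psi>)
  have Qpos: "Q x > 0" for x
  proof (cases "\<Psi> x > 0")
    case True
    then show ?thesis using flat_exp_0_nonneg[of "c - \<Psi> x"] by (simp add: Q_def)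
  next
    case False
    then show ?thesis using flat_exp_0_pos[of "c - \<Psi> x"] \<Psi>0[of x] c(1) by (simp add: Q_def)
  qed
  have Qeq: "Q x = \<Psi> x" if "x \<in> frontier B" for x
    using c(2)[OF that] by (simp add: Q_def flat_exp_def)
  define \<eta> where "\<eta> p x = bump p (r p) x / Q x" for p x
  obtain g where g: "bij_betw g {..<card D} D"
    using ex_bij_betw_nat_finite[OF D(2)] by (auto simp: atLeast0LessThan)
  have "boundary_partition B (card D, k \<circ> g, h \<circ> g, \<eta> \<circ> g)"
    unfolding boundary_partition_def split
  proof (intro conjI allI impI ballI)
    fix i assume "i < card D"
    then have p: "g i \<in> frontier B" using g D(1) bij_betwE by blast
    show "smooth ((\<eta> \<circ> g) i)"
      unfolding o_def \<eta>_def by (intro smooth_intros Q) (use Qpos in \<open>simp add: less_imp_neq[symmetric]\<close>)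
    show "0 \<le> (\<eta> \<circ> g) i x" for x
      using Qpos[of x] bump_nonneg[of "g i" "r (g i)" x] by (simp add: \<eta>_def)
    have "{x. (\<eta> \<circ> g) i x \<noteq> 0} = ball (g i) (r (g i))"
      unfolding bump_support[OF r[OF p], symmetric] using Qpos by (auto simp: \<eta>_def less_imp_neq[symmetric])
    then have cl: "closure {x. (\<eta> \<circ> g) i x \<noteq> 0} = cball (g i) (r (g i))"
      using r[OF p] by simp
    show "compact (closure {x. (\<eta> \<circ> g) i x \<noteq> 0})" unfolding cl by simp
    show "\<exists>U s. graph_patch B U ((k \<circ> g) i) s ((h \<circ> g) i) \<and> closure {x. (\<eta> \<circ> g) i x \<noteq> 0} \<subseteq> U"
      using gp[OF p] unfolding cl by auto
  next
    fix x assume x: "x \<in> frontier B"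
    have "(\<Sum>i<card D. (\<eta> \<circ> g) i x) = (\<Sum>p\<in>D. \<eta> p x)"
      using sum.reindex_bij_betw[OF g, of "\<lambda>p. \<eta> p x"] by simp
    also have "\<dots> = \<Psi> x / Q x" by (simp add: \<eta>_def \<Psi>_def sum_divide_distrib)
    finally show "(\<Sum>i<card D. (\<eta> \<circ> g) i x) = 1"
      using Qeq[OF x] Qpos[of x] by simp
  qed
  then show ?thesis by blast
qed


section \<open>Positive definite functionals\<close>

text \<open>The common structure of four integrals: over \<open>B\<close>, over its frontier, and
  over their products with the time interval. Differentiation under the integral and the fundamental
  lemma are proved once for all of them. The axiom \<open>cong\<close> expresses that values outside
  \<open>K\<close> do not count.\<close>

locale definite_functional =
  fixes K :: "'a::metric_space set" and I :: "('a \<Rightarrow> real) \<Rightarrow> real"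
  assumes compact_carrier: "compact K"
    and cong: "(\<And>x. x \<in> K \<Longrightarrow> f x = g x) \<Longrightarrow> I f = I g"
    and add: "continuous_on K f \<Longrightarrow> continuous_on K g \<Longrightarrow> I (\<lambda>x. f x + g x) = I f + I g"
    and scale: "continuous_on K f \<Longrightarrow> I (\<lambda>x. c * f x) = c * I f"
    and nonneg: "continuous_on K f \<Longrightarrow> (\<And>x. x \<in> K \<Longrightarrow> 0 \<le> f x) \<Longrightarrow> 0 \<le> I f"
    and definite: "continuous_on K f \<Longrightarrow> (\<And>x. x \<in> K \<Longrightarrow> 0 \<le> f x) \<Longrightarrow> I f = 0 \<Longrightarrow> x \<in> K \<Longrightarrow> f x = 0"
begin

lemma minus: "continuous_on K f \<Longrightarrow> I (\<lambda>x. - f x) = - I f"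
  using scale[of f "-1"] by simp

lemma diff: "continuous_on K f \<Longrightarrow> continuous_on K g \<Longrightarrow> I (\<lambda>x. f x - g x) = I f - I g"
  using add[of f "\<lambda>x. - g x"] minus[of g] by (simp add: continuous_on_minus)

lemma zero: "I (\<lambda>x. 0) = 0"
  using scale[of "\<lambda>x. 0" 0] by simp

lemma mono:
  assumes "continuous_on K f" "continuous_on K g" "\<And>x. x \<in> K \<Longrightarrow> f x \<le> g x"
  shows "I f \<le> I g"
  using nonneg[of "\<lambda>x. g x - f x"] diff[of g f] assms by (simp add: continuous_on_diff)

lemma mass_nonneg: "0 \<le> I (\<lambda>x. 1)"
  by (rule nonneg) auto

lemma bound:
  assumes f: "continuous_on K f" and M: "\<And>x. x \<in> K \<Longrightarrow> \<bar>f x\<bar> \<le> M"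
  shows "\<bar>I f\<bar> \<le> M * I (\<lambda>x. 1)"
proof -
  have "I f \<le> I (\<lambda>x. M * 1)"
    by (rule mono[OF f]) (use M in \<open>auto simp: abs_le_iff\<close>)
  moreover have "I (\<lambda>x. - f x) \<le> I (\<lambda>x. M * 1)"
    by (rule mono[OF continuous_on_minus[OF f]]) (use M in \<open>auto simp: abs_le_iff\<close>)
  ultimately show ?thesis using minus[OF f] scale[of "\<lambda>x. 1" M] by (simp add: abs_le_iff)
qed

text \<open>The scale \<open>r\<close> allows two uses of one estimate: \<open>r = 1\<close> gives
  continuity in a parameter, and \<open>r = \<bar>s - t\<bar>\<close> gives
  differentiability.\<close>

lemma small:
  assumes "e > 0"
  obtains \<delta> where "\<delta> > 0"
    "\<And>f r. continuous_on K f \<Longrightarrow> 0 \<le> r \<Longrightarrow> (\<And>x. x \<in> K \<Longrightarrow> \<bar>f x\<bar> \<le> \<delta> * r) \<Longrightarrow> \<bar>I f\<bar> \<le> e * r"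
\<comment> \<open>Adding 1 to the total mass keeps the quotient defined when the mass is
  zero.\<close>
proof (rule that[of "e / (I (\<lambda>x. 1) + 1)"])
  have M: "I (\<lambda>x. 1) + 1 > 0" using mass_nonneg by simp
  show "e / (I (\<lambda>x. 1) + 1) > 0" using M assms by simp
  fix f and r :: real
  assume "continuous_on K f" "0 \<le> r" "\<And>x. x \<in> K \<Longrightarrow> \<bar>f x\<bar> \<le> e / (I (\<lambda>x. 1) + 1) * r"
  then have "\<bar>I f\<bar> \<le> e / (I (\<lambda>x. 1) + 1) * r * I (\<lambda>x. 1)" by (intro bound)
  also have "\<dots> \<le> e / (I (\<lambda>x. 1) + 1) * r * (I (\<lambda>x. 1) + 1)"
    using M assms \<open>0 \<le> r\<close> by (intro mult_left_mono) auto
  finally show "\<bar>I f\<bar> \<le> e * r" using M by simp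
qed

lemma slice:
  assumes "continuous_on (T \<times> K) f" "t \<in> T"
  shows "continuous_on K (\<lambda>x. f (t, x))"
  by (rule continuous_on_compose2[OF assms(1)]) (use assms(2) in \<open>auto intro!: continuous_intros\<close>)

text \<open>Compactness of \<open>K\<close> makes joint continuity uniform in \<open>x\<close> for
  parameters near \<open>t\<close>, and \<open>small\<close> turns a uniform bound on the integrand
  into one on the functional.\<close>

lemma continuous_parameter:
  fixes T :: "'b::metric_space set"
  assumes f: "continuous_on (T \<times> K) f"
  shows "continuous_on T (\<lambda>t. I (\<lambda>x. f (t, x)))"
  unfolding continuous_on_iff
proof (intro ballI allI impI)
  fix t and e :: real assume t: "t \<in> T" and "e > 0"
  then obtain \<delta> where \<delta>: "\<delta> > 0"
    "\<And>f r. continuous_on K f \<Longrightarrow> 0 \<le> r \<Longrightarrow> (\<And>x. x \<in> K \<Longrightarrow> \<bar>f x\<bar> \<le> \<delta> * r) \<Longrightarrow> \<bar>I f\<bar> \<le> e / 2 * r"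
    using small[of "e / 2"] by auto
  obtain X where X: "t \<in> X" "open X" "\<forall>s\<in>X \<inter> T. \<forall>x\<in>K. dist (f (s, x)) (f (t, x)) \<le> \<delta>"
    using continuous_on_prod_compactE[OF f compact_carrier t \<delta>(1)] by blast
  obtain d where d: "d > 0" "ball t d \<subseteq> X" using X open_contains_ball by blast
  show "\<exists>d>0. \<forall>s\<in>T. dist s t < d \<longrightarrow> dist (I (\<lambda>x. f (s, x))) (I (\<lambda>x. f (t, x))) < e"
  proof (intro exI conjI ballI impI)
    fix s assume s: "s \<in> T" "dist s t < d"
    have "\<bar>I (\<lambda>x. f (s, x) - f (t, x))\<bar> \<le> e / 2 * 1"
    proof (rule \<delta>(2))
      have "s \<in> X" using s(2) d(2) by (auto simp: dist_commute)
      then show "\<bar>f (s, x) - f (t, x)\<bar> \<le> \<delta> * 1" if "x \<in> K" for x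
        using X(3) s(1) that by (auto simp: dist_real_def)
    qed (auto intro!: continuous_intros slice[OF f] s(1) t)
    then show "dist (I (\<lambda>x. f (s, x))) (I (\<lambda>x. f (t, x))) < e"
      using diff[OF slice[OF f s(1)] slice[OF f t]] \<open>e > 0\<close> by (simp add: dist_real_def)
  qed (rule d(1))
qed

text \<open>The remainder of the first-order expansion in the parameter is small relative to
  \<open>\<bar>s - t\<bar>\<close>, uniformly over the compact set \<open>K\<close>.\<close>

lemma has_derivative_parameter:
  fixes T :: "real set"
  assumes T: "convex T" "t \<in> T"
    and f: "\<And>s. s \<in> T \<Longrightarrow> continuous_on K (f s)"
    and f': "continuous_on (T \<times> K) (\<lambda>(s, x). f' s x)"
    and D: "\<And>s x. s \<in> T \<Longrightarrow> x \<in> K \<Longrightarrow> ((\<lambda>r. f r x) has_real_derivative f' s x) (at s within T)"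
  shows "((\<lambda>s. I (f s)) has_real_derivative I (f' t)) (at t within T)"
  unfolding has_field_derivative_def has_derivative_within_alt
proof (intro conjI allI impI bounded_linear_mult_right)
  fix e :: real assume "e > 0"
  then obtain \<delta> where \<delta>: "\<delta> > 0"
    "\<And>f r. continuous_on K f \<Longrightarrow> 0 \<le> r \<Longrightarrow> (\<And>x. x \<in> K \<Longrightarrow> \<bar>f x\<bar> \<le> \<delta> * r) \<Longrightarrow> \<bar>I f\<bar> \<le> e * r"
    using small by blast
  obtain X where X: "t \<in> X" "open X" "\<forall>s\<in>X \<inter> T. \<forall>x\<in>K. dist (f' s x) (f' t x) \<le> \<delta>"
    using continuous_on_prod_compactE[OF f' compact_carrier T(2) \<delta>(1)] by auto
  obtain d where d: "d > 0" "ball t d \<subseteq> X" using X open_contains_ball by blast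
  have f't: "continuous_on K (f' t)" using slice[OF f' T(2)] by simp
  show "\<exists>d>0. \<forall>s\<in>T. norm (s - t) < d \<longrightarrow>
      norm (I (f s) - I (f t) - I (f' t) * (s - t)) \<le> e * norm (s - t)"
  proof (intro exI conjI ballI impI)
    fix s assume s: "s \<in> T" "norm (s - t) < d"
    have "\<bar>I (\<lambda>x. f s x - f t x - (s - t) * f' t x)\<bar> \<le> e * \<bar>s - t\<bar>"
    proof (rule \<delta>(2))
      fix x assume x: "x \<in> K"
      \<comment> \<open>After subtraction of the linear part the derivative in \<open>r\<close> is
        \<open>f' r x - f' t x\<close>, which is at most \<open>\<delta>\<close> near
        \<open>t\<close>, so the mean value inequality yields the factor
        \<open>\<delta>\<close>.\<close>
      have "norm ((f s x - s * f' t x) - (f t x - t * f' t x)) \<le> \<delta> * norm (s - t)"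
      proof (rule field_differentiable_bound)
        show "convex (T \<inter> ball t d)" using T(1) by (intro convex_Int convex_ball)
        fix r assume r: "r \<in> T \<inter> ball t d"
        show "((\<lambda>r. f r x - r * f' t x) has_field_derivative (f' r x - f' t x)) (at r within T \<inter> ball t d)"
          using DERIV_subset[OF D[of r x], of "T \<inter> ball t d"] r x
          by (auto intro!: derivative_eq_intros)
        show "norm (f' r x - f' t x) \<le> \<delta>"
          using X(3) d(2) r x by (auto simp: dist_real_def)
      qed (use s T(2) d(1) in \<open>auto simp: dist_real_def\<close>)
      then show "\<bar>f s x - f t x - (s - t) * f' t x\<bar> \<le> \<delta> * \<bar>s - t\<bar>"
        by (simp add: algebra_simps)
    qed (auto intro!: continuous_intros f f't s(1) T(2))
    moreover have "I (\<lambda>x. f s x - f t x - (s - t) * f' t x) = I (f s) - I (f t) - (s - t) * I (f' t)"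
      using f[OF s(1)] f[OF T(2)] f't by (simp add: diff scale continuous_on_diff continuous_on_mult_left)
    ultimately show "norm (I (f s) - I (f t) - I (f' t) * (s - t)) \<le> e * norm (s - t)"
      by (simp add: mult.commute)
  qed (rule d(1))
qed

text \<open>Besides the density evaluated along jets, \<open>l\<close> may be the product of two
  reals. That instance differentiates the pairing terms of the Pontryagin action.\<close>

lemma variation:
  fixes l :: "'b::euclidean_space \<Rightarrow> real"
  assumes l: "smooth l" and u: "continuous_on K u" and v: "continuous_on K v"
  shows "((\<lambda>\<epsilon>. I (\<lambda>x. l (u x + \<epsilon> *\<^sub>R v x))) has_real_derivative
      I (\<lambda>x. frechet_derivative l (at (u x)) (v x))) (at 0)"
proof -
  have "((\<lambda>\<epsilon>. I (\<lambda>x. l (u x + \<epsilon> *\<^sub>R v x))) has_real_derivative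
      I (\<lambda>x. frechet_derivative l (at (u x + 0 *\<^sub>R v x)) (v x))) (at 0 within UNIV)"
  proof (rule has_derivative_parameter)
    show "continuous_on K (\<lambda>x. l (u x + \<epsilon> *\<^sub>R v x))" for \<epsilon>
      by (rule continuous_on_compose2[OF smooth_continuous[OF l, of UNIV]])
        (auto intro!: continuous_intros u v)
    have v': "continuous_on (UNIV \<times> K) (\<lambda>z. v (snd z))" "continuous_on (UNIV \<times> K) (\<lambda>z. u (snd z))"
      by (auto intro!: continuous_on_compose2[OF v] continuous_on_compose2[OF u] continuous_intros)
    have "smooth (\<lambda>z::'b \<times> 'b. frechet_derivative l (at (fst z)) (snd z))"
      by (intro smooth_intros l)
    from smooth_continuous[OF this, of UNIV]
    show "continuous_on (UNIV \<times> K) (\<lambda>(\<epsilon>, x). frechet_derivative l (at (u x + \<epsilon> *\<^sub>R v x)) (v x))"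
      by (rule continuous_on_compose2[where f = "\<lambda>z. (u (snd z) + fst z *\<^sub>R v (snd z), v (snd z))", THEN continuous_on_eq])
        (auto intro!: continuous_intros v')
    fix \<epsilon> :: real and x
    have "((\<lambda>\<epsilon>. u x + \<epsilon> *\<^sub>R v x) has_derivative (\<lambda>r. r *\<^sub>R v x)) (at \<epsilon>)"
      by (auto intro!: derivative_eq_intros)
    from has_derivative_compose[OF this smooth_has_derivative[OF l]]
    show "((\<lambda>\<epsilon>. l (u x + \<epsilon> *\<^sub>R v x)) has_real_derivative
        frechet_derivative l (at (u x + \<epsilon> *\<^sub>R v x)) (v x)) (at \<epsilon> within UNIV)"
      using linear_cmul[OF bounded_linear.linear[OF smooth_linear_derivative[OF l]]]
      by (simp add: has_field_derivative_def mult_commute_abs)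
  qed auto
  then show ?thesis by simp
qed

end

text \<open>For definiteness, the inner values form a nonnegative continuous function of time. If
  its integral is zero it vanishes at each time, and definiteness of \<open>I\<close> then applies
  to each slice.\<close>

lemma definite_functional_time:
  fixes K :: "'a::metric_space set"
  assumes "definite_functional K I" and ab: "a < (b::real)"
  shows "definite_functional ({a..b} \<times> K) (\<lambda>f. integral {a..b} (\<lambda>t. I (\<lambda>x. f (t, x))))"
proof -
  interpret definite_functional K I by fact
  have int: "(\<lambda>t. I (\<lambda>x. f (t, x))) integrable_on {a..b}" if "continuous_on ({a..b} \<times> K) f" for f
    by (rule integrable_continuous_real[OF continuous_parameter[OF that]])
  show ?thesis
  proof
    show "compact ({a..b} \<times> K)" by (intro compact_Times compact_Icc compact_carrier)
    fix f g :: "real \<times> 'a \<Rightarrow> real"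
    show "integral {a..b} (\<lambda>t. I (\<lambda>x. f (t, x))) = integral {a..b} (\<lambda>t. I (\<lambda>x. g (t, x)))"
      if "\<And>x. x \<in> {a..b} \<times> K \<Longrightarrow> f x = g x"
      by (intro integral_cong cong that) auto
    assume f: "continuous_on ({a..b} \<times> K) f"
    show "integral {a..b} (\<lambda>t. I (\<lambda>x. f (t, x) + g (t, x))) =
        integral {a..b} (\<lambda>t. I (\<lambda>x. f (t, x))) + integral {a..b} (\<lambda>t. I (\<lambda>x. g (t, x)))"
      if g: "continuous_on ({a..b} \<times> K) g"
      by (subst integral_add[OF int[OF f] int[OF g], symmetric])
        (intro integral_cong add slice[OF f] slice[OF g]; simp)
    show "integral {a..b} (\<lambda>t. I (\<lambda>x. c * f (t, x))) = c * integral {a..b} (\<lambda>t. I (\<lambda>x. f (t, x)))" for c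
      by (subst integral_mult_right[symmetric]) (intro integral_cong scale slice[OF f]; simp)
    assume pos: "\<And>x. x \<in> {a..b} \<times> K \<Longrightarrow> 0 \<le> f x"
    have pos': "0 \<le> I (\<lambda>x. f (t, x))" if "t \<in> {a..b}" for t
      using that by (intro nonneg slice[OF f] pos) auto
    show "0 \<le> integral {a..b} (\<lambda>t. I (\<lambda>x. f (t, x)))"
      by (intro integral_nonneg int[OF f] pos')
    fix z assume 0: "integral {a..b} (\<lambda>t. I (\<lambda>x. f (t, x))) = 0" and z: "z \<in> {a..b} \<times> K"
    have "((\<lambda>t. I (\<lambda>x. f (t, x))) has_integral 0) (cbox a b)"
      using 0 int[OF f] by (simp add: has_integral_iff)
    then have "I (\<lambda>x. f (fst z, x)) = 0"
      by (rule has_integral_0_cbox_imp_0[rotated 2])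
        (use z ab pos' continuous_parameter[OF f] in auto)
    then show "f z = 0"
      using definite[of "\<lambda>x. f (fst z, x)" "snd z"] slice[OF f, of "fst z"] pos z by (auto simp: mem_Times_iff)
  qed
qed

text \<open>Testing with \<open>E\<close> times a bump function supported away from \<open>K'\<close> gives \<open>E = 0\<close>; then \<open>E'\<close> itself
  is a test function. The weight \<open>w\<close> makes room for the condition that variations vanish at the
  endpoints of the time interval.\<close>

lemma fundamental_lemma:
  fixes K K' :: "'a::euclidean_space set"
  assumes "definite_functional K I" "definite_functional K' I'" "K' \<subseteq> K"
    and E: "smooth E" and E': "smooth E'" and w: "smooth w" "\<And>z. z \<in> K \<Longrightarrow> 0 \<le> w z"
    and dense: "K \<subseteq> closure {z \<in> K - K'. w z \<noteq> 0}" "K' \<subseteq> closure {z \<in> K'. w z \<noteq> 0}"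
    and vanish: "\<And>d. smooth d \<Longrightarrow> I (\<lambda>z. E z * (w z * d z)) + I' (\<lambda>z. E' z * (w z * d z)) = 0"
  shows "(\<forall>z\<in>K. E z = 0) \<and> (\<forall>z\<in>K'. E' z = 0)"
proof -
  interpret K: definite_functional K I by fact
  interpret K': definite_functional K' I' by fact
  have "E z = 0" if z: "z \<in> K - K'" "w z \<noteq> 0" for z
  proof -
    have "open (- K')" using K'.compact_carrier compact_imp_closed by blast
    then obtain r where r: "r > 0" "ball z r \<subseteq> - K'" using z(1) open_contains_ball by blast
    define f where "f x = E x * (w x * (bump z r x * E x))" for x
    have f: "smooth f" unfolding f_def by (intro smooth_intros E w)
    have b: "bump z r x = 0" if "x \<in> K'" for x
      using bump_support[OF r(1), of z] r(2) that by blast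
    have "I' (\<lambda>x. E' x * (w x * (bump z r x * E x))) = I' (\<lambda>x. 0)"
      by (rule K'.cong) (simp add: b)
    then have "I f = 0"
      using vanish[of "\<lambda>x. bump z r x * E x"] K'.zero by (simp add: f_def[abs_def] smooth_intros E)
    moreover have "0 \<le> f x" if "x \<in> K" for x
      using w(2)[OF that] bump_nonneg[of z r x] mult_nonneg_nonneg[of "w x * bump z r x" "E x * E x"]
      by (simp add: f_def mult_ac)
    ultimately have "f z = 0"
      using K.definite[OF smooth_continuous[OF f]] z(1) by blast
    then show "E z = 0"
      using bump_pos_iff[OF r(1), of z z] r(1) z(2) by (auto simp: f_def)
  qed
  \<comment> \<open>The points treated so far are dense in \<open>K\<close>, and \<open>E\<close> is
    continuous.\<close>
  then have EK: "E z = 0" if "z \<in> K" for z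
    using continuous_constant_on_closure[OF smooth_continuous[OF E], of "{z \<in> K - K'. w z \<noteq> 0}" 0 z] dense(1) that
    by auto
  define f where "f x = E' x * (w x * E' x)" for x
  have f: "smooth f" unfolding f_def by (intro smooth_intros E' w)
  have "I (\<lambda>z. E z * (w z * E' z)) = I (\<lambda>z. 0)"
    by (rule K.cong) (simp add: EK)
  then have "I' f = 0" using vanish[OF E'] K.zero by (simp add: f_def[abs_def])
  moreover have "0 \<le> f x" if "x \<in> K'" for x
    using mult_nonneg_nonneg[of "w x" "E' x * E' x"] w(2)[of x] that assms(3)
    by (auto simp: f_def mult_ac)
  ultimately have f0: "f z = 0" if "z \<in> K'" for z
    using K'.definite[OF smooth_continuous[OF f]] that by blast
  have "E' z = 0" if "z \<in> K'" for z
    using continuous_constant_on_closure[OF smooth_continuous[OF E'], of "{z \<in> K'. w z \<noteq> 0}" 0 z] dense(2) that f0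
    by (auto simp: f_def)
  then show ?thesis using EK by blast
qed

section \<open>The integral over the domain as a definite functional\<close>

lemma continuous_compact_integrable:
  fixes f :: "'a::euclidean_space \<Rightarrow> real"
  assumes "compact S" "continuous_on S f"
  shows "f integrable_on S"
  using borel_integrable_compact[OF assms] set_borel_integral_eq_integral(1)[of S f]
  by (simp add: set_integrable_def)

lemma definite_functional_interior:
  fixes B :: "'a::euclidean_space set"
  assumes B: "compact B" "B \<subseteq> closure (interior B)"
  shows "definite_functional B (integral B)"
proof
  note int = continuous_compact_integrable[OF B(1)]
  fix f g :: "'a \<Rightarrow> real"
  show "integral B f = integral B g" if "\<And>x. x \<in> B \<Longrightarrow> f x = g x"
    using that by (rule integral_cong)
  assume f: "continuous_on B f"
  show "integral B (\<lambda>x. f x + g x) = integral B f + integral B g" if "continuous_on B g"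
    by (rule integral_add[OF int[OF f] int[OF that]])
  show "integral B (\<lambda>x. c * f x) = c * integral B f" for c by simp
  assume pos: "\<And>x. x \<in> B \<Longrightarrow> 0 \<le> f x"
  then show "0 \<le> integral B f" by (rule integral_nonneg[OF int[OF f]])
  fix z assume 0: "integral B f = 0" and z: "z \<in> B"
  have "f x = 0" if x: "x \<in> interior B" for x
  proof -
    \<comment> \<open>Nonnegativity bounds the integral over a small box by the one over
      \<open>B\<close>, so it is zero as well. On a box a nonnegative continuous function with zero
      integral vanishes.\<close>
    obtain a b where ab: "cbox a b \<subseteq> interior B" "x \<in> box a b"
      by (rule open_contains_cbox[OF open_interior x], rule that)
    then have sub: "cbox a b \<subseteq> B" using interior_subset by blast
    have f': "continuous_on (cbox a b) f" using continuous_on_subset[OF f sub] .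
    have "integral (cbox a b) f \<le> integral B f"
      by (rule integral_subset_le[OF sub]) (use f' f int pos in \<open>auto intro: integrable_continuous\<close>)
    moreover have "0 \<le> integral (cbox a b) f"
      by (rule integral_nonneg) (use f' pos sub in \<open>auto intro: integrable_continuous\<close>)
    ultimately have "(f has_integral 0) (cbox a b)"
      using 0 f' by (simp add: has_integral_iff integrable_continuous)
    then show "f x = 0"
      by (rule has_integral_0_cbox_imp_0[OF f', rotated])
        (use ab pos sub box_subset_cbox[of a b] in blast)+
  qed
  moreover have "closure (interior B) \<subseteq> B"
    using B(1) compact_imp_closed closure_minimal interior_subset by blast
  ultimately show "f z = 0"
    using continuous_constant_on_closure[OF continuous_on_subset[OF f], of "interior B" 0 z] B(2) z by blast
qed (use B in simp)


section \<open>The divergence theorem\<close>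

lemma negligible_AE_lborel: "negligible N \<Longrightarrow> AE x in lborel. x \<notin> N"
  unfolding negligible_iff_null_sets using AE_not_in AE_completion_iff by blast

lemma integrable_compact_support:
  fixes f :: "'a::euclidean_space \<Rightarrow> real"
  assumes "continuous_on UNIV f" "\<And>x. f x \<noteq> 0 \<Longrightarrow> norm x \<le> R"
  shows "integrable lborel f"
proof -
  have "integrable lborel (\<lambda>x. indicator (cball 0 R) x *\<^sub>R f x)"
    by (rule borel_integrable_compact[OF compact_cball continuous_on_subset[OF assms(1)]]) simp
  moreover have "(\<lambda>x. indicator (cball 0 R) x *\<^sub>R f x) = f"
    using assms(2) by (auto simp: fun_eq_iff indicator_def)
  ultimately show ?thesis by simp
qed

lemma smooth_borel_measurable: "smooth f \<Longrightarrow> f \<in> borel_measurable borel"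
  by (rule borel_measurable_continuous_onI[OF smooth_continuous])

section \<open>Change of variables along a graph\<close>

text \<open>By Fubini, this reduces to affine substitutions on the lines parallel to the \<open>k\<close>-th axis.\<close>

lemma lborel_graph_affine:
  fixes h :: "real^'m \<Rightarrow> real"
  assumes [measurable]: "h \<in> borel_measurable borel" and h: "\<And>y c. h (set_coord k c y) = h y"
    and c: "c \<noteq> 0"
  shows "lborel = density (distr lborel borel (\<lambda>x. set_coord k (h x + c * x $ k) x)) (\<lambda>_. ennreal \<bar>c\<bar>)"
proof -
  define e :: "real^'m" where "e = axis k 1"
  define J where "J = Basis - {e}"
  have e: "e \<in> Basis" by (simp add: e_def)
  have J: "Basis = insert e J" "finite J" "e \<notin> J" using e by (auto simp: J_def)
  define S where "S x = set_coord k (h x + c * x $ k) x" for x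
  have S: "S x = x + (h x + c * (x \<bullet> e) - x \<bullet> e) *\<^sub>R e" for x
    by (simp add: S_def set_coord_eq e_def inner_axis)
  have [measurable]: "S \<in> borel_measurable borel" unfolding S by measurable
  interpret product_sigma_finite "\<lambda>_::real^'m. lborel :: real measure" ..
  have fubini: "(\<integral>\<^sup>+x. f x \<partial>lborel) =
      (\<integral>\<^sup>+x. (\<integral>\<^sup>+y. f ((\<Sum>b\<in>J. x b *\<^sub>R b) + y *\<^sub>R e) \<partial>lborel) \<partial>(\<Pi>\<^sub>M b\<in>J. lborel))"
    if [measurable]: "f \<in> borel_measurable borel" for f :: "real^'m \<Rightarrow> ennreal"
  proof -
    have "(\<integral>\<^sup>+x. f x \<partial>lborel) = (\<integral>\<^sup>+x. f (\<Sum>b\<in>insert e J. x b *\<^sub>R b) \<partial>(\<Pi>\<^sub>M b\<in>insert e J. lborel))"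
      unfolding J(1)[symmetric] by (subst lborel_eq) (simp add: nn_integral_distr)
    also have "\<dots> = (\<integral>\<^sup>+x. (\<integral>\<^sup>+y. f (\<Sum>b\<in>insert e J. (x(e := y)) b *\<^sub>R b) \<partial>lborel) \<partial>(\<Pi>\<^sub>M b\<in>J. lborel))"
      by (rule product_nn_integral_insert[OF J(2,3)]) measurable
    moreover have "(\<Sum>b\<in>insert e J. (x(e := y)) b *\<^sub>R b) = (\<Sum>b\<in>J. x b *\<^sub>R b) + y *\<^sub>R e" for x y
    proof -
      have "(\<Sum>b\<in>J. (x(e := y)) b *\<^sub>R b) = (\<Sum>b\<in>J. x b *\<^sub>R b)"
        using J(3) by (intro sum.cong) auto
      then show ?thesis using J(2,3) by simp
    qed
    ultimately show ?thesis by simp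
  qed
  have we: "(\<Sum>b\<in>J. x b *\<^sub>R b) \<bullet> e = 0" for x :: "real^'m \<Rightarrow> real"
    unfolding inner_sum_left by (rule sum.neutral) (use e J(1,3) in \<open>metis inner_not_same_Basis inner_scaleR_left insertCI mult_zero_right\<close>)
  have ee: "e \<bullet> e = 1" using e by (simp add: inner_same_Basis)
  have hw: "h (w + y *\<^sub>R e) = h w" for w y
    using h[of "w $ k + y" w] by (simp add: set_coord_eq e_def)
  \<comment> \<open>On each line parallel to \<open>e\<close> the map is affine with slope
    \<open>c\<close>, and its offset depends on the line only.\<close>
  have SJ: "S ((\<Sum>b\<in>J. x b *\<^sub>R b) + y *\<^sub>R e) =
      (\<Sum>b\<in>J. x b *\<^sub>R b) + (h (\<Sum>b\<in>J. x b *\<^sub>R b) + c * y) *\<^sub>R e" for x y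
    by (simp add: S hw inner_add_left we ee scaleR_add_left scaleR_diff_left)
  have nn: "(\<integral>\<^sup>+x. f x \<partial>lborel) = ennreal \<bar>c\<bar> * (\<integral>\<^sup>+x. f (S x) \<partial>lborel)"
    if [measurable]: "f \<in> borel_measurable borel" for f :: "real^'m \<Rightarrow> ennreal"
  proof -
    have "(\<integral>\<^sup>+y. f ((\<Sum>b\<in>J. x b *\<^sub>R b) + y *\<^sub>R e) \<partial>lborel) =
        ennreal \<bar>c\<bar> * (\<integral>\<^sup>+y. f (S ((\<Sum>b\<in>J. x b *\<^sub>R b) + y *\<^sub>R e)) \<partial>lborel)" for x :: "real^'m \<Rightarrow> real"
      by (subst nn_integral_real_affine[where t = "h (\<Sum>b\<in>J. x b *\<^sub>R b)", OF _ c])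
        (simp_all add: SJ)
    then show ?thesis
      by (simp add: fubini nn_integral_cmult)
  qed
  show ?thesis unfolding S_def[symmetric]
  proof (rule measure_eqI)
    fix A :: "(real^'m) set" assume "A \<in> sets lborel"
    then have [measurable]: "A \<in> sets borel" by simp
    have "emeasure lborel A = (\<integral>\<^sup>+x. indicator A x \<partial>lborel)" by simp
    also have "\<dots> = ennreal \<bar>c\<bar> * (\<integral>\<^sup>+x. indicator A (S x) \<partial>lborel)" by (rule nn) simp
    also have "(\<integral>\<^sup>+x. indicator A (S x) \<partial>lborel) = (\<integral>\<^sup>+x. indicator A x \<partial>distr lborel borel S)"
      by (rule nn_integral_distr[symmetric]) auto
    also have "ennreal \<bar>c\<bar> * \<dots> = emeasure (density (distr lborel borel S) (\<lambda>_. ennreal \<bar>c\<bar>)) A"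
      by (simp add: emeasure_density nn_integral_cmult)
    finally show "emeasure lborel A = emeasure (density (distr lborel borel S) (\<lambda>_. ennreal \<bar>c\<bar>)) A" .
  qed simp
qed

lemma integral_graph_affine:
  fixes h :: "real^'m \<Rightarrow> real" and f :: "real^'m \<Rightarrow> real"
  assumes h: "h \<in> borel_measurable borel" "\<And>y c. h (set_coord k c y) = h y" and c: "c \<noteq> 0"
    and [measurable]: "f \<in> borel_measurable borel"
  shows "(\<integral>x. f x \<partial>lborel) = \<bar>c\<bar> * (\<integral>x. f (set_coord k (h x + c * x $ k) x) \<partial>lborel)"
proof -
  note [measurable] = h(1)
  have [measurable]: "(\<lambda>x. set_coord k (h x + c * x $ k) x) \<in> borel_measurable borel"
  proof -
    have "(\<lambda>x. set_coord k (h x + c * x $ k) x) =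
        (\<lambda>x. x + (h x + c * (x \<bullet> axis k 1) - x \<bullet> axis k 1) *\<^sub>R axis k 1)"
      by (simp add: set_coord_eq inner_axis fun_eq_iff)
    then show ?thesis by simp
  qed
  show ?thesis
    by (subst lborel_graph_affine[OF h c]) (simp add: integral_density integral_distr)
qed

section \<open>Integrals of derivatives of compactly supported Lipschitz functions\<close>

lemma smooth_lipschitz_cball:
  fixes f :: "'a::euclidean_space \<Rightarrow> 'b::real_normed_vector"
  assumes f: "smooth f"
  obtains L where "L \<ge> 0" "\<And>x y. x \<in> cball 0 R \<Longrightarrow> y \<in> cball 0 R \<Longrightarrow> norm (f x - f y) \<le> L * norm (x - y)"
proof -
  have "\<exists>M\<ge>0. \<forall>x\<in>cball 0 R. norm (frechet_derivative f (at x) b) \<le> M" for b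
  proof -
    have "smooth (\<lambda>x. frechet_derivative f (at x) b)" by (intro smooth_intros f)
    then have "compact ((\<lambda>x. frechet_derivative f (at x) b) ` cball 0 R)"
      by (intro compact_continuous_image smooth_continuous compact_cball)
    then obtain M where "\<forall>x\<in>cball 0 R. norm (frechet_derivative f (at x) b) \<le> M"
      using compact_imp_bounded[of "(\<lambda>x. frechet_derivative f (at x) b) ` cball 0 R"]
      unfolding bounded_iff by auto
    then show ?thesis by (intro exI[of _ "max M 0"]) (auto simp: le_max_iff_disj)
  qed
  then obtain M where M: "\<And>b. M b \<ge> 0"
    "\<And>b x. x \<in> cball 0 R \<Longrightarrow> norm (frechet_derivative f (at x) b) \<le> M b"
    by metis
  show thesis
  proof (rule that)
    show "(\<Sum>b\<in>Basis. M b) \<ge> 0" by (intro sum_nonneg M)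
    fix x y :: 'a assume xy: "x \<in> cball 0 R" "y \<in> cball 0 R"
    show "norm (f x - f y) \<le> (\<Sum>b\<in>Basis. M b) * norm (x - y)"
    proof (rule differentiable_bound[OF convex_cball _ _ xy])
      fix x :: 'a assume x: "x \<in> cball 0 R"
      show "(f has_derivative frechet_derivative f (at x)) (at x within cball 0 R)"
        by (rule smooth_has_derivative[OF f])
      show "onorm (frechet_derivative f (at x)) \<le> (\<Sum>b\<in>Basis. M b)"
      proof (rule onorm_le)
        fix v
        have "norm (frechet_derivative f (at x) v) = norm (\<Sum>b\<in>Basis. (v \<bullet> b) *\<^sub>R frechet_derivative f (at x) b)"
          by (subst linear_eq_sum_Basis[OF bounded_linear.linear[OF smooth_linear_derivative[OF f]]]) simp
        also have "\<dots> \<le> (\<Sum>b\<in>Basis. norm v * M b)"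
          by (rule order_trans[OF norm_sum], rule sum_mono)
            (auto intro!: mult_mono M(2)[OF x] Basis_le_norm)
        finally show "norm (frechet_derivative f (at x) v) \<le> (\<Sum>b\<in>Basis. M b) * norm v"
          by (simp add: sum_distrib_left mult.commute)
      qed
    qed
  qed
qed

text \<open>If one of two points at distance at most 1 lies outside the ball of radius
  \<open>R + 1\<close>, then both lie outside the ball of radius \<open>R\<close> and
  \<open>g\<close> vanishes at both. A Lipschitz constant on the larger ball thus serves all nearby
  pairs.\<close>

lemma lipschitz_supported:
  fixes g :: "'a::real_normed_vector \<Rightarrow> real"
  assumes lip: "\<And>x y. x \<in> cball 0 (R + 1) \<Longrightarrow> y \<in> cball 0 (R + 1) \<Longrightarrow> \<bar>g x - g y\<bar> \<le> L * norm (x - y)"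
    and L: "L \<ge> 0" and supp: "\<And>x. g x \<noteq> 0 \<Longrightarrow> norm x \<le> R" and xy: "norm (x - y) \<le> 1"
  shows "\<bar>g x - g y\<bar> \<le> L * norm (x - y)"
proof (cases "x \<in> cball 0 (R + 1) \<and> y \<in> cball 0 (R + 1)")
  case False
  then have "norm x > R" "norm y > R"
    using xy norm_triangle_ineq2[of x y] norm_triangle_ineq2[of y x] by (auto simp: norm_minus_commute)
  then show ?thesis using supp[of x] supp[of y] L by force
qed (use lip in blast)

text \<open>Difference quotients have integral zero by translation invariance, and the Lipschitz
  bound allows passage to the limit by dominated convergence. The exceptional null set
  \<open>N\<close> makes room for the kinks of ramps and of extensions by zero.\<close>

lemma integral_directional_derivative_zero:
  fixes g :: "'a::euclidean_space \<Rightarrow> real"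
  assumes lip: "\<And>x y. norm (x - y) \<le> 1 \<Longrightarrow> \<bar>g x - g y\<bar> \<le> L * norm (x - y)"
    and supp: "\<And>x. g x \<noteq> 0 \<Longrightarrow> norm x \<le> R"
    and N: "negligible N" and der: "\<And>x. x \<notin> N \<Longrightarrow> (g has_derivative g' x) (at x)"
    and meas: "(\<lambda>x. g' x v) \<in> borel_measurable borel" and v: "norm v \<le> 1"
  shows "integrable lborel (\<lambda>x. g' x v)" "(\<integral>x. g' x v \<partial>lborel) = 0"
proof -
  have cont: "continuous_on UNIV g"
    unfolding continuous_on_iff
  proof (intro ballI allI impI)
    fix x and e :: real assume "e > 0"
    show "\<exists>d>0. \<forall>y\<in>UNIV. dist y x < d \<longrightarrow> dist (g y) (g x) < e"
    proof (intro exI conjI ballI impI)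
      show "min 1 (e / (\<bar>L\<bar> + 1)) > 0" using \<open>e > 0\<close> by simp
      fix y assume y: "dist y x < min 1 (e / (\<bar>L\<bar> + 1))"
      then have "\<bar>g y - g x\<bar> \<le> L * norm (y - x)" by (intro lip) (simp add: dist_norm)
      also have "\<dots> \<le> (\<bar>L\<bar> + 1) * norm (y - x)" by (rule mult_right_mono) auto
      also have "\<dots> < (\<bar>L\<bar> + 1) * (e / (\<bar>L\<bar> + 1))"
        using y by (intro mult_strict_left_mono) (auto simp: dist_norm)
      finally show "dist (g y) (g x) < e" by (simp add: dist_real_def)
    qed
  qed
  have gint: "integrable lborel g" by (rule integrable_compact_support[OF cont supp])
  have [measurable]: "g \<in> borel_measurable borel" by (rule borel_measurable_continuous_onI[OF cont])
  \<comment> \<open>The step lengths are at most 1 and so is \<open>norm v\<close>, so all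
    increments lie in the range of the Lipschitz hypothesis.\<close>
  define t where "t n = inverse (real (Suc n))" for n
  have t: "0 < t n" "t n \<le> 1" for n by (auto simp: t_def inverse_le_1_iff)
  define f where "f n x = (g (x + t n *\<^sub>R v) - g x) / t n" for n x
  have shift: "(\<integral>x. g (x + c) \<partial>lborel) = (\<integral>x. g x \<partial>lborel)" "integrable lborel (\<lambda>x. g (x + c))" for c
  proof -
    have "(\<integral>x. g x \<partial>distr lborel borel ((+) c)) = (\<integral>x. g (c + x) \<partial>lborel)"
      by (rule integral_distr) auto
    then show "(\<integral>x. g (x + c) \<partial>lborel) = (\<integral>x. g x \<partial>lborel)"
      by (simp add: lborel_distr_plus add.commute)
    have "integrable (distr lborel borel ((+) c)) g" using gint by (simp add: lborel_distr_plus)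
    then show "integrable lborel (\<lambda>x. g (x + c))"
      by (subst (asm) integrable_distr_eq) (auto simp: add.commute)
  qed
  have f0: "(\<integral>x. f n x \<partial>lborel) = 0" for n
    by (simp add: f_def shift gint)
  have lim: "(\<lambda>n. f n x) \<longlonglongrightarrow> g' x v" if "x \<notin> N" for x
  proof -
    have "((\<lambda>r. x + r *\<^sub>R v) has_derivative (\<lambda>r. r *\<^sub>R v)) (at (0::real))"
      by (auto intro!: derivative_eq_intros)
    moreover have "(g has_derivative g' x) (at (x + 0 *\<^sub>R v))" using der[OF that] by simp
    ultimately have "((\<lambda>r. g (x + r *\<^sub>R v)) has_derivative (\<lambda>r. g' x (r *\<^sub>R v))) (at 0)"
      by (rule has_derivative_compose)
    then have "((\<lambda>r. g (x + r *\<^sub>R v)) has_real_derivative g' x v) (at 0)"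
      using has_derivative_bounded_linear[OF der[OF that]]
      by (simp add: has_field_derivative_def linear_cmul[OF bounded_linear.linear] mult_commute_abs)
    then have "(\<lambda>r. (g (x + r *\<^sub>R v) - g x) / r) \<midarrow>0\<rightarrow> g' x v"
      by (simp add: DERIV_def)
    moreover have "filterlim t (at 0) sequentially"
      using LIMSEQ_inverse_real_of_nat by (simp add: filterlim_at t_def[abs_def])
    ultimately show ?thesis unfolding f_def by (rule filterlim_compose)
  qed
  \<comment> \<open>A quotient can be nonzero only within distance 1 of the support, hence the
    radius \<open>R + 1\<close> in the dominating function.\<close>
  have bd: "norm (f n x) \<le> indicator (cball 0 (R + 1)) x * \<bar>L\<bar>" for n x
  proof (cases "g (x + t n *\<^sub>R v) = 0 \<and> g x = 0")
    case True
    then show ?thesis by (simp add: f_def)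
  next
    case False
    have tv: "norm (t n *\<^sub>R v) \<le> t n" using v t[of n] by (simp add: mult_left_le)
    have "norm x \<le> R + 1"
    proof (cases "g x = 0")
      case True
      then have "norm (x + t n *\<^sub>R v) \<le> R" using False supp by blast
      moreover have "norm x \<le> norm (x + t n *\<^sub>R v) + norm (t n *\<^sub>R v)"
        using norm_triangle_ineq4[of "x + t n *\<^sub>R v" "t n *\<^sub>R v"] by simp
      ultimately show ?thesis using tv t[of n] by linarith
    qed (use supp[of x] in simp)
    moreover have "\<bar>g (x + t n *\<^sub>R v) - g x\<bar> \<le> L * norm (t n *\<^sub>R v)"
      using lip[of "x + t n *\<^sub>R v" x] order_trans[OF tv t(2)] by simp
    then have "\<bar>g (x + t n *\<^sub>R v) - g x\<bar> \<le> \<bar>L\<bar> * t n"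
      by (rule order_trans) (use tv in \<open>auto intro!: mult_mono\<close>)
    ultimately show ?thesis using t[of n] by (simp add: f_def divide_le_eq)
  qed
  have wint: "integrable lborel (\<lambda>x::'a. indicator (cball 0 (R + 1)) x * \<bar>L\<bar>)"
    using borel_integrable_compact[OF compact_cball, of "0::'a" "R + 1" "\<lambda>_. \<bar>L\<bar>"] by simp
  have meas': "(\<lambda>x. g' x v) \<in> borel_measurable lborel" using meas by simp
  have fm: "f n \<in> borel_measurable lborel" for n unfolding f_def by measurable
  have lim': "AE x in lborel. (\<lambda>n. f n x) \<longlonglongrightarrow> g' x v"
    using negligible_AE_lborel[OF N] by eventually_elim (rule lim)
  show "integrable lborel (\<lambda>x. g' x v)"
    by (rule integrable_dominated_convergence[OF meas' fm wint lim']) (use bd in auto)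
  have "(\<lambda>n. \<integral>x. f n x \<partial>lborel) \<longlonglongrightarrow> (\<integral>x. g' x v \<partial>lborel)"
    by (rule integral_dominated_convergence[OF meas' fm wint lim']) (use bd in auto)
  then show "(\<integral>x. g' x v \<partial>lborel) = 0" by (simp add: f0 LIMSEQ_const_iff)
qed

lemma integral_eq_lborel:
  fixes f :: "'a::euclidean_space \<Rightarrow> real"
  assumes "compact S" "continuous_on S f"
  shows "integral S f = (\<integral>x. indicator S x * f x \<partial>lborel)"
  using borel_integrable_compact[OF assms] set_borel_integral_eq_integral(2)[of S f]
  by (simp add: set_integrable_def set_lebesgue_integral_def)

lemma integral_partial_zero_boundary:
  fixes f :: "real^'m \<Rightarrow> real"
  assumes B: "smooth_domain B" and f: "smooth f" and f0: "\<And>x. x \<in> frontier B \<Longrightarrow> f x = 0"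
  shows "integral B (\<lambda>x. frechet_derivative f (at x) (axis i 1)) = 0"
proof -
  have Df: "smooth (\<lambda>x. frechet_derivative f (at x) (axis i 1))" by (intro smooth_intros f)
  define g where "g x = (if x \<in> B then f x else 0)" for x
  define g' where "g' x v = indicator (interior B) x * frechet_derivative f (at x) v" for x v
  obtain R where R: "\<And>x. x \<in> B \<Longrightarrow> norm x \<le> R"
    using smooth_domainD(3)[OF B] by (auto simp: bounded_iff)
  obtain L where L: "L \<ge> 0" "\<And>x y. x \<in> cball 0 (R + 1) \<Longrightarrow> y \<in> cball 0 (R + 1) \<Longrightarrow>
      norm (f x - f y) \<le> L * norm (x - y)"
    using smooth_lipschitz_cball[OF f] by blast
  \<comment> \<open>A segment from a point of \<open>B\<close> to a point outside meets the
    frontier, where \<open>f\<close> vanishes. The Lipschitz estimate up to that point already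
    bounds the jump to zero.\<close>
  have cross: "\<bar>f x\<bar> \<le> L * norm (x - y)"
    if x: "x \<in> B" "x \<in> cball 0 (R + 1)" and y: "y \<notin> B" "y \<in> cball 0 (R + 1)" for x y
  proof -
    obtain z where z: "z \<in> closed_segment x y" "z \<in> frontier B"
      using connected_Int_frontier[of "closed_segment x y" B] x(1) y(1) by auto
    have "z \<in> cball 0 (R + 1)"
      using z(1) closed_segment_subset[OF x(2) y(2) convex_cball] by blast
    then have "\<bar>f x\<bar> \<le> L * norm (x - z)" using L(2)[OF x(2), of z] f0[OF z(2)] by simp
    also have "\<dots> \<le> L * norm (x - y)"
      using segment_bound(1)[OF z(1)] L(1) by (intro mult_left_mono) (auto simp: norm_minus_commute)
    finally show ?thesis .
  qed
  have lip: "\<bar>g x - g y\<bar> \<le> L * norm (x - y)" if "x \<in> cball 0 (R + 1)" "y \<in> cball 0 (R + 1)" for x y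
    using that L cross[of x y] cross[of y x] by (auto simp: g_def norm_minus_commute)
  have supp: "norm x \<le> R" if "g x \<noteq> 0" for x using that R by (auto simp: g_def split: if_splits)
  have der: "(g has_derivative g' x) (at x)" if x: "x \<notin> frontier B" for x
  proof (cases "x \<in> interior B")
    case True
    have "(g has_derivative frechet_derivative f (at x)) (at x)"
      by (rule has_derivative_transform_within_open[OF smooth_has_derivative[OF f] open_interior True])
        (use interior_subset in \<open>auto simp: g_def\<close>)
    then show ?thesis using True by (simp add: g'_def[abs_def])
  next
    case False
    then have xB: "x \<in> - B" using x closure_subset by (auto simp: frontier_def)
    have "(g has_derivative (\<lambda>v. 0)) (at x)"
      by (rule has_derivative_transform_within_open[OF has_derivative_const _ xB])
        (use smooth_domainD(2)[OF B] in \<open>auto simp: g_def\<close>)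
    then show ?thesis using False by (simp add: g'_def[abs_def])
  qed
  have m: "(\<lambda>x. g' x (axis i 1)) \<in> borel_measurable borel"
    unfolding g'_def using smooth_borel_measurable[OF Df] by simp
  have "(\<integral>x. g' x (axis i 1) \<partial>lborel) = 0"
    by (rule integral_directional_derivative_zero[OF lipschitz_supported[OF lip L(1) supp] supp
        smooth_domain_negligible_frontier[OF B] der m]) auto
  moreover have "(\<integral>x. g' x (axis i 1) \<partial>lborel) =
      (\<integral>x. indicator B x * frechet_derivative f (at x) (axis i 1) \<partial>lborel)"
  proof (rule integral_cong_AE)
    show "AE x in lborel. g' x (axis i 1) = indicator B x * frechet_derivative f (at x) (axis i 1)"
      using negligible_AE_lborel[OF smooth_domain_negligible_frontier[OF B]]
    proof eventually_elim
      case (elim x)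
      then have "x \<in> B \<longleftrightarrow> x \<in> interior B" using closure_subset interior_subset by (auto simp: frontier_def)
      then show ?case by (simp add: g'_def indicator_def)
    qed
  qed (use m smooth_borel_measurable[OF Df] borel_closed[OF smooth_domainD(2)[OF B]] in auto)
  ultimately show ?thesis
    using integral_eq_lborel[OF smooth_domainD(1)[OF B] smooth_continuous[OF Df]] by simp
qed

lemma smooth_div [smooth_intros]: "smooth X \<Longrightarrow> smooth (div_in UNIV X)"
  unfolding div_in_def by (intro smooth_intros)

lemma norm_set_coord_le: "norm (set_coord k c y) \<le> norm y + \<bar>c\<bar>"
proof -
  have "set_coord k c y = set_coord k 0 y + c *\<^sub>R axis k 1"
    by (simp add: set_coord_eq algebra_simps)
  then have "norm (set_coord k c y) \<le> norm (set_coord k 0 y) + \<bar>c\<bar>"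
    using norm_triangle_ineq[of "set_coord k 0 y" "c *\<^sub>R axis k 1"] by simp
  also have "norm (set_coord k 0 y) \<le> norm y"
    by (rule norm_le_componentwise_cart) (simp add: set_coord_def)
  finally show ?thesis by simp
qed

lemma frechet_derivative_zero_off_support:
  assumes "x \<notin> closure {x. f x \<noteq> 0}"
  shows "frechet_derivative f (at x) v = 0"
proof -
  have "(f has_derivative (\<lambda>v. 0)) (at x)"
  proof (rule has_derivative_transform_within_open[OF has_derivative_const])
    show "open (- closure {x. f x \<noteq> 0})" "x \<in> - closure {x. f x \<noteq> 0}" using assms by auto
    show "0 = f y" if "y \<in> - closure {x. f x \<noteq> 0}" for y
      using that closure_subset[of "{x. f x \<noteq> 0}"] by fastforce
  qed
  from fun_cong[OF frechet_derivative_at[OF this], of v] show ?thesis by simp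
qed

section \<open>The divergence theorem in a patch\<close>

text \<open>The ramp \<open>max 0 (min 1 (q / \<epsilon>))\<close> approximates the indicator of \<open>B\<close> inside the patch. Its gradient
  is supported in the strip \<open>0 < q < \<epsilon>\<close>, which is mapped to the slab of thickness 1 occurring in
  \<^const>\<open>graph_integral\<close>.\<close>

lemma patch_ramp:
  fixes Z :: "real^'m \<Rightarrow> real^'m"
  assumes gp: "graph_patch B U k s h" and Z: "smooth Z" and R: "\<And>x. Z x \<noteq> 0 \<Longrightarrow> norm x \<le> R"
    and \<epsilon>: "\<epsilon> > 0"
  defines "q \<equiv> \<lambda>x. s * (h x - x $ k)"
    and "G \<equiv> \<lambda>x. s * ((axis k 1 - grad_in UNIV h x) \<bullet> Z x)"
  shows "(\<integral>x. max 0 (min 1 (q x / \<epsilon>)) * div_in UNIV Z x \<partial>lborel) =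
    (\<integral>x. indicator {x. 0 < x $ k \<and> x $ k < 1} x * G (set_coord k (h x - s * \<epsilon> * x $ k) x) \<partial>lborel)"
proof -
  note h = patchD(3,4)[OF gp] and s = patchD(2)[OF gp]
  have q: "smooth q" unfolding q_def by (intro smooth_intros h)
  have G: "smooth G" unfolding G_def by (intro smooth_intros smooth_grad h Z)
  note [measurable] = smooth_borel_measurable[OF q] smooth_borel_measurable[OF G]
    smooth_borel_measurable[OF smooth_div[OF Z]]
  define \<theta> where "\<theta> x = max 0 (min 1 (q x / \<epsilon>))" for x
  have [measurable]: "\<theta> \<in> borel_measurable borel" unfolding \<theta>_def by measurable
  \<comment> \<open>The kinks of the ramp lie on two graphs, where \<open>q\<close> is 0 or
    \<open>\<epsilon>\<close>.\<close>
  define N where "N = {x. q x = 0} \<union> {x. q x = \<epsilon>}"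
  have "negligible N"
  proof -
    have "{x. q x = 0} = {x. x $ k = h x}" using s by (auto simp: q_def)
    moreover have "{x. q x = \<epsilon>} = {x. x $ k = h x - s * \<epsilon>}" using s by (auto simp: q_def)
    moreover have "smooth (\<lambda>x. h x - s * \<epsilon>)" by (intro smooth_intros h)
    ultimately show ?thesis
      unfolding N_def using negligible_graph[of h k] negligible_graph[of "\<lambda>x. h x - s * \<epsilon>" k] h by simp
  qed
  define strip where "strip = {x. 0 < q x \<and> q x < \<epsilon>}"
  have [measurable]: "strip \<in> sets borel" unfolding strip_def by measurable
  have q': "frechet_derivative q (at x) v = - (s * ((axis k 1 - grad_in UNIV h x) \<bullet> v))" for x v
  proof -
    have "(q has_derivative (\<lambda>v. s * (grad_in UNIV h x \<bullet> v - v $ k))) (at x)"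
      unfolding q_def
      by (rule has_derivative_eq_rhs[OF has_derivative_mult_right[OF has_derivative_diff[OF
              smooth_has_derivative[OF h(1)] has_derivative_nth]]])
        (simp add: smooth_derivative_grad[OF h(1)])
    from frechet_derivative_at[OF this, symmetric] show ?thesis
      by (simp add: inner_diff_left inner_axis' algebra_simps)
  qed
  define g' where "g' i x v = indicator strip x * (frechet_derivative q (at x) v / \<epsilon>) * Z x $ i
      + \<theta> x * frechet_derivative Z (at x) v $ i" for i x v
  have Zi: "smooth (\<lambda>x. Z x $ i)" for i by (intro smooth_intros Z)
  have parts: "integrable lborel (\<lambda>x. g' i x (axis i 1))" "(\<integral>x. g' i x (axis i 1) \<partial>lborel) = 0" for i
  proof -
    obtain Lq where Lq: "Lq \<ge> 0" "\<And>x y. x \<in> cball 0 (R + 1) \<Longrightarrow> y \<in> cball 0 (R + 1) \<Longrightarrow>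
        norm (q x - q y) \<le> Lq * norm (x - y)"
      using smooth_lipschitz_cball[OF q] by blast
    obtain LZ where LZ: "LZ \<ge> 0" "\<And>x y. x \<in> cball 0 (R + 1) \<Longrightarrow> y \<in> cball 0 (R + 1) \<Longrightarrow>
        norm (Z x $ i - Z y $ i) \<le> LZ * norm (x - y)"
      using smooth_lipschitz_cball[OF Zi] by blast
    have "bounded ((\<lambda>x. Z x $ i) ` cball 0 (R + 1))"
      by (intro compact_imp_bounded compact_continuous_image smooth_continuous Zi compact_cball)
    then obtain M where M: "\<And>x. x \<in> cball 0 (R + 1) \<Longrightarrow> \<bar>Z x $ i\<bar> \<le> M" "M \<ge> 0"
      unfolding bounded_pos by (force simp: less_imp_le)
    define L where "L = Lq / \<epsilon> * M + LZ"
    have L: "L \<ge> 0" using Lq(1) LZ(1) M(2) \<epsilon> by (simp add: L_def)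
    have lip: "\<bar>\<theta> x * Z x $ i - \<theta> y * Z y $ i\<bar> \<le> L * norm (x - y)"
      if xy: "x \<in> cball 0 (R + 1)" "y \<in> cball 0 (R + 1)" for x y
    proof -
      have "\<bar>\<theta> x - \<theta> y\<bar> \<le> \<bar>q x / \<epsilon> - q y / \<epsilon>\<bar>" by (auto simp: \<theta>_def)
      also have "\<dots> \<le> Lq / \<epsilon> * norm (x - y)"
        using Lq(2)[OF xy] \<epsilon> by (simp add: diff_divide_distrib[symmetric] divide_right_mono)
      finally have 1: "\<bar>\<theta> x - \<theta> y\<bar> \<le> Lq / \<epsilon> * norm (x - y)" .
      have "\<bar>\<theta> x * Z x $ i - \<theta> y * Z y $ i\<bar> = \<bar>(\<theta> x - \<theta> y) * Z x $ i + \<theta> y * (Z x $ i - Z y $ i)\<bar>"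
        by (simp add: algebra_simps)
      also have "\<dots> \<le> \<bar>\<theta> x - \<theta> y\<bar> * \<bar>Z x $ i\<bar> + \<bar>\<theta> y\<bar> * \<bar>Z x $ i - Z y $ i\<bar>"
        unfolding abs_mult[symmetric] by (rule abs_triangle_ineq)
      also have "\<dots> \<le> Lq / \<epsilon> * norm (x - y) * M + 1 * (LZ * norm (x - y))"
      proof (rule add_mono)
        show "\<bar>\<theta> x - \<theta> y\<bar> * \<bar>Z x $ i\<bar> \<le> Lq / \<epsilon> * norm (x - y) * M"
          by (rule mult_mono[OF 1 M(1)[OF xy(1)]]) (use Lq(1) \<epsilon> in auto)
        show "\<bar>\<theta> y\<bar> * \<bar>Z x $ i - Z y $ i\<bar> \<le> 1 * (LZ * norm (x - y))"
          by (rule mult_mono) (use LZ(2)[OF xy] in \<open>auto simp: \<theta>_def\<close>)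
      qed
      finally show ?thesis by (simp add: L_def algebra_simps)
    qed
    have supp: "norm x \<le> R" if "\<theta> x * Z x $ i \<noteq> 0" for x
      by (rule R) (use that in auto)
    have der: "((\<lambda>x. \<theta> x * Z x $ i) has_derivative g' i x) (at x)" if x: "x \<notin> N" for x
    proof -
      have DZ: "((\<lambda>x. Z x $ i) has_derivative (\<lambda>v. frechet_derivative Z (at x) v $ i)) (at x)"
        by (rule bounded_linear.has_derivative[OF bounded_linear_vec_nth smooth_has_derivative[OF Z]])
      have qc: "continuous_on UNIV q" by (rule smooth_continuous[OF q])
      consider "q x < 0" | "x \<in> strip" | "q x > \<epsilon>"
        using x by (force simp: N_def strip_def)
      then have "(\<theta> has_derivative (\<lambda>v. indicator strip x * (frechet_derivative q (at x) v / \<epsilon>))) (at x)"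
      proof cases
        case 1
        have "(\<theta> has_derivative (\<lambda>v. 0)) (at x)"
        proof (rule has_derivative_transform_within_open[OF has_derivative_const])
          show "open {x. q x < 0}" by (intro open_Collect_less qc continuous_on_const)
          show "0 = \<theta> y" if "y \<in> {x. q x < 0}" for y
            using divide_neg_pos[of "q y" \<epsilon>] that \<epsilon> by (simp add: \<theta>_def)
        qed (use 1 in simp)
        then show ?thesis using 1 by (simp add: strip_def)
      next
        case 2
        have "((\<lambda>x. q x / \<epsilon>) has_derivative (\<lambda>v. frechet_derivative q (at x) v / \<epsilon>)) (at x)"
          by (rule bounded_linear.has_derivative[OF bounded_linear_divide smooth_has_derivative[OF q]])
        then have "(\<theta> has_derivative (\<lambda>v. frechet_derivative q (at x) v / \<epsilon>)) (at x)"
        proof (rule has_derivative_transform_within_open)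
          show "open strip" unfolding strip_def
            by (intro open_Collect_conj open_Collect_less qc continuous_on_const)
          show "q y / \<epsilon> = \<theta> y" if "y \<in> strip" for y
            using that \<epsilon> by (simp add: \<theta>_def strip_def)
        qed (rule 2)
        then show ?thesis using 2 by simp
      next
        case 3
        have "(\<theta> has_derivative (\<lambda>v. 0)) (at x)"
        proof (rule has_derivative_transform_within_open[OF has_derivative_const])
          show "open {x. \<epsilon> < q x}" by (intro open_Collect_less qc continuous_on_const)
          show "1 = \<theta> y" if "y \<in> {x. \<epsilon> < q x}" for y
            using that \<epsilon> by (simp add: \<theta>_def)
        qed (use 3 in simp)
        then show ?thesis using 3 by (simp add: strip_def)
      qed
      from has_derivative_mult[OF this DZ] show ?thesis
        by (simp add: g'_def[abs_def] algebra_simps)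
    qed
    have m1: "(\<lambda>x. frechet_derivative Z (at x) (axis i 1) $ i) \<in> borel_measurable borel"
      by (intro smooth_borel_measurable smooth_intros Z)
    have m2: "(\<lambda>x. frechet_derivative q (at x) (axis i 1)) \<in> borel_measurable borel"
      by (intro smooth_borel_measurable smooth_intros q)
    note [measurable] = m1 m2 smooth_borel_measurable[OF Zi]
    have m: "(\<lambda>x. g' i x (axis i 1)) \<in> borel_measurable borel"
      unfolding g'_def by measurable
    note * = integral_directional_derivative_zero[OF lipschitz_supported[OF lip L supp] supp
        \<open>negligible N\<close> der m]
    show "integrable lborel (\<lambda>x. g' i x (axis i 1))" by (rule *(1)) auto
    show "(\<integral>x. g' i x (axis i 1) \<partial>lborel) = 0" by (rule *(2)) auto
  qed
  have sum: "(\<Sum>i\<in>UNIV. g' i x (axis i 1)) = \<theta> x * div_in UNIV Z x - indicator strip x * (G x / \<epsilon>)" for x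
  proof -
    \<comment> \<open>The function \<open>q\<close> decreases towards the outside. Its gradient is
      minus the conormal that enters \<open>G\<close>, hence the minus sign.\<close>
    have "(\<Sum>i\<in>UNIV. frechet_derivative q (at x) (axis i 1) * Z x $ i) = - G x"
      by (simp add: q' G_def inner_vec_def[of _ "Z x"] inner_axis sum_distrib_left sum_negf mult_ac)
    then have *: "- (indicator strip x * (G x / \<epsilon>)) =
        indicator strip x * ((\<Sum>i\<in>UNIV. frechet_derivative q (at x) (axis i 1) * Z x $ i) / \<epsilon>)"
      by simp
    show ?thesis
      unfolding diff_conv_add_uminus * g'_def div_in_def
      by (simp add: sum.distrib sum_distrib_left sum_divide_distrib algebra_simps)
  qed
  have Z0: "\<theta> x * div_in UNIV Z x = 0" if "norm x > R" for x
  proof -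
    have "closure {x. Z x \<noteq> 0} \<subseteq> cball 0 R" by (rule closure_minimal) (use R in auto)
    then have "x \<notin> closure {x. Z x \<noteq> 0}" using that by auto
    from frechet_derivative_zero_off_support[OF this] show ?thesis by (simp add: div_in_def)
  qed
  have i1: "integrable lborel (\<lambda>x. \<theta> x * div_in UNIV Z x)"
    by (rule integrable_compact_support[of _ R])
      (use Z0 \<epsilon> in \<open>auto simp: \<theta>_def not_le[symmetric] intro!: continuous_intros
        smooth_continuous[OF q] smooth_continuous[OF smooth_div[OF Z]]\<close>)
  have i2: "integrable lborel (\<lambda>x. indicator strip x * (G x / \<epsilon>))"
  proof -
    have "integrable lborel (\<lambda>x. \<Sum>i\<in>UNIV. g' i x (axis i 1))"
      by (rule Bochner_Integration.integrable_sum) (rule parts(1))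
    from Bochner_Integration.integrable_diff[OF i1 this] show ?thesis by (simp add: sum)
  qed
  have "(\<integral>x. \<theta> x * div_in UNIV Z x \<partial>lborel) - (\<integral>x. indicator strip x * (G x / \<epsilon>) \<partial>lborel) =
      (\<integral>x. (\<Sum>i\<in>UNIV. g' i x (axis i 1)) \<partial>lborel)"
    unfolding sum by (rule Bochner_Integration.integral_diff[OF i1 i2, symmetric])
  also have "\<dots> = 0" by (simp add: Bochner_Integration.integral_sum[OF parts(1)] parts(2))
  finally have "(\<integral>x. \<theta> x * div_in UNIV Z x \<partial>lborel) = (\<integral>x. indicator strip x * (G x / \<epsilon>) \<partial>lborel)"
    by simp
  \<comment> \<open>In the new variables \<open>q\<close> becomes \<open>\<epsilon> * x $ k\<close>,
    so the strip pulls back to the slab \<open>0 < x $ k < 1\<close>, and the Jacobian cancels the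
    factor \<open>1 / \<epsilon>\<close>.\<close>
  also have "\<dots> = \<bar>- s * \<epsilon>\<bar> * (\<integral>x. indicator strip (set_coord k (h x + (- s * \<epsilon>) * x $ k) x) *
      (G (set_coord k (h x + (- s * \<epsilon>) * x $ k) x) / \<epsilon>) \<partial>lborel)"
    by (rule integral_graph_affine[OF smooth_borel_measurable[OF h(1)] h(2)])
      (use s \<epsilon> in auto)
  also have "\<dots> = (\<integral>x. \<bar>- s * \<epsilon>\<bar> * (indicator strip (set_coord k (h x + (- s * \<epsilon>) * x $ k) x) *
      (G (set_coord k (h x + (- s * \<epsilon>) * x $ k) x) / \<epsilon>)) \<partial>lborel)"
    by simp
  also have "\<dots> = (\<integral>x. indicator {x. 0 < x $ k \<and> x $ k < 1} x * G (set_coord k (h x - s * \<epsilon> * x $ k) x) \<partial>lborel)"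
  proof (rule Bochner_Integration.integral_cong[OF refl])
    fix x
    have "q (set_coord k (h x + (- s * \<epsilon>) * x $ k) x) = \<epsilon> * x $ k"
      using s by (auto simp: q_def h(2))
    then have "indicator strip (set_coord k (h x + (- s * \<epsilon>) * x $ k) x) =
        (indicator {x. 0 < x $ k \<and> x $ k < 1} x :: real)"
      using \<epsilon> by (auto simp: strip_def indicator_def zero_less_mult_iff)
    then show "\<bar>- s * \<epsilon>\<bar> * (indicator strip (set_coord k (h x + (- s * \<epsilon>) * x $ k) x) *
      (G (set_coord k (h x + (- s * \<epsilon>) * x $ k) x) / \<epsilon>)) =
      indicator {x. 0 < x $ k \<and> x $ k < 1} x * G (set_coord k (h x - s * \<epsilon> * x $ k) x)"
      using s \<epsilon> by (auto simp: abs_mult)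
  qed
  finally show ?thesis by (simp add: \<theta>_def)
qed

lemma in_support_closure: "f x \<noteq> 0 \<Longrightarrow> x \<in> closure {x. f x \<noteq> 0}"
  using closure_subset by fastforce

text \<open>The width in \<open>patch_ramp\<close> tends to zero. On the left the ramp tends to the
  indicator of \<open>q x > 0\<close>, and on the right the points of the strip collapse onto the
  graph.\<close>

lemma patch_divergence:
  fixes Z :: "real^'m \<Rightarrow> real^'m"
  assumes gp: "graph_patch B U k s h" and B: "compact B" and Z: "smooth Z"
    and supp: "compact (closure {x. Z x \<noteq> 0})" "closure {x. Z x \<noteq> 0} \<subseteq> U"
  shows "integral B (div_in UNIV Z) = graph_integral k h (\<lambda>x. Z x \<bullet> patch_normal k s h x)"
proof -
  note h = patchD(3,4)[OF gp] and s = patchD(2)[OF gp]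
  define q where "q x = s * (h x - x $ k)" for x
  define G where "G x = s * ((axis k 1 - grad_in UNIV h x) \<bullet> Z x)" for x
  define D where "D = div_in UNIV Z"
  have q: "smooth q" unfolding q_def by (intro smooth_intros h)
  have G: "smooth G" unfolding G_def by (intro smooth_intros smooth_grad h Z)
  have D: "smooth D" unfolding D_def by (rule smooth_div[OF Z])
  obtain R where R: "\<And>x. x \<in> closure {x. Z x \<noteq> 0} \<Longrightarrow> norm x \<le> R"
    using compact_imp_bounded[OF supp(1)] by (auto simp: bounded_iff)
  have ZR: "norm x \<le> R" if "Z x \<noteq> 0" for x
    using R in_support_closure[of Z x] that by blast
  have D0: "D x = 0" if "x \<notin> closure {x. Z x \<noteq> 0}" for x
    using frechet_derivative_zero_off_support[OF that] by (simp add: D_def div_in_def)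
  have DR: "norm x \<le> R" if "D x \<noteq> 0" for x using D0 R that by blast
  have GR: "norm x \<le> R" if "G x \<noteq> 0" for x using ZR[of x] that by (cases "Z x = 0") (auto simp: G_def)
  note [measurable] = smooth_borel_measurable[OF q] smooth_borel_measurable[OF G] smooth_borel_measurable[OF D]
  define t where "t n = inverse (real (Suc n))" for n
  have t: "t n > 0" "t n \<le> 1" for n by (auto simp: t_def inverse_le_1_iff)
  have tlim: "t \<longlonglongrightarrow> 0" unfolding t_def by (rule LIMSEQ_inverse_real_of_nat)
  define S where "S = {x :: real^'m. 0 < x $ k \<and> x $ k < 1}"
  have "open S" unfolding S_def
    by (intro open_Collect_conj open_Collect_less continuous_on_const
        linear_continuous_on bounded_linear_vec_nth)
  then have Sm [measurable]: "S \<in> sets borel" by simp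
  have ramp: "(\<integral>x. max 0 (min 1 (q x / t n)) * D x \<partial>lborel) =
      (\<integral>x. indicator S x * G (set_coord k (h x - s * t n * x $ k) x) \<partial>lborel)" for n
    using patch_ramp[OF gp Z ZR t(1)] unfolding q_def G_def D_def S_def .
  have left: "(\<lambda>n. \<integral>x. max 0 (min 1 (q x / t n)) * D x \<partial>lborel) \<longlonglongrightarrow>
      (\<integral>x. indicator {x. q x > 0} x * D x \<partial>lborel)"
  proof (rule integral_dominated_convergence[where w = "\<lambda>x. \<bar>D x\<bar>"])
    show "integrable lborel (\<lambda>x. \<bar>D x\<bar>)"
      by (rule integrable_compact_support[of _ R])
        (use DR in \<open>auto intro!: continuous_intros smooth_continuous[OF D]\<close>)
    show "AE x in lborel. (\<lambda>n. max 0 (min 1 (q x / t n)) * D x) \<longlonglongrightarrow> indicator {x. q x > 0} x * D x"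
    proof (rule AE_I2, rule tendsto_mult[OF _ tendsto_const])
      fix x
      show "(\<lambda>n. max 0 (min 1 (q x / t n))) \<longlonglongrightarrow> indicator {x. q x > 0} x"
      proof (cases "q x > 0")
        case True
        then have "\<forall>\<^sub>F n in sequentially. t n < q x"
          using order_tendstoD(2)[OF tlim] by blast
        then have "\<forall>\<^sub>F n in sequentially. max 0 (min 1 (q x / t n)) = 1"
          by eventually_elim (use t in \<open>auto simp: min_def field_simps\<close>)
        then show ?thesis using True by (simp add: tendsto_eventually)
      next
        case False
        then have "q x / t n \<le> 0" for n using t(1)[of n] by (simp add: divide_nonpos_pos)
        then have "max 0 (min 1 (q x / t n)) = 0" for n by (intro max_absorb1) (simp add: min.coboundedI2)
        then show ?thesis using False by simp
      qed
    qed
    show "AE x in lborel. norm (max 0 (min 1 (q x / t n)) * D x) \<le> \<bar>D x\<bar>" for n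
      by (rule AE_I2) (auto simp: abs_mult intro!: mult_left_le_one_le)
  qed measurable
  have cont: "continuous_on UNIV (\<lambda>x. G (set_coord k (h x - c * x $ k) x))" for c
    by (intro smooth_continuous smooth_compose[OF G] smooth_intros h)
  have meas: "(\<lambda>x. indicator S x * G (set_coord k (h x - c * x $ k) x)) \<in> borel_measurable lborel" for c
    using borel_measurable_continuous_onI[OF cont[of c]] by simp
  have "compact (G ` cball 0 R)"
    by (intro compact_continuous_image smooth_continuous[OF G] compact_cball)
  then have "bounded (G ` cball 0 R)" by (rule compact_imp_bounded)
  then obtain M where "\<forall>y\<in>G ` cball 0 R. norm y \<le> M" unfolding bounded_iff by blast
  then have M: "\<bar>G x\<bar> \<le> M" if "x \<in> cball 0 R" for x using that by simp
  have GM: "\<bar>G x\<bar> \<le> \<bar>M\<bar>" for x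
    using M[of x] GR[of x] by (cases "G x = 0") auto
  have wint: "integrable lborel (\<lambda>x::real^'m. indicator (cball 0 (R + 1)) x * \<bar>M\<bar>)"
    using borel_integrable_compact[OF compact_cball, of "0::real^'m" "R + 1" "\<lambda>_. \<bar>M\<bar>"] by simp
  have lim: "AE x in lborel. (\<lambda>n. indicator S x * G (set_coord k (h x - s * t n * x $ k) x)) \<longlonglongrightarrow>
      indicator S x * G (set_coord k (h x - 0 * x $ k) x)"
  proof (rule AE_I2, rule tendsto_mult[OF tendsto_const])
    fix x
    have "(\<lambda>n. set_coord k (h x - s * t n * x $ k) x) \<longlonglongrightarrow> set_coord k (h x - s * 0 * x $ k) x"
      unfolding set_coord_eq by (intro tendsto_intros tlim)
    then show "(\<lambda>n. G (set_coord k (h x - s * t n * x $ k) x)) \<longlonglongrightarrow> G (set_coord k (h x - 0 * x $ k) x)"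
      using continuous_on_tendsto_compose[OF smooth_continuous[OF G, of UNIV]] by simp
  qed
  \<comment> \<open>The two points differ only in the \<open>k\<close>-th coordinate, and on the
    slab \<open>\<bar>x $ k\<bar> < 1\<close>. A nonzero value therefore confines \<open>x\<close>
    to the ball of radius \<open>R + 1\<close>, uniformly in \<open>n\<close>.\<close>
  have bd: "AE x in lborel. norm (indicator S x * G (set_coord k (h x - s * t n * x $ k) x)) \<le>
      indicator (cball 0 (R + 1)) x * \<bar>M\<bar>" for n
  proof (rule AE_I2)
    fix x
    let ?y = "set_coord k (h x - s * t n * x $ k) x"
    show "norm (indicator S x * G ?y) \<le> indicator (cball 0 (R + 1)) x * \<bar>M\<bar>"
    proof (cases "x \<in> S \<and> G ?y \<noteq> 0")
      case True
      then have "norm ?y \<le> R" using GR by blast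
      moreover have "norm x \<le> norm ?y + \<bar>x $ k\<bar>"
        using norm_set_coord_le[of k "x $ k" ?y] by simp
      ultimately have "norm x \<le> R + 1" using True by (auto simp: S_def)
      then show ?thesis using True GM[of ?y] by simp
    qed auto
  qed
  have right: "(\<lambda>n. \<integral>x. indicator S x * G (set_coord k (h x - s * t n * x $ k) x) \<partial>lborel) \<longlonglongrightarrow>
      (\<integral>x. indicator S x * G (set_coord k (h x - 0 * x $ k) x) \<partial>lborel)"
    by (rule integral_dominated_convergence[OF meas meas wint lim bd])
  have rint: "integrable lborel (\<lambda>x. indicator S x * G (set_coord k (h x - 0 * x $ k) x))"
    by (rule integrable_dominated_convergence[OF meas meas wint lim bd])
  have "integral B D = (\<integral>x. indicator B x * D x \<partial>lborel)"
    by (rule integral_eq_lborel[OF B smooth_continuous[OF D]])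
  \<comment> \<open>Inside \<open>U\<close> the sets \<open>B\<close> and \<open>q x > 0\<close>
    differ only on the graph, a null set. Outside \<open>U\<close> the divergence \<open>D\<close>
    vanishes.\<close>
  also have "\<dots> = (\<integral>x. indicator {x. q x > 0} x * D x \<partial>lborel)"
  proof (rule integral_cong_AE)
    show "AE x in lborel. indicator B x * D x = indicator {x. q x > 0} x * D x"
      using negligible_AE_lborel[OF negligible_graph[OF h]]
    proof eventually_elim
      case (elim x)
      then have "x \<in> B \<longleftrightarrow> q x > 0" if "x \<in> U"
        using patchD(5)[OF gp that] s by (auto simp: q_def algebra_simps)
      then show ?case using D0[of x] supp(2) by (cases "x \<in> U") (auto simp: indicator_def)
    qed
  qed (use borel_closed[OF compact_imp_closed[OF B]] in measurable)
  also have "\<dots> = (\<integral>x. indicator S x * G (set_coord k (h x - 0 * x $ k) x) \<partial>lborel)"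
    by (rule LIMSEQ_unique[OF left]) (use right ramp in simp)
  also have "\<dots> = integral S (\<lambda>x. G (set_coord k (h x) x))"
    using set_borel_integral_eq_integral(2)[of S "\<lambda>x. G (set_coord k (h x) x)"] rint
    by (simp add: set_integrable_def set_lebesgue_integral_def)
  also have "\<dots> = integral {y. 0 \<le> y $ k \<and> y $ k \<le> 1} (\<lambda>x. G (set_coord k (h x) x))"
  proof (rule integral_spike_set)
    have "negligible {x::real^'m. axis k 1 \<bullet> x = 0}" "negligible {x::real^'m. axis k 1 \<bullet> x = 1}"
      by (rule negligible_hyperplane, simp)+
    then have "negligible ({x::real^'m. x $ k = 0} \<union> {x. x $ k = 1})"
      by (simp add: inner_axis')
    then show "negligible {x \<in> {y. 0 \<le> y $ k \<and> y $ k \<le> 1} - S. G (set_coord k (h x) x) \<noteq> 0}"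
      by (rule negligible_subset) (auto simp: S_def)
    show "negligible {x \<in> S - {y. 0 \<le> y $ k \<and> y $ k \<le> 1}. G (set_coord k (h x) x) \<noteq> 0}"
      by (rule negligible_subset[OF negligible_empty]) (auto simp: S_def)
  qed
  \<comment> \<open>The area factor cancels the normalising denominator of
    \<open>patch_normal\<close>.\<close>
  also have "\<dots> = graph_integral k h (\<lambda>x. Z x \<bullet> patch_normal k s h x)"
    unfolding graph_integral_def
  proof (rule integral_cong)
    fix y
    have "sqrt (1 + (norm (grad_in UNIV h y))\<^sup>2) > 0" by (simp add: add_pos_nonneg)
    then show "G (set_coord k (h y) y) = Z (set_coord k (h y) y) \<bullet> patch_normal k s h (set_coord k (h y) y) *
        sqrt (1 + (norm (grad_in UNIV h y))\<^sup>2)"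
      by (simp add: G_def patch_normal_def grad_set_coord[OF h] inner_commute)
  qed
  finally show ?thesis by (simp add: D_def)
qed

text \<open>The slab in \<open>graph_integral\<close> is unbounded. The compact support of
  \<open>\<eta>\<close> confines the integrand to a box, and there it is continuous although
  \<open>f\<close> is only assumed continuous on the frontier. Integrability and definiteness of the
  boundary integral rest on this.\<close>

lemma graph_integral_eq_cbox:
  fixes \<eta> :: "real^'m \<Rightarrow> real"
  assumes gp: "graph_patch B U k s h" and B: "closed B" and \<eta>: "smooth \<eta>"
    and supp: "compact (closure {x. \<eta> x \<noteq> 0})" "closure {x. \<eta> x \<noteq> 0} \<subseteq> U"
  obtains a b where "box a b \<noteq> {}"
    "\<And>x. \<eta> x \<noteq> 0 \<Longrightarrow> set_coord k 0 x \<in> cbox a b"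
    "\<And>y. y \<in> cbox a b \<Longrightarrow> \<eta> (set_coord k (h y) y) \<noteq> 0 \<Longrightarrow> set_coord k (h y) y \<in> frontier B"
    "\<And>f. continuous_on (frontier B) f \<Longrightarrow> continuous_on (cbox a b)
      (\<lambda>y. \<eta> (set_coord k (h y) y) * f (set_coord k (h y) y) * sqrt (1 + (norm (grad_in UNIV h y))\<^sup>2))"
    "\<And>f. graph_integral k h (\<lambda>x. \<eta> x * f x) = integral (cbox a b)
      (\<lambda>y. \<eta> (set_coord k (h y) y) * f (set_coord k (h y) y) * sqrt (1 + (norm (grad_in UNIV h y))\<^sup>2))"
proof -
  note h = patchD(3,4)[OF gp]
  define C where "C = closure {x. \<eta> x \<noteq> 0}"
  define T where "T y = set_coord k (h y) y" for y
  define w where "w y = sqrt (1 + (norm (grad_in UNIV h y))\<^sup>2)" for y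
  have T: "continuous_on S T" for S unfolding T_def by (intro smooth_continuous smooth_intros h)
  have w: "continuous_on S w" for S unfolding w_def
    by (intro continuous_intros smooth_continuous smooth_grad h)
  have \<eta>C: "x \<in> C" if "\<eta> x \<noteq> 0" for x using in_support_closure[of \<eta>, OF that] by (simp add: C_def)
  obtain R where R: "R > 0" "\<And>x. x \<in> C \<Longrightarrow> norm x \<le> R"
    using compact_imp_bounded[OF supp(1)] by (auto simp: bounded_pos C_def)
  \<comment> \<open>The \<open>k\<close>-th side of the box is the thickness of the slab, and
    \<open>R\<close> bounds the remaining coordinates of the support.\<close>
  define a :: "real^'m" where "a = (\<chi> i. if i = k then 0 else - R)"
  define b :: "real^'m" where "b = (\<chi> i. if i = k then 1 else R)"
  have cb: "y \<in> cbox a b \<longleftrightarrow> 0 \<le> y $ k \<and> y $ k \<le> 1 \<and> (\<forall>i. i \<noteq> k \<longrightarrow> \<bar>y $ i\<bar> \<le> R)" for y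
    by (auto simp: mem_box_cart a_def b_def abs_le_iff) (metis minus_le_iff)+
  have front: "T y \<in> frontier B" if "T y \<in> U" for y
    using patch_frontier[OF gp B that] h(2) by (simp add: T_def)
  have inC: "\<bar>y $ i\<bar> \<le> R" if "\<eta> (T y) \<noteq> 0" "i \<noteq> k" for y i
    using component_le_norm_cart[of "T y" i] R(2)[OF \<eta>C[OF that(1)]] that(2) by (simp add: T_def)
  show thesis
  proof (rule that)
    show "box a b \<noteq> {}"
      using R(1) by (auto simp: interval_ne_empty_cart a_def b_def)
    show "set_coord k 0 x \<in> cbox a b" if "\<eta> x \<noteq> 0" for x
      using component_le_norm_cart[of x] R(2)[OF \<eta>C[OF that]] by (auto simp: cb intro: order_trans)
    show "set_coord k (h y) y \<in> frontier B" if "\<eta> (set_coord k (h y) y) \<noteq> 0" for y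
      using front[of y] \<eta>C supp(2) that by (auto simp: C_def T_def)
    fix f
    show "continuous_on (cbox a b) (\<lambda>y. \<eta> (set_coord k (h y) y) * f (set_coord k (h y) y) *
        sqrt (1 + (norm (grad_in UNIV h y))\<^sup>2))" if f: "continuous_on (frontier B) f"
    proof -
      \<comment> \<open>Two open sets cover the space: over \<open>U\<close> the graph point lies on
        the frontier, where \<open>f\<close> is continuous, and off the support the product is
        zero.\<close>
      have "continuous_on (T -` U \<union> T -` (- C)) (\<lambda>y. \<eta> (T y) * f (T y))"
      proof (rule continuous_on_open_Un)
        show "open (T -` U)" by (rule open_vimage[OF patchD(1)[OF gp] T])
        show "open (T -` (- C))" by (rule open_vimage[OF _ T]) (simp add: C_def open_Compl)
        show "continuous_on (T -` U) (\<lambda>y. \<eta> (T y) * f (T y))"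
          by (intro continuous_on_mult continuous_on_compose2[OF smooth_continuous[OF \<eta>, of UNIV] T]
              continuous_on_compose2[OF f T]) (use front in auto)
        show "continuous_on (T -` (- C)) (\<lambda>y. \<eta> (T y) * f (T y))"
          by (rule continuous_on_eq[OF continuous_on_const[of _ 0]]) (use \<eta>C in force)
      qed
      moreover have "T -` U \<union> T -` (- C) = UNIV" using supp(2) by (auto simp: C_def)
      ultimately have "continuous_on UNIV (\<lambda>y. \<eta> (T y) * f (T y))" by simp
      from continuous_on_mult[OF continuous_on_subset[OF this subset_UNIV] w]
      have "continuous_on (cbox a b) (\<lambda>y. \<eta> (T y) * f (T y) * w y)" .
      then show ?thesis by (simp add: T_def w_def)
    qed
    show "graph_integral k h (\<lambda>x. \<eta> x * f x) = integral (cbox a b)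
      (\<lambda>y. \<eta> (set_coord k (h y) y) * f (set_coord k (h y) y) * sqrt (1 + (norm (grad_in UNIV h y))\<^sup>2))"
      unfolding graph_integral_def T_def[symmetric] w_def[symmetric]
        integral_restrict_UNIV[of "cbox a b", symmetric]
        integral_restrict_UNIV[of "{y. 0 \<le> y $ k \<and> y $ k \<le> 1}", symmetric]
      by (rule integral_cong) (use inC in \<open>auto simp: cb\<close>)
  qed
qed

text \<open>The choice operator does not see the integrand, so one partition serves for all
  \<open>f\<close> at once.\<close>

lemma boundary_integral_partition:
  assumes "smooth_domain B"
  obtains N k h \<eta> where "boundary_partition B (N, k, h, \<eta>)"
    "\<And>f. boundary_integral B f = (\<Sum>i<N. graph_integral (k i) (h i) (\<lambda>x. \<eta> i x * f x))"
proof -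
  obtain N k h \<eta> where P: "(SOME P. boundary_partition B P) = (N, k, h, \<eta>)" by (metis surj_pair)
  have "boundary_partition B (N, k, h, \<eta>)"
    using someI_ex[OF boundary_partition_exists[OF assms]] by (simp add: P)
  then show thesis using that by (simp add: boundary_integral_def P)
qed

lemma boundary_partitionD:
  assumes "boundary_partition B (N, k, h, \<eta>)"
  shows "i < N \<Longrightarrow> smooth (\<eta> i)" "i < N \<Longrightarrow> 0 \<le> \<eta> i x"
    "i < N \<Longrightarrow> compact (closure {x. \<eta> i x \<noteq> 0})"
    "i < N \<Longrightarrow> \<exists>U s. graph_patch B U (k i) s (h i) \<and> closure {x. \<eta> i x \<noteq> 0} \<subseteq> U"
    "x \<in> frontier B \<Longrightarrow> (\<Sum>i<N. \<eta> i x) = 1"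
  using assms unfolding boundary_partition_def split by blast+

lemma definite_functional_boundary:
  assumes B: "smooth_domain B"
  shows "definite_functional (frontier B) (boundary_integral B)"
proof -
  obtain N k h \<eta> where P: "boundary_partition B (N, k, h, \<eta>)"
    and I: "\<And>f. boundary_integral B f = (\<Sum>i<N. graph_integral (k i) (h i) (\<lambda>x. \<eta> i x * f x))"
    by (rule boundary_integral_partition[OF B], rule that)
  note \<eta> = boundary_partitionD[OF P]
  define T where "T i y = set_coord (k i) (h i y) y" for i y
  define w where "w i y = sqrt (1 + (norm (grad_in UNIV (h i) y))\<^sup>2)" for i y
  have w: "w i y > 0" for i y by (simp add: w_def add_pos_nonneg)
  \<comment> \<open>Bundling the properties into one predicate allows boxes to be chosen for all
    indices simultaneously.\<close>
  define good where "good i a b \<longleftrightarrow> box a b \<noteq> {} \<and>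
      (\<forall>x. \<eta> i x \<noteq> 0 \<longrightarrow> set_coord (k i) 0 x \<in> cbox a b) \<and>
      (\<forall>y\<in>cbox a b. \<eta> i (T i y) \<noteq> 0 \<longrightarrow> T i y \<in> frontier B) \<and>
      (\<forall>f. continuous_on (frontier B) f \<longrightarrow> continuous_on (cbox a b) (\<lambda>y. \<eta> i (T i y) * f (T i y) * w i y)) \<and>
      (\<forall>f. graph_integral (k i) (h i) (\<lambda>x. \<eta> i x * f x) = integral (cbox a b) (\<lambda>y. \<eta> i (T i y) * f (T i y) * w i y))"
    for i a b
  have "\<exists>a b. good i a b" if i: "i < N" for i
  proof -
    obtain U s where gp: "graph_patch B U (k i) s (h i)" and U: "closure {x. \<eta> i x \<noteq> 0} \<subseteq> U"
      using \<eta>(4)[OF i] by blast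
    show ?thesis unfolding T_def w_def good_def
      by (rule graph_integral_eq_cbox[OF gp smooth_domainD(2)[OF B] \<eta>(1)[OF i] \<eta>(3)[OF i] U]) blast
  qed
  then obtain a b where good: "\<And>i. i < N \<Longrightarrow> good i (a i) (b i)" by metis
  note ne = good[unfolded good_def, THEN conjunct1]
    and inbox = good[unfolded good_def, THEN conjunct2, THEN conjunct1, rule_format]
    and front = good[unfolded good_def, THEN conjunct2, THEN conjunct2, THEN conjunct1, rule_format]
    and cont = good[unfolded good_def, THEN conjunct2, THEN conjunct2, THEN conjunct2, THEN conjunct1, rule_format]
    and gi = good[unfolded good_def, THEN conjunct2, THEN conjunct2, THEN conjunct2, THEN conjunct2, rule_format]
  define J where "J i f = integral (cbox (a i) (b i)) (\<lambda>y. \<eta> i (T i y) * f (T i y) * w i y)" for i f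
  have I: "boundary_integral B f = (\<Sum>i<N. J i f)" for f
    unfolding I J_def by (rule sum.cong) (use gi in auto)
  have int: "(\<lambda>y. \<eta> i (T i y) * f (T i y) * w i y) integrable_on cbox (a i) (b i)"
    if "i < N" "continuous_on (frontier B) f" for i f
    by (rule integrable_continuous[OF cont[OF that]])
  have pos: "0 \<le> \<eta> i (T i y) * f (T i y) * w i y"
    if "i < N" "\<And>x. x \<in> frontier B \<Longrightarrow> 0 \<le> f x" "y \<in> cbox (a i) (b i)" for i f y
    using front[OF that(1,3)] that(2)[of "T i y"] \<eta>(2)[OF that(1), of "T i y"] w[of i y]
    by (cases "\<eta> i (T i y) = 0") (auto intro!: mult_nonneg_nonneg)
  show ?thesis
  proof
    show "compact (frontier B)" by (rule compact_frontier[OF smooth_domainD(1)[OF B]])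
    fix f g :: "real^'a \<Rightarrow> real"
    show "boundary_integral B f = boundary_integral B g" if "\<And>x. x \<in> frontier B \<Longrightarrow> f x = g x"
      unfolding I J_def
    proof (intro sum.cong[OF refl] integral_cong)
      fix i y assume "i \<in> {..<N}" "y \<in> cbox (a i) (b i)"
      then show "\<eta> i (T i y) * f (T i y) * w i y = \<eta> i (T i y) * g (T i y) * w i y"
        using front[of i y] that by (cases "\<eta> i (T i y) = 0") auto
    qed
    assume f: "continuous_on (frontier B) f"
    show "boundary_integral B (\<lambda>x. f x + g x) = boundary_integral B f + boundary_integral B g"
      if g: "continuous_on (frontier B) g"
      unfolding I sum.distrib[symmetric]
    proof (rule sum.cong[OF refl])
      fix i assume "i \<in> {..<N}"
      then show "J i (\<lambda>x. f x + g x) = J i f + J i g"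
        unfolding J_def by (subst integral_add[OF int[OF _ f] int[OF _ g], symmetric]) (auto simp: algebra_simps)
    qed
    show "boundary_integral B (\<lambda>x. c * f x) = c * boundary_integral B f" for c
      unfolding I J_def sum_distrib_left integral_mult_right[symmetric]
      by (simp add: mult_ac)
    assume f0: "\<And>x. x \<in> frontier B \<Longrightarrow> 0 \<le> f x"
    have J0: "0 \<le> J i f" if "i < N" for i
      unfolding J_def by (rule integral_nonneg[OF int[OF that f]]) (rule pos[OF that f0])
    show "0 \<le> boundary_integral B f" unfolding I by (rule sum_nonneg) (use J0 in auto)
    fix x assume "boundary_integral B f = 0" and x: "x \<in> frontier B"
    then have Ji: "J i f = 0" if "i < N" for i
      using sum_nonneg_eq_0_iff[of "{..<N}" "\<lambda>i. J i f"] J0 that by (auto simp: I)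
    \<comment> \<open>The weights sum to 1 at \<open>x\<close>, so some patch sees \<open>x\<close>,
      and in that patch the vanishing term determines \<open>f x\<close>.\<close>
    obtain i where i: "i < N" "\<eta> i x \<noteq> 0"
      using \<eta>(5)[OF x] by (metis lessThan_iff sum.neutral zero_neq_one)
    obtain U s where gp: "graph_patch B U (k i) s (h i)" and U: "closure {x. \<eta> i x \<noteq> 0} \<subseteq> U"
      using \<eta>(4)[OF i(1)] by blast
    have "x \<in> U" using U in_support_closure[of "\<eta> i", OF i(2)] by blast
    then have "x $ k i = h i x" using patch_frontier[OF gp smooth_domainD(2)[OF B]] x by blast
    \<comment> \<open>The integrand is tested at the preimage of \<open>x\<close> whose
      \<open>k i\<close>-th coordinate is 0. It lies in the box by \<open>inbox\<close>, possibly on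
      a face, and vanishing on the closed box covers this case.\<close>
    then have Tx: "T i (set_coord (k i) 0 x) = x"
      using patchD(4)[OF gp] by (simp add: T_def) (metis set_coord_self)
    let ?y = "set_coord (k i) 0 x"
    have "\<eta> i (T i ?y) * f (T i ?y) * w i ?y = 0"
    proof (rule has_integral_0_cbox_imp_0[OF cont[OF i(1) f] _ _ ne[OF i(1)] inbox[OF i]])
      show "0 \<le> \<eta> i (T i y) * f (T i y) * w i y" if "y \<in> box (a i) (b i)" for y
        using pos[of i f y, OF i(1) f0 subsetD[OF box_subset_cbox that]] .
      show "((\<lambda>y. \<eta> i (T i y) * f (T i y) * w i y) has_integral 0) (cbox (a i) (b i))"
        using Ji[OF i(1)] int[OF i(1) f] by (simp add: has_integral_iff J_def)
    qed
    then show "f x = 0" using i(2) w[of i ?y] by (simp add: Tx)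
  qed
qed

text \<open>Each field \<open>\<eta> i x *\<^sub>R X x\<close> is supported in one patch and
  contributes a graph integral. The partition sums to 1 on the frontier only, and the part of
  \<open>X\<close> left over vanishes there and contributes nothing.\<close>

theorem divergence_theorem:
  fixes X :: "real^'m \<Rightarrow> real^'m"
  assumes B: "smooth_domain B" and X: "smooth X"
  shows "integral B (div_in UNIV X) = boundary_integral B (\<lambda>x. X x \<bullet> outward_normal B x)"
proof -
  obtain N k h \<eta> where P: "boundary_partition B (N, k, h, \<eta>)"
    and I: "\<And>f. boundary_integral B f = (\<Sum>i<N. graph_integral (k i) (h i) (\<lambda>x. \<eta> i x * f x))"
    by (rule boundary_integral_partition[OF B], rule that)
  note \<eta> = boundary_partitionD[OF P]
  define r where "r x = 1 - (\<Sum>i<N. \<eta> i x)" for x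
  have r: "smooth r" unfolding r_def by (intro smooth_intros \<eta>(1)) simp
  have int: "div_in UNIV Z integrable_on B" if "smooth Z" for Z :: "real^'m \<Rightarrow> real^'m"
    by (rule continuous_compact_integrable[OF smooth_domainD(1)[OF B] smooth_continuous[OF smooth_div[OF that]]])
  have sm: "smooth (\<lambda>x. \<eta> i x *\<^sub>R X x)" if "i < N" for i
    by (intro smooth_intros \<eta>(1)[OF that] X)
  have rX: "smooth (\<lambda>x. r x *\<^sub>R X x)" by (intro smooth_intros r X)
  have divsum: "div_in UNIV X x = div_in UNIV (\<lambda>x. r x *\<^sub>R X x) x + (\<Sum>i<N. div_in UNIV (\<lambda>x. \<eta> i x *\<^sub>R X x) x)" for x
  proof -
    have eq: "X = (\<lambda>x. r x *\<^sub>R X x + (\<Sum>i<N. \<eta> i x *\<^sub>R X x))"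
      by (simp add: r_def scaleR_left_diff_distrib scaleR_sum_left)
    have "(X has_derivative (\<lambda>v. frechet_derivative (\<lambda>x. r x *\<^sub>R X x) (at x) v +
        (\<Sum>i<N. frechet_derivative (\<lambda>x. \<eta> i x *\<^sub>R X x) (at x) v))) (at x)"
      by (subst eq, intro has_derivative_add has_derivative_sum smooth_has_derivative rX sm) simp
    from frechet_derivative_at[OF this, symmetric]
    show ?thesis
      by (simp add: div_in_def sum.distrib) (rule sum.swap)
  qed
  have zero: "integral B (div_in UNIV (\<lambda>x. r x *\<^sub>R X x)) = 0"
  proof -
    have Z: "smooth (\<lambda>x. r x * X x $ i)" for i by (intro smooth_intros r X)
    have "div_in UNIV (\<lambda>x. r x *\<^sub>R X x) x = (\<Sum>i\<in>UNIV. frechet_derivative (\<lambda>x. r x * X x $ i) (at x) (axis i 1))" for x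
    proof -
      have "((\<lambda>x. r x * X x $ i) has_derivative (\<lambda>v. frechet_derivative (\<lambda>x. r x *\<^sub>R X x) (at x) v $ i)) (at x)" for i
        using bounded_linear.has_derivative[OF bounded_linear_vec_nth smooth_has_derivative[OF rX]] by simp
      from frechet_derivative_at[OF this, symmetric] show ?thesis by (simp add: div_in_def)
    qed
    then have "integral B (div_in UNIV (\<lambda>x. r x *\<^sub>R X x)) =
        integral B (\<lambda>x. \<Sum>i\<in>UNIV. frechet_derivative (\<lambda>x. r x * X x $ i) (at x) (axis i 1))"
      by (intro integral_cong)
    also have "\<dots> = (\<Sum>i\<in>UNIV. integral B (\<lambda>x. frechet_derivative (\<lambda>x. r x * X x $ i) (at x) (axis i 1)))"
      \<comment> \<open>Splitting the divergence into partial derivatives makes each component of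
        the remainder a scalar function that vanishes on the frontier.\<close>
      by (rule integral_sum)
        (auto intro!: continuous_compact_integrable[OF smooth_domainD(1)[OF B]] smooth_continuous smooth_intros Z)
    also have "\<dots> = 0"
      by (rule sum.neutral, intro ballI integral_partial_zero_boundary[OF B Z]) (simp add: r_def \<eta>(5))
    finally show ?thesis .
  qed
  have "integral B (div_in UNIV X) = integral B (div_in UNIV (\<lambda>x. r x *\<^sub>R X x)) +
      (\<Sum>i<N. integral B (div_in UNIV (\<lambda>x. \<eta> i x *\<^sub>R X x)))"
    unfolding divsum[abs_def]
    by (subst integral_add) (auto intro!: int rX sm integrable_sum integral_sum)
  also have "\<dots> = (\<Sum>i<N. graph_integral (k i) (h i) (\<lambda>x. \<eta> i x * (X x \<bullet> outward_normal B x)))"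
    unfolding zero add_0_left
  proof (rule sum.cong[OF refl])
    fix i assume "i \<in> {..<N}"
    then have i: "i < N" by simp
    obtain U s where gp: "graph_patch B U (k i) s (h i)" and U: "closure {x. \<eta> i x \<noteq> 0} \<subseteq> U"
      using \<eta>(4)[OF i] by blast
    have sub: "closure {x. \<eta> i x *\<^sub>R X x \<noteq> 0} \<subseteq> closure {x. \<eta> i x \<noteq> 0}"
      by (rule closure_mono) auto
    have "compact (closure {x. \<eta> i x *\<^sub>R X x \<noteq> 0})"
      using \<eta>(3)[OF i] unfolding compact_closure by (rule bounded_subset) auto
    then have "integral B (div_in UNIV (\<lambda>x. \<eta> i x *\<^sub>R X x)) =
        graph_integral (k i) (h i) (\<lambda>x. (\<eta> i x *\<^sub>R X x) \<bullet> patch_normal (k i) s (h i) x)"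
      by (rule patch_divergence[OF gp smooth_domainD(1)[OF B] sm[OF i]]) (use sub U in blast)
    also have "\<dots> = graph_integral (k i) (h i) (\<lambda>x. \<eta> i x * (X x \<bullet> outward_normal B x))"
      unfolding graph_integral_def
    proof (rule integral_cong)
      fix y
      let ?x = "set_coord (k i) (h i y) y"
      have "outward_normal B ?x = patch_normal (k i) s (h i) ?x" if "\<eta> i ?x \<noteq> 0"
        by (rule patch_outward_normal[OF gp smooth_domainD(2)[OF B]])
          (use U in_support_closure[of "\<eta> i", OF that] patchD(4)[OF gp] in auto)
      then show "(\<eta> i ?x *\<^sub>R X ?x) \<bullet> patch_normal (k i) s (h i) ?x * sqrt (1 + (norm (grad_in UNIV (h i) y))\<^sup>2) =
          \<eta> i ?x * (X ?x \<bullet> outward_normal B ?x) * sqrt (1 + (norm (grad_in UNIV (h i) y))\<^sup>2)"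
        by (cases "\<eta> i ?x = 0") auto
    qed
    finally show "integral B (div_in UNIV (\<lambda>x. \<eta> i x *\<^sub>R X x)) =
        graph_integral (k i) (h i) (\<lambda>x. \<eta> i x * (X x \<bullet> outward_normal B x))" .
  qed
  finally show ?thesis by (simp add: I)
qed

text \<open>The definite description in \<open>outward_normal\<close> is controlled on the frontier
  only. Gluing the patch formulas gives a smooth field on the whole space, so that boundary
  residuals become smooth functions.\<close>

lemma outward_normal_smooth:
  fixes B :: "(real^'m) set"
  assumes B: "smooth_domain B"
  obtains n where "smooth n" "\<And>x. x \<in> frontier B \<Longrightarrow> n x = outward_normal B x"
proof -
  obtain N k h \<eta> where P: "boundary_partition B (N, k, h, \<eta>)"
    using boundary_integral_partition[OF B] by metis
  note \<eta> = boundary_partitionD[OF P]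
  obtain U s where gp: "\<And>i. i < N \<Longrightarrow> graph_patch B (U i) (k i) (s i) (h i)"
    and U: "\<And>i. i < N \<Longrightarrow> closure {x. \<eta> i x \<noteq> 0} \<subseteq> U i"
    using \<eta>(4) by metis
  show thesis
  proof (rule that)
    show "smooth (\<lambda>x. \<Sum>i<N. \<eta> i x *\<^sub>R patch_normal (k i) (s i) (h i) x)"
      by (intro smooth_intros \<eta>(1) smooth_patch_normal[OF gp]) auto
    fix x assume x: "x \<in> frontier B"
    have "\<eta> i x *\<^sub>R patch_normal (k i) (s i) (h i) x = \<eta> i x *\<^sub>R outward_normal B x" if i: "i < N" for i
    proof (cases "\<eta> i x = 0")
      case False
      then have "x \<in> U i" using U[OF i] in_support_closure[of "\<eta> i" x] by blast
      then show ?thesis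
        using patch_outward_normal[OF gp[OF i] smooth_domainD(2)[OF B]]
          patch_frontier[OF gp[OF i] smooth_domainD(2)[OF B]] x by simp
    qed simp
    then have "(\<Sum>i<N. \<eta> i x *\<^sub>R patch_normal (k i) (s i) (h i) x) = (\<Sum>i<N. \<eta> i x *\<^sub>R outward_normal B x)"
      by (intro sum.cong) auto
    then show "(\<Sum>i<N. \<eta> i x *\<^sub>R patch_normal (k i) (s i) (h i) x) = outward_normal B x"
      by (simp add: scaleR_sum_left[symmetric] \<eta>(5)[OF x])
  qed
qed


section \<open>First variation of the Lagrangian\<close>

lemma smooth_domain_frechet_derivative:
  assumes B: "smooth_domain B" and x: "x \<in> B" and F: "smooth F" and eq: "\<And>y. y \<in> B \<Longrightarrow> f y = F y"
  shows "frechet_derivative f (at x within B) = frechet_derivative F (at x)"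
proof -
  have D: "(f has_derivative frechet_derivative F (at x)) (at x within B)"
    by (rule has_derivative_transform[OF x eq smooth_has_derivative[OF F]])
  then have "(f has_derivative frechet_derivative f (at x within B)) (at x within B)"
    by (metis differentiableI frechet_derivative_works)
  from smooth_domain_derivative_unique[OF B x this D] show ?thesis .
qed

text \<open>Curves of smooth functions on \<open>B\<close> are represented by smooth functions of
  \<open>(t, x)\<close> on the whole space. Derivatives within \<open>B\<close> become derivatives of such extensions, because
  the interior of \<open>B\<close> meets an open cone of directions at every boundary point.\<close>

definition tdiff :: "(real \<times> (real^'m) \<Rightarrow> real) \<Rightarrow> real \<times> (real^'m) \<Rightarrow> real" where
  "tdiff g z = frechet_derivative g (at z) (1, 0)"

definition xgrad :: "(real \<times> (real^'m) \<Rightarrow> real) \<Rightarrow> real \<times> (real^'m) \<Rightarrow> real^'m" where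
  "xgrad g z = (\<chi> i. frechet_derivative g (at z) (0, axis i 1))"

definition xdiv :: "(real \<times> (real^'m) \<Rightarrow> real^'m) \<Rightarrow> real \<times> (real^'m) \<Rightarrow> real" where
  "xdiv X z = (\<Sum>i\<in>UNIV. frechet_derivative X (at z) (0, axis i 1) $ i)"

text \<open>The argument of the density. It is linear in the two functions jointly, so a variation
  of the fields is an affine perturbation of the jet and \<open>variation\<close> applies.\<close>

definition jet :: "(real \<times> (real^'m) \<Rightarrow> real) \<Rightarrow> (real \<times> (real^'m) \<Rightarrow> real) \<Rightarrow> real \<times> (real^'m) \<Rightarrow>
    real \<times> real \<times> (real^'m)" where
  "jet g n z = (g z, n z, xgrad g z)"

lemma smooth_tdiff [smooth_intros]: "smooth g \<Longrightarrow> smooth (tdiff g)"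
  unfolding tdiff_def by (intro smooth_intros)

lemma smooth_xgrad [smooth_intros]: "smooth g \<Longrightarrow> smooth (xgrad g)"
  unfolding xgrad_def by (intro smooth_intros)

lemma smooth_xdiv [smooth_intros]: "smooth X \<Longrightarrow> smooth (xdiv X)"
  unfolding xdiv_def by (intro smooth_intros)

lemma smooth_jet [smooth_intros]: "smooth g \<Longrightarrow> smooth n \<Longrightarrow> smooth (jet g n)"
  unfolding jet_def by (intro smooth_intros smooth_xgrad)

lemma smooth_slice: "smooth g \<Longrightarrow> smooth (\<lambda>x. g (t::real, x::real^'m))"
  by (rule smooth_compose[OF _ smooth_Pair[OF smooth_const smooth_ident]])

lemma slice_derivative:
  assumes "smooth g"
  shows "frechet_derivative (\<lambda>x. g (t, x)) (at x) v = frechet_derivative g (at (t, x)) (0, v)"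
proof -
  have "((\<lambda>x. (t, x)) has_derivative (\<lambda>v. (0, v))) (at x)"
    by (auto intro!: derivative_eq_intros)
  from has_derivative_compose[OF this smooth_has_derivative[OF assms]]
  show ?thesis by (metis frechet_derivative_at)
qed

lemma tdiff_has_vector_derivative:
  assumes "smooth g"
  shows "((\<lambda>s. g (s, x)) has_vector_derivative tdiff g (t, x)) (at t within T)"
proof -
  have "((\<lambda>s. (s, x)) has_derivative (\<lambda>r. (r, 0))) (at t within T)"
    by (auto intro!: derivative_eq_intros)
  from has_derivative_compose[OF this smooth_has_derivative[OF assms]]
  have "((\<lambda>s. g (s, x)) has_derivative (\<lambda>r. frechet_derivative g (at (t, x)) (r *\<^sub>R (1, 0)))) (at t within T)"
    by simp
  then show ?thesis
    unfolding has_vector_derivative_def tdiff_def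
    by (simp only: linear_cmul[OF bounded_linear.linear[OF smooth_linear_derivative[OF assms]]])
qed

lemma tder_eq:
  assumes "t0 < t1" "t \<in> {t0..t1}" "smooth g" "\<And>s. s \<in> {t0..t1} \<Longrightarrow> c s x = g (s, x)"
  shows "tder {t0..t1} c t x = tdiff g (t, x)"
  unfolding tder_def
proof (rule vector_derivative_within_closed_interval[OF assms(1,2)])
  show "((\<lambda>s. c s x) has_vector_derivative tdiff g (t, x)) (at t within {t0..t1})"
    by (rule has_vector_derivative_transform[OF assms(2) _ tdiff_has_vector_derivative[OF assms(3)]])
      (use assms(4) in auto)
qed

lemma tder_eq_0:
  fixes c :: "real \<Rightarrow> real^'m \<Rightarrow> real"
  assumes "t0 < t1" "t \<in> {t0..t1}" "\<And>s. s \<in> {t0..t1} \<Longrightarrow> c s x = 0"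
  shows "tder {t0..t1} c t x = 0"
proof -
  have "tdiff (\<lambda>z. 0) (t, x) = 0"
    by (simp add: tdiff_def frechet_derivative_const)
  then show ?thesis using tder_eq[of t0 t1 t "\<lambda>z. 0" c x] assms by (simp add: smooth_const)
qed

lemma derivative_add_mult:
  fixes g :: "'a::real_normed_vector \<Rightarrow> real"
  assumes "smooth g" "smooth d"
  shows "frechet_derivative (\<lambda>z. g z + \<epsilon> * d z) (at z) v =
    frechet_derivative g (at z) v + \<epsilon> * frechet_derivative d (at z) v"
proof -
  have "((\<lambda>z. g z + \<epsilon> * d z) has_derivative
      (\<lambda>v. frechet_derivative g (at z) v + \<epsilon> * frechet_derivative d (at z) v)) (at z)"
    by (intro has_derivative_add has_derivative_mult_right smooth_has_derivative assms)
  from fun_cong[OF frechet_derivative_at[OF this]] show ?thesis by simp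
qed

lemma jet_add:
  assumes "smooth g" "smooth d"
  shows "jet (\<lambda>z. g z + \<epsilon> * d z) (\<lambda>z. n z + \<epsilon> * e z) z = jet g n z + \<epsilon> *\<^sub>R jet d e z"
  by (simp add: jet_def xgrad_def derivative_add_mult[OF assms] vec_eq_iff)

lemma tdiff_add:
  assumes "smooth g" "smooth d"
  shows "tdiff (\<lambda>z. g z + \<epsilon> * d z) z = tdiff g z + \<epsilon> * tdiff d z"
  by (simp add: tdiff_def derivative_add_mult[OF assms])

lemma xdiv_scaleR:
  assumes "smooth w" "smooth X"
  shows "xdiv (\<lambda>z. w z *\<^sub>R X z) z = xdiv X z * w z + X z \<bullet> xgrad w z"
proof -
  have "((\<lambda>z. w z *\<^sub>R X z) has_derivative
      (\<lambda>v. w z *\<^sub>R frechet_derivative X (at z) v + frechet_derivative w (at z) v *\<^sub>R X z)) (at z)"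
    by (intro has_derivative_scaleR smooth_has_derivative assms)
  from fun_cong[OF frechet_derivative_at[OF this, symmetric]] show ?thesis
    by (simp add: xdiv_def xgrad_def inner_vec_def sum.distrib sum_distrib_left mult_ac)
qed

lemma div_slice:
  assumes "smooth X"
  shows "div_in UNIV (\<lambda>x. X (t, x)) x = xdiv X (t, x)"
  by (simp add: div_in_def xdiv_def slice_derivative[OF assms])

text \<open>\<open>D1\<close>, \<open>D2\<close> and \<open>D3\<close> are the counterparts of
  \<open>d1\<close>, \<open>d2\<close> and \<open>d3\<close> for extended fields. Taken from the
  total derivative of \<open>l\<close>, they are smooth in time and space.\<close>

definition D1 :: "(real \<times> real \<times> (real^'m) \<Rightarrow> real) \<Rightarrow> (real \<times> (real^'m) \<Rightarrow> real) \<Rightarrow>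
    (real \<times> (real^'m) \<Rightarrow> real) \<Rightarrow> real \<times> (real^'m) \<Rightarrow> real" where
  "D1 l g n z = frechet_derivative l (at (jet g n z)) (1, 0, 0)"
definition D2 :: "(real \<times> real \<times> (real^'m) \<Rightarrow> real) \<Rightarrow> (real \<times> (real^'m) \<Rightarrow> real) \<Rightarrow>
    (real \<times> (real^'m) \<Rightarrow> real) \<Rightarrow> real \<times> (real^'m) \<Rightarrow> real" where
  "D2 l g n z = frechet_derivative l (at (jet g n z)) (0, 1, 0)"
definition D3 :: "(real \<times> real \<times> (real^'m) \<Rightarrow> real) \<Rightarrow> (real \<times> (real^'m) \<Rightarrow> real) \<Rightarrow>
    (real \<times> (real^'m) \<Rightarrow> real) \<Rightarrow> real \<times> (real^'m) \<Rightarrow> real^'m" where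
  "D3 l g n z = (\<chi> i. frechet_derivative l (at (jet g n z)) (0, 0, axis i 1))"

lemma smooth_D [smooth_intros]:
  assumes "smooth l" "smooth g" "smooth n"
  shows "smooth (D1 l g n)" "smooth (D2 l g n)" "smooth (D3 l g n)"
proof -
  have "smooth (\<lambda>z. frechet_derivative l (at (jet g n z)) v)" for v
    by (intro smooth_intros assms)
  then show "smooth (D1 l g n)" "smooth (D2 l g n)" "smooth (D3 l g n)"
    unfolding D1_def D2_def D3_def by (rule smooth_vec | blast)+
qed

lemma derivative_jet:
  fixes l :: "real \<times> real \<times> (real^'m) \<Rightarrow> real"
  assumes "smooth l"
  shows "frechet_derivative l (at (jet g n z)) (jet d e z) =
    D1 l g n z * d z + D2 l g n z * e z + D3 l g n z \<bullet> xgrad d z"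
proof -
  define A where "A = frechet_derivative l (at (jet g n z))"
  have lin: "linear A"
    unfolding A_def by (rule bounded_linear.linear[OF smooth_linear_derivative[OF assms]])
  have 3: "A (0, 0, v) = (\<Sum>i\<in>UNIV. v $ i * A (0, 0, axis i 1))" for v
  proof -
    have "linear (\<lambda>v. A (0, 0, v))"
      using linear_compose[OF _ lin, of "\<lambda>v. (0, 0, v)"] by (simp add: o_def linear_iff)
    then show ?thesis by (rule linear_eq_sum_axis)
  qed
  have "jet d e z = d z *\<^sub>R (1, 0, 0) + e z *\<^sub>R (0, 1, 0) + (0, 0, xgrad d z)"
    by (simp add: jet_def)
  then have "A (jet d e z) = d z * A (1, 0, 0) + e z * A (0, 1, 0) + A (0, 0, xgrad d z)"
    by (simp add: linear_add[OF lin] linear_cmul[OF lin] del: scaleR_Pair)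
  then show ?thesis
    by (simp add: 3[of "xgrad d z"] D1_def D2_def D3_def A_def[symmetric] inner_vec_def mult.commute)
qed

lemma axis_derivative:
  fixes l :: "real \<times> real \<times> (real^'m) \<Rightarrow> real"
  assumes "smooth l"
  shows "deriv (\<lambda>a. l (a, b, w)) a = frechet_derivative l (at (a, b, w)) (1, 0, 0)"
    "deriv (\<lambda>b. l (a, b, w)) b = frechet_derivative l (at (a, b, w)) (0, 1, 0)"
    "frechet_derivative (\<lambda>w. l (a, b, w)) (at w) v = frechet_derivative l (at (a, b, w)) (0, 0, v)"
proof -
  note cmul = linear_cmul[OF bounded_linear.linear[OF smooth_linear_derivative[OF assms]]]
  have "((\<lambda>a. (a, b, w)) has_derivative (\<lambda>r. r *\<^sub>R (1, 0, 0))) (at a)"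
    by (auto intro!: derivative_eq_intros simp: zero_prod_def)
  from has_derivative_compose[OF this smooth_has_derivative[OF assms]]
  have "((\<lambda>a. l (a, b, w)) has_real_derivative frechet_derivative l (at (a, b, w)) (1, 0, 0)) (at a)"
    unfolding has_field_derivative_def cmul by (simp add: mult_commute_abs)
  then show "deriv (\<lambda>a. l (a, b, w)) a = frechet_derivative l (at (a, b, w)) (1, 0, 0)"
    by (rule DERIV_imp_deriv)
  have "((\<lambda>b. (a, b, w)) has_derivative (\<lambda>r. r *\<^sub>R (0, 1, 0))) (at b)"
    by (auto intro!: derivative_eq_intros simp: zero_prod_def)
  from has_derivative_compose[OF this smooth_has_derivative[OF assms]]
  have "((\<lambda>b. l (a, b, w)) has_real_derivative frechet_derivative l (at (a, b, w)) (0, 1, 0)) (at b)"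
    unfolding has_field_derivative_def cmul by (simp add: mult_commute_abs)
  then show "deriv (\<lambda>b. l (a, b, w)) b = frechet_derivative l (at (a, b, w)) (0, 1, 0)"
    by (rule DERIV_imp_deriv)
  have "((\<lambda>w. (a, b, w)) has_derivative (\<lambda>v. (0, 0, v))) (at w)"
    by (auto intro!: derivative_eq_intros)
  from fun_cong[OF frechet_derivative_at[OF has_derivative_compose[OF this smooth_has_derivative[OF assms]]], of v]
  show "frechet_derivative (\<lambda>w. l (a, b, w)) (at w) v = frechet_derivative l (at (a, b, w)) (0, 0, v)"
    by simp
qed

section \<open>The Lagrangian functional and integration by parts in space\<close>

locale lagrangian_density =
  fixes B :: "(real^'m) set" and l :: "real \<times> real \<times> (real^'m) \<Rightarrow> real"
  assumes B: "smooth_domain B" and l: "smooth l"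
begin

sublocale I: definite_functional B "integral B"
  by (rule definite_functional_interior[OF smooth_domainD(1)[OF B] smooth_domain_closure[OF B]])

sublocale Ib: definite_functional "frontier B" "boundary_integral B"
  by (rule definite_functional_boundary[OF B])

lemma frontier_in_B: "x \<in> frontier B \<Longrightarrow> x \<in> B"
  using smooth_domainD(2)[OF B] by (auto simp: frontier_def)

context
  fixes g n :: "real \<times> (real^'m) \<Rightarrow> real" and \<phi> \<nu> :: "real^'m \<Rightarrow> real" and t :: real
  assumes g: "smooth g" and n: "smooth n"
    and \<phi>: "\<And>x. x \<in> B \<Longrightarrow> \<phi> x = g (t, x)" and \<nu>: "\<And>x. x \<in> B \<Longrightarrow> \<nu> x = n (t, x)"
begin

lemma grad_in_eq: "x \<in> B \<Longrightarrow> grad_in B \<phi> x = xgrad g (t, x)"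
  using smooth_domain_frechet_derivative[OF B _ smooth_slice[OF g] \<phi>]
  by (simp add: grad_in_def xgrad_def slice_derivative[OF g])

lemma jet_eq: "x \<in> B \<Longrightarrow> (\<phi> x, \<nu> x, grad_in B \<phi> x) = jet g n (t, x)"
  by (simp add: jet_def \<phi> \<nu> grad_in_eq)

lemma Lag_eq: "Lag B l \<phi> \<nu> = integral B (\<lambda>x. l (jet g n (t, x)))"
  unfolding Lag_def by (rule I.cong) (simp add: jet_eq)

lemma d1_eq: "x \<in> B \<Longrightarrow> d1 B l \<phi> \<nu> x = D1 l g n (t, x)"
  by (simp add: d1_def D1_def axis_derivative[OF l] jet_eq[symmetric])

lemma d2_eq: "x \<in> B \<Longrightarrow> d2 B l \<phi> \<nu> x = D2 l g n (t, x)"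
  by (simp add: d2_def D2_def axis_derivative[OF l] jet_eq[symmetric])

lemma d3_eq: "x \<in> B \<Longrightarrow> d3 B l \<phi> \<nu> x = D3 l g n (t, x)"
  by (simp add: d3_def D3_def grad_in_def[of UNIV] axis_derivative[OF l] jet_eq[symmetric])

lemma div_d3_eq: "x \<in> B \<Longrightarrow> div_in B (d3 B l \<phi> \<nu>) x = xdiv (D3 l g n) (t, x)"
  using smooth_domain_frechet_derivative[OF B _ smooth_slice[OF smooth_D(3)[OF l g n]] d3_eq]
  by (simp add: div_in_def xdiv_def slice_derivative[OF smooth_D(3)[OF l g n]])

end

text \<open>The divergence theorem for the product of \<open>w\<close> and \<open>X\<close>,
  combined with the product rule.\<close>

lemma green:
  assumes X: "smooth X" and w: "smooth w"
  shows "integral B (\<lambda>x. X (t, x) \<bullet> xgrad w (t, x)) =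
    boundary_integral B (\<lambda>x. (X (t, x) \<bullet> outward_normal B x) * w (t, x)) -
    integral B (\<lambda>x. xdiv X (t, x) * w (t, x))"
proof -
  have wX: "smooth (\<lambda>z. w z *\<^sub>R X z)" by (intro smooth_intros w X)
  have "integral B (div_in UNIV (\<lambda>x. w (t, x) *\<^sub>R X (t, x))) =
      integral B (\<lambda>x. xdiv X (t, x) * w (t, x) + X (t, x) \<bullet> xgrad w (t, x))"
    using div_slice[OF wX] by (intro I.cong) (simp add: xdiv_scaleR[OF w X])
  also have "\<dots> = integral B (\<lambda>x. xdiv X (t, x) * w (t, x)) + integral B (\<lambda>x. X (t, x) \<bullet> xgrad w (t, x))"
    by (rule I.add) (intro smooth_continuous smooth_slice[where g = "\<lambda>z. _ z * _ z"]
        smooth_slice[where g = "\<lambda>z. _ z \<bullet> _ z"] smooth_intros X w)+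
  finally show ?thesis
    using divergence_theorem[OF B smooth_slice[OF wX]] by (simp add: mult.commute)
qed

text \<open>Green's formula takes the gradient off \<open>d\<close>. The divergence it produces
  enters the interior part, and its boundary term is the source of the boundary component of the
  functional derivative.\<close>

lemma first_variation:
  assumes g: "smooth g" and n: "smooth n" and d: "smooth d" and e: "smooth e"
  shows "integral B (\<lambda>x. frechet_derivative l (at (jet g n (t, x))) (jet d e (t, x))) =
    integral B (\<lambda>x. (D1 l g n (t, x) - xdiv (D3 l g n) (t, x)) * d (t, x)) +
    integral B (\<lambda>x. D2 l g n (t, x) * e (t, x)) +
    boundary_integral B (\<lambda>x. (D3 l g n (t, x) \<bullet> outward_normal B x) * d (t, x))"
proof -
  note D = smooth_D[OF l g n]
  have sm: "smooth (\<lambda>z. D1 l g n z * d z)" "smooth (\<lambda>z. D2 l g n z * e z)"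
    "smooth (\<lambda>z. D3 l g n z \<bullet> xgrad d z)" "smooth (\<lambda>z. xdiv (D3 l g n) z * d z)"
    by (intro smooth_intros D d e smooth_xgrad smooth_xdiv)+
  note c = smooth_continuous[OF smooth_slice[OF sm(1)]] smooth_continuous[OF smooth_slice[OF sm(2)]]
    smooth_continuous[OF smooth_slice[OF sm(3)]] smooth_continuous[OF smooth_slice[OF sm(4)]]
  have "integral B (\<lambda>x. frechet_derivative l (at (jet g n (t, x))) (jet d e (t, x))) =
      integral B (\<lambda>x. D1 l g n (t, x) * d (t, x)) + integral B (\<lambda>x. D2 l g n (t, x) * e (t, x)) +
      integral B (\<lambda>x. D3 l g n (t, x) \<bullet> xgrad d (t, x))"
    unfolding derivative_jet[OF l]
    by (subst I.add[OF continuous_on_add[OF c(1,2)] c(3)], subst I.add[OF c(1,2)]) (rule refl)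
  moreover have "integral B (\<lambda>x. (D1 l g n (t, x) - xdiv (D3 l g n) (t, x)) * d (t, x)) =
      integral B (\<lambda>x. D1 l g n (t, x) * d (t, x)) - integral B (\<lambda>x. xdiv (D3 l g n) (t, x) * d (t, x))"
    unfolding left_diff_distrib by (rule I.diff[OF c(1,4)])
  ultimately show ?thesis using green[OF D(3) d, of t] by simp
qed

end

section \<open>Representatives of fields and of curves of fields\<close>

lemma Cinf_rep:
  assumes "f \<in> Cinf S"
  obtains g where "smooth g" "\<And>x. x \<in> S \<Longrightarrow> f x = g x"
  using assms unfolding Cinf_def smooth_within_def by force

lemma restr_Cinf: "smooth g \<Longrightarrow> (\<And>x. x \<in> S \<Longrightarrow> f x = g x) \<Longrightarrow> restr S f \<in> Cinf S"
  unfolding Cinf_def smooth_within_def restr_def by auto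

lemma restr_apply [simp]: "x \<in> S \<Longrightarrow> restr S f x = f x"
  by (simp add: restr_def)

lemma Cinf_zero: "(\<lambda>x. 0) \<in> Cinf S"
  using restr_Cinf[OF smooth_const[of 0], of S "\<lambda>x. 0"] by (simp add: restr_def)

lemma Cinf_eqI: "f \<in> Cinf S \<Longrightarrow> g \<in> Cinf S \<Longrightarrow> (\<And>x. x \<in> S \<Longrightarrow> f x = g x) \<Longrightarrow> f = g"
  unfolding Cinf_def by (auto simp: fun_eq_iff) metis

lemma smooth_curveI:
  assumes "smooth g" "\<And>t x. t \<in> T \<Longrightarrow> x \<in> S \<Longrightarrow> c t x = g (t, x)"
    "\<And>t x. t \<in> T \<Longrightarrow> x \<notin> S \<Longrightarrow> c t x = 0"
  shows "smooth_curve T S c"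
  unfolding smooth_curve_def
proof (intro conjI ballI)
  show "c t \<in> Cinf S" if "t \<in> T" for t
    unfolding Cinf_def smooth_within_def using smooth_slice[OF assms(1), of t] assms(2,3) that by force
  show "smooth_within (T \<times> S) (\<lambda>(t, x). c t x)"
    unfolding smooth_within_def using assms(1,2) by auto
qed

lemma smooth_curve_rep:
  assumes "smooth_curve T S c"
  obtains g where "smooth g" "\<And>t x. t \<in> T \<Longrightarrow> x \<in> S \<Longrightarrow> c t x = g (t, x)"
  using assms unfolding smooth_curve_def smooth_within_def by force

lemma smooth_curve_0: "smooth_curve T S c \<Longrightarrow> t \<in> T \<Longrightarrow> x \<notin> S \<Longrightarrow> c t x = 0"
  unfolding smooth_curve_def Cinf_def by blast

lemma smooth_curve_Cinf: "smooth_curve T S c \<Longrightarrow> t \<in> T \<Longrightarrow> c t \<in> Cinf S"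
  unfolding smooth_curve_def by blast

lemma smooth_curve_restr: "smooth g \<Longrightarrow> smooth_curve T S (\<lambda>t. restr S (\<lambda>x. g (t, x)))"
  by (rule smooth_curveI) (auto simp: restr_def)

lemma smooth_curve_zero: "smooth_curve T S (\<lambda>t x. 0)"
  by (rule smooth_curveI[of "\<lambda>z. 0"]) (auto intro: smooth_const)

lemma smooth_curve_tder:
  assumes "t0 < t1" "smooth_curve {t0..t1} S c"
  shows "smooth_curve {t0..t1} S (tder {t0..t1} c)"
proof -
  obtain g where g: "smooth g" "\<And>t x. t \<in> {t0..t1} \<Longrightarrow> x \<in> S \<Longrightarrow> c t x = g (t, x)"
    using smooth_curve_rep[OF assms(2)] by blast
  show ?thesis
    by (rule smooth_curveI[OF smooth_tdiff[OF g(1)]])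
      (use tder_eq[OF assms(1) _ g(1)] tder_eq_0[OF assms(1)] g(2) smooth_curve_0[OF assms(2)] in blast)+
qed

text \<open>Smoothness of the force is tested on curves over the whole real line. The given curves
  are continued to all times by their smooth extensions and cut off outside \<open>B\<close>, which
  does not change them for times in \<open>T\<close>.\<close>

lemma smooth_force_curve:
  assumes F: "smooth_force B F Fb" and \<phi>: "smooth_curve T B \<phi>" and \<nu>: "smooth_curve T B \<nu>"
  shows "smooth_curve T B (\<lambda>t. F (\<phi> t) (\<nu> t))" "smooth_curve T (frontier B) (\<lambda>t. Fb (\<phi> t) (\<nu> t))"
proof -
  obtain g where g: "smooth g" "\<And>t x. t \<in> T \<Longrightarrow> x \<in> B \<Longrightarrow> \<phi> t x = g (t, x)"
    using smooth_curve_rep[OF \<phi>] by blast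
  obtain n where n: "smooth n" "\<And>t x. t \<in> T \<Longrightarrow> x \<in> B \<Longrightarrow> \<nu> t x = n (t, x)"
    using smooth_curve_rep[OF \<nu>] by blast
  define \<phi>' where "\<phi>' t = restr B (\<lambda>x. g (t, x))" for t
  define \<nu>' where "\<nu>' t = restr B (\<lambda>x. n (t, x))" for t
  have eq: "\<phi>' t = \<phi> t" "\<nu>' t = \<nu> t" if "t \<in> T" for t
    using that g(2) n(2) smooth_curve_0[OF \<phi>] smooth_curve_0[OF \<nu>]
    by (auto simp: \<phi>'_def \<nu>'_def restr_def fun_eq_iff)
  have "smooth_curve UNIV B \<phi>'" "smooth_curve UNIV B \<nu>'"
    unfolding \<phi>'_def \<nu>'_def by (rule smooth_curve_restr; fact)+
  then have F': "smooth_curve UNIV B (\<lambda>t. F (\<phi>' t) (\<nu>' t))"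
    and Fb': "smooth_curve UNIV (frontier B) (\<lambda>t. Fb (\<phi>' t) (\<nu>' t))"
    using F unfolding smooth_force_def by blast+
  obtain f where f: "smooth f" "\<And>t x. t \<in> UNIV \<Longrightarrow> x \<in> B \<Longrightarrow> F (\<phi>' t) (\<nu>' t) x = f (t, x)"
    using smooth_curve_rep[OF F'] by blast
  obtain fb where fb: "smooth fb" "\<And>t x. t \<in> UNIV \<Longrightarrow> x \<in> frontier B \<Longrightarrow> Fb (\<phi>' t) (\<nu>' t) x = fb (t, x)"
    using smooth_curve_rep[OF Fb'] by blast
  show "smooth_curve T B (\<lambda>t. F (\<phi> t) (\<nu> t))"
    by (rule smooth_curveI[OF f(1)]) (metis eq f(2) smooth_curve_0[OF F'] UNIV_I)+
  show "smooth_curve T (frontier B) (\<lambda>t. Fb (\<phi> t) (\<nu> t))"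
    by (rule smooth_curveI[OF fb(1)]) (metis eq fb(2) smooth_curve_0[OF Fb'] UNIV_I)+
qed

section \<open>Nondegeneracy of the pairing and the functional derivatives\<close>

context lagrangian_density
begin

lemma interior_dense: "B \<subseteq> closure (B - frontier B)"
proof -
  have "interior B \<subseteq> B - frontier B" using interior_subset by (auto simp: frontier_def)
  from closure_mono[OF this] show ?thesis using smooth_domain_closure[OF B] by blast
qed

text \<open>The fundamental lemma with constant weight 1, since no time is involved. It justifies
  the definite descriptions of the functional derivatives and extracts the momentum equations from
  the Dirac condition.\<close>

lemma pairing_inject:
  assumes a: "a \<in> Vstar B" "a' \<in> Vstar B"
    and eq: "\<And>\<delta>. \<delta> \<in> Cinf B \<Longrightarrow> pairing B a \<delta> = pairing B a' \<delta>"
  shows "a = a'"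
proof -
  have aC: "fst a \<in> Cinf B" "fst a' \<in> Cinf B" "snd a \<in> Cinf (frontier B)" "snd a' \<in> Cinf (frontier B)"
    using a by (auto simp: Vstar_def)
  obtain e where e: "smooth e" "\<And>x. x \<in> B \<Longrightarrow> fst a x = e x"
    by (rule Cinf_rep[OF aC(1)], rule that)
  obtain e' where e': "smooth e'" "\<And>x. x \<in> B \<Longrightarrow> fst a' x = e' x"
    by (rule Cinf_rep[OF aC(2)], rule that)
  obtain b where b: "smooth b" "\<And>x. x \<in> frontier B \<Longrightarrow> snd a x = b x"
    by (rule Cinf_rep[OF aC(3)], rule that)
  obtain b' where b': "smooth b'" "\<And>x. x \<in> frontier B \<Longrightarrow> snd a' x = b' x"
    by (rule Cinf_rep[OF aC(4)], rule that)
  have "(\<forall>z\<in>B. e z - e' z = 0) \<and> (\<forall>z\<in>frontier B. b z - b' z = 0)"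
  proof (rule fundamental_lemma[where w = "\<lambda>z. 1", OF I.definite_functional_axioms Ib.definite_functional_axioms])
    fix d :: "real^'m \<Rightarrow> real" assume d: "smooth d"
    have c: "continuous_on S (\<lambda>x. p x * d x)" if "smooth p" for S and p :: "real^'m \<Rightarrow> real"
      by (intro smooth_continuous smooth_intros d that)
    have "pairing B a (restr B d) = integral B (\<lambda>x. e x * d x) + boundary_integral B (\<lambda>x. b x * d x)"
      unfolding pairing_def
      by (intro arg_cong2[of _ _ _ _ "(+)"] I.cong Ib.cong) (simp_all add: e(2) b(2) frontier_in_B)
    moreover have "pairing B a' (restr B d) = integral B (\<lambda>x. e' x * d x) + boundary_integral B (\<lambda>x. b' x * d x)"
      unfolding pairing_def
      by (intro arg_cong2[of _ _ _ _ "(+)"] I.cong Ib.cong) (simp_all add: e'(2) b'(2) frontier_in_B)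
    moreover have "pairing B a (restr B d) = pairing B a' (restr B d)"
      by (rule eq[OF restr_Cinf[OF d]]) simp
    ultimately show "integral B (\<lambda>z. (e z - e' z) * (1 * d z)) + boundary_integral B (\<lambda>z. (b z - b' z) * (1 * d z)) = 0"
      unfolding left_diff_distrib mult_1
      by (simp add: I.diff[OF c[OF e(1)] c[OF e'(1)]] Ib.diff[OF c[OF b(1)] c[OF b'(1)]])
  next
    show "B \<subseteq> closure {z \<in> B - frontier B. (1::real) \<noteq> 0}"
      using interior_dense by (simp add: set_diff_eq)
    show "frontier B \<subseteq> closure {z \<in> frontier B. (1::real) \<noteq> 0}" using closure_subset by simp
  qed (auto intro: smooth_intros e e' b b' frontier_in_B)
  then have "fst a = fst a'" "snd a = snd a'"
    using a e(2) e'(2) b(2) b'(2) by (auto simp: Vstar_def intro!: Cinf_eqI)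
  then show ?thesis by (rule prod_eqI)
qed

context
  fixes g n :: "real \<times> (real^'m) \<Rightarrow> real" and \<phi> \<nu> :: "real^'m \<Rightarrow> real" and t :: real
  assumes g: "smooth g" and n: "smooth n"
    and \<phi>: "\<And>x. x \<in> B \<Longrightarrow> \<phi> x = g (t, x)" and \<nu>: "\<And>x. x \<in> B \<Longrightarrow> \<nu> x = n (t, x)"
begin

lemma Lag_variation:
  assumes d: "smooth d" "\<And>x. x \<in> B \<Longrightarrow> \<delta>\<phi> x = d (t, x)"
    and e: "smooth e" "\<And>x. x \<in> B \<Longrightarrow> \<delta>\<nu> x = e (t, x)"
  shows "((\<lambda>\<epsilon>. Lag B l (fadd \<phi> \<epsilon> \<delta>\<phi>) (fadd \<nu> \<epsilon> \<delta>\<nu>)) has_real_derivative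
    integral B (\<lambda>x. (D1 l g n (t, x) - xdiv (D3 l g n) (t, x)) * d (t, x)) +
    integral B (\<lambda>x. D2 l g n (t, x) * e (t, x)) +
    boundary_integral B (\<lambda>x. (D3 l g n (t, x) \<bullet> outward_normal B x) * d (t, x))) (at 0)"
proof -
  have "Lag B l (fadd \<phi> \<epsilon> \<delta>\<phi>) (fadd \<nu> \<epsilon> \<delta>\<nu>) =
      integral B (\<lambda>x. l (jet g n (t, x) + \<epsilon> *\<^sub>R jet d e (t, x)))" for \<epsilon>
    unfolding jet_add[OF g d(1), symmetric]
    by (rule Lag_eq) (auto intro!: smooth_intros g n d(1) e(1) simp: fadd_def \<phi> \<nu> d(2) e(2))
  then show ?thesis
    unfolding first_variation[OF g n d(1) e(1), symmetric]
    using I.variation[OF l smooth_continuous[OF smooth_slice[OF smooth_jet[OF g n]]]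
        smooth_continuous[OF smooth_slice[OF smooth_jet[OF d(1) e(1)]]]]
    by simp
qed

lemma fder_phi_eq:
  "fder_phi B l \<phi> \<nu> = (restr B (\<lambda>x. D1 l g n (t, x) - xdiv (D3 l g n) (t, x)),
    restr (frontier B) (\<lambda>x. D3 l g n (t, x) \<bullet> outward_normal B x))" (is "_ = ?a")
  unfolding fder_phi_def
proof (rule the_equality)
  obtain N where N: "smooth N" "\<And>x. x \<in> frontier B \<Longrightarrow> N x = outward_normal B x"
    using outward_normal_smooth[OF B] by blast
  note D = smooth_D[OF l g n]
  have a: "?a \<in> Vstar B"
    unfolding Vstar_def mem_Times_iff fst_conv snd_conv
  proof
    show "restr B (\<lambda>x. D1 l g n (t, x) - xdiv (D3 l g n) (t, x)) \<in> Cinf B"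
      by (rule restr_Cinf[OF smooth_diff[OF smooth_slice[OF D(1)] smooth_slice[OF smooth_xdiv[OF D(3)]]]]) simp
    show "restr (frontier B) (\<lambda>x. D3 l g n (t, x) \<bullet> outward_normal B x) \<in> Cinf (frontier B)"
      by (rule restr_Cinf[OF smooth_inner[OF smooth_slice[OF D(3)] N(1)]]) (simp add: N(2))
  qed
  have deriv: "((\<lambda>\<epsilon>. Lag B l (fadd \<phi> \<epsilon> \<delta>) \<nu>) has_real_derivative pairing B ?a \<delta>) (at 0)"
    if \<delta>: "\<delta> \<in> Cinf B" for \<delta>
  proof -
    obtain d where d: "smooth d" "\<And>x. x \<in> B \<Longrightarrow> \<delta> x = d x"
      by (rule Cinf_rep[OF \<delta>], rule that)
    \<comment> \<open>The test field is continued constantly in time, to fit the variation formula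
      for functions of time and space.\<close>
    have d': "smooth (\<lambda>z::real \<times> (real^'m). d (snd z))"
      by (intro smooth_compose[OF d(1)] smooth_intros)
    have "((\<lambda>\<epsilon>. Lag B l (fadd \<phi> \<epsilon> \<delta>) (fadd \<nu> \<epsilon> (\<lambda>x. 0))) has_real_derivative
        integral B (\<lambda>x. (D1 l g n (t, x) - xdiv (D3 l g n) (t, x)) * d x) +
        integral B (\<lambda>x. D2 l g n (t, x) * 0) +
        boundary_integral B (\<lambda>x. (D3 l g n (t, x) \<bullet> outward_normal B x) * d x)) (at 0)"
      using Lag_variation[OF d' _ smooth_const[of 0], of \<delta> "\<lambda>x. 0"] d(2) by simp
    moreover have "pairing B ?a \<delta> = integral B (\<lambda>x. (D1 l g n (t, x) - xdiv (D3 l g n) (t, x)) * d x) +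
        boundary_integral B (\<lambda>x. (D3 l g n (t, x) \<bullet> outward_normal B x) * d x)"
      unfolding pairing_def
      by (intro arg_cong2[of _ _ _ _ "(+)"] I.cong Ib.cong) (simp_all add: d(2) frontier_in_B)
    ultimately show ?thesis by (simp add: fadd_def)
  qed
  show "?a \<in> Vstar B \<and> (\<forall>\<delta>\<phi>\<in>Cinf B.
      ((\<lambda>\<epsilon>. Lag B l (fadd \<phi> \<epsilon> \<delta>\<phi>) \<nu>) has_real_derivative pairing B ?a \<delta>\<phi>) (at 0))"
    using a deriv by blast
  show "b = ?a" if "b \<in> Vstar B \<and> (\<forall>\<delta>\<phi>\<in>Cinf B.
      ((\<lambda>\<epsilon>. Lag B l (fadd \<phi> \<epsilon> \<delta>\<phi>) \<nu>) has_real_derivative pairing B b \<delta>\<phi>) (at 0))" for b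
    using that a deriv by (intro pairing_inject) (blast intro: DERIV_unique)+
qed

text \<open>The density contains no spatial derivative of \<open>\<nu>\<close>, so no integration by
  parts occurs and the boundary component is zero. In the Dirac formulation this is the origin of
  the equation \<open>\<alpha>b = 0\<close>.\<close>

lemma fder_nu_eq: "fder_nu B l \<phi> \<nu> = (restr B (\<lambda>x. D2 l g n (t, x)), \<lambda>x. 0)" (is "_ = ?a")
  unfolding fder_nu_def
proof (rule the_equality)
  note D = smooth_D[OF l g n]
  have a: "?a \<in> Vstar B"
    using restr_Cinf[OF smooth_slice[OF D(2)]] by (simp add: Vstar_def Cinf_zero)
  have deriv: "((\<lambda>\<epsilon>. Lag B l \<phi> (fadd \<nu> \<epsilon> \<delta>)) has_real_derivative pairing B ?a \<delta>) (at 0)"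
    if \<delta>: "\<delta> \<in> Cinf B" for \<delta>
  proof -
    obtain d where d: "smooth d" "\<And>x. x \<in> B \<Longrightarrow> \<delta> x = d x"
      by (rule Cinf_rep[OF \<delta>], rule that)
    have d': "smooth (\<lambda>z::real \<times> (real^'m). d (snd z))"
      by (intro smooth_compose[OF d(1)] smooth_intros)
    have "((\<lambda>\<epsilon>. Lag B l (fadd \<phi> \<epsilon> (\<lambda>x. 0)) (fadd \<nu> \<epsilon> \<delta>)) has_real_derivative
        integral B (\<lambda>x. (D1 l g n (t, x) - xdiv (D3 l g n) (t, x)) * 0) +
        integral B (\<lambda>x. D2 l g n (t, x) * d x) +
        boundary_integral B (\<lambda>x. (D3 l g n (t, x) \<bullet> outward_normal B x) * 0)) (at 0)"
      using Lag_variation[OF smooth_const[of 0] _ d', of "\<lambda>x. 0" \<delta>] d(2) by simp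
    moreover have "pairing B ?a \<delta> = integral B (\<lambda>x. D2 l g n (t, x) * d x) + boundary_integral B (\<lambda>x. 0)"
      unfolding pairing_def
      by (intro arg_cong2[of _ _ _ _ "(+)"] I.cong Ib.cong) (simp_all add: d(2))
    ultimately show ?thesis by (simp add: fadd_def Ib.zero)
  qed
  show "?a \<in> Vstar B \<and> (\<forall>\<delta>\<nu>\<in>Cinf B.
      ((\<lambda>\<epsilon>. Lag B l \<phi> (fadd \<nu> \<epsilon> \<delta>\<nu>)) has_real_derivative pairing B ?a \<delta>\<nu>) (at 0))"
    using a deriv by blast
  show "b = ?a" if "b \<in> Vstar B \<and> (\<forall>\<delta>\<nu>\<in>Cinf B.
      ((\<lambda>\<epsilon>. Lag B l \<phi> (fadd \<nu> \<epsilon> \<delta>\<nu>)) has_real_derivative pairing B b \<delta>\<nu>) (at 0))" for b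
    using that a deriv by (intro pairing_inject) (blast intro: DERIV_unique)+
qed

end

end

text \<open>Differentiation under \<open>I\<close> shows that the sum of the two integrands is a
  total time derivative. The fundamental theorem of calculus leaves only endpoint values, which
  vanish with \<open>d\<close>.\<close>

lemma (in definite_functional) time_parts:
  fixes A d :: "real \<times> 'a \<Rightarrow> real"
  assumes ab: "a < b" and A: "continuous_on ({a..b} \<times> K) A" and d: "continuous_on ({a..b} \<times> K) d"
    and A': "continuous_on ({a..b} \<times> K) A'" and d': "continuous_on ({a..b} \<times> K) d'"
    and DA: "\<And>t x. t \<in> {a..b} \<Longrightarrow> x \<in> K \<Longrightarrow> ((\<lambda>s. A (s, x)) has_real_derivative A' (t, x)) (at t within {a..b})"
    and Dd: "\<And>t x. t \<in> {a..b} \<Longrightarrow> x \<in> K \<Longrightarrow> ((\<lambda>s. d (s, x)) has_real_derivative d' (t, x)) (at t within {a..b})"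
    and ends: "\<And>x. x \<in> K \<Longrightarrow> d (a, x) = 0" "\<And>x. x \<in> K \<Longrightarrow> d (b, x) = 0"
  shows "integral {a..b} (\<lambda>t. I (\<lambda>x. A (t, x) * d' (t, x))) = - integral {a..b} (\<lambda>t. I (\<lambda>x. A' (t, x) * d (t, x)))"
proof -
  interpret J: definite_functional "{a..b} \<times> K" "\<lambda>f. integral {a..b} (\<lambda>t. I (\<lambda>x. f (t, x)))"
    by (rule definite_functional_time[OF definite_functional_axioms ab])
  have c: "continuous_on ({a..b} \<times> K) (\<lambda>z. A z * d z)" "continuous_on ({a..b} \<times> K) (\<lambda>z. A' z * d z)"
      "continuous_on ({a..b} \<times> K) (\<lambda>z. A z * d' z)"
    by (intro continuous_on_mult A d A' d')+
  have "((\<lambda>s. I (\<lambda>x. A (s, x) * d (s, x))) has_real_derivative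
      I (\<lambda>x. A' (t, x) * d (t, x) + A (t, x) * d' (t, x))) (at t within {a..b})" if t: "t \<in> {a..b}" for t
  proof (rule has_derivative_parameter[OF _ t])
    show "continuous_on K (\<lambda>x. A (s, x) * d (s, x))" if "s \<in> {a..b}" for s
      using slice[OF c(1) that] by simp
    show "continuous_on ({a..b} \<times> K) (\<lambda>(s, x). A' (s, x) * d (s, x) + A (s, x) * d' (s, x))"
      using continuous_on_add[OF c(2,3)] by (simp add: case_prod_unfold)
    show "((\<lambda>r. A (r, x) * d (r, x)) has_real_derivative A' (s, x) * d (s, x) + A (s, x) * d' (s, x))
        (at s within {a..b})" if "s \<in> {a..b}" "x \<in> K" for s x
      using DERIV_mult[OF DA[OF that] Dd[OF that]] by (simp add: algebra_simps)
  qed simp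
  then have "((\<lambda>t. I (\<lambda>x. A' (t, x) * d (t, x) + A (t, x) * d' (t, x))) has_integral
      I (\<lambda>x. A (b, x) * d (b, x)) - I (\<lambda>x. A (a, x) * d (a, x))) {a..b}"
    using ab by (intro fundamental_theorem_of_calculus) (auto simp: has_real_derivative_iff_has_vector_derivative)
  moreover have "I (\<lambda>x. A (s, x) * d (s, x)) = 0" if "s = a \<or> s = b" for s
    using cong[of "\<lambda>x. A (s, x) * d (s, x)" "\<lambda>x. 0"] ends that zero by auto
  ultimately have "integral {a..b} (\<lambda>t. I (\<lambda>x. A' (t, x) * d (t, x) + A (t, x) * d' (t, x))) = 0"
    by (simp add: has_integral_iff)
  then show ?thesis using J.add[OF c(2,3)] by simp
qed


section \<open>Variational principles and equations of motion\<close>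

locale forced_lagrangian_system = lagrangian_density B l
  for B :: "(real^'m) set" and l +
  fixes F Fb :: "(real^'m \<Rightarrow> real) \<Rightarrow> (real^'m \<Rightarrow> real) \<Rightarrow> real^'m \<Rightarrow> real" and t0 t1 :: real
  assumes force: "smooth_force B F Fb" and t: "t0 < t1"
begin

abbreviation (input) T where "T \<equiv> {t0..t1}"

definition JB :: "(real \<times> (real^'m) \<Rightarrow> real) \<Rightarrow> real" where
  "JB f = integral T (\<lambda>t. integral B (\<lambda>x. f (t, x)))"

definition JF :: "(real \<times> (real^'m) \<Rightarrow> real) \<Rightarrow> real" where
  "JF f = integral T (\<lambda>t. boundary_integral B (\<lambda>x. f (t, x)))"

sublocale JB: definite_functional "T \<times> B" JB
  unfolding JB_def by (rule definite_functional_time[OF I.definite_functional_axioms t])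

sublocale JF: definite_functional "T \<times> frontier B" JF
  unfolding JF_def by (rule definite_functional_time[OF Ib.definite_functional_axioms t])

lemma time_parts_JB:
  assumes "smooth A" "smooth d" "\<And>x. x \<in> B \<Longrightarrow> d (t0, x) = 0" "\<And>x. x \<in> B \<Longrightarrow> d (t1, x) = 0"
  shows "JB (\<lambda>z. A z * tdiff d z) = - JB (\<lambda>z. tdiff A z * d z)"
  unfolding JB_def
  by (rule I.time_parts[OF t])
    (use assms in \<open>auto intro!: smooth_continuous smooth_tdiff tdiff_has_vector_derivative
      simp: has_real_derivative_iff_has_vector_derivative\<close>)

lemma time_parts_JF:
  assumes "smooth A" "smooth d" "\<And>x. x \<in> B \<Longrightarrow> d (t0, x) = 0" "\<And>x. x \<in> B \<Longrightarrow> d (t1, x) = 0"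
  shows "JF (\<lambda>z. A z * tdiff d z) = - JF (\<lambda>z. tdiff A z * d z)"
  unfolding JF_def
  by (rule Ib.time_parts[OF t])
    (use assms in \<open>auto intro!: smooth_continuous smooth_tdiff tdiff_has_vector_derivative frontier_in_B
      simp: has_real_derivative_iff_has_vector_derivative\<close>)

lemma integrable_slices:
  assumes "smooth f"
  shows "(\<lambda>t. integral B (\<lambda>x. f (t, x))) integrable_on T"
    "(\<lambda>t. boundary_integral B (\<lambda>x. f (t, x))) integrable_on T"
  by (intro integrable_continuous_real I.continuous_parameter Ib.continuous_parameter smooth_continuous assms)+

lemma pairing_time:
  assumes "smooth a" "smooth b"
    and "\<And>t x. t \<in> T \<Longrightarrow> x \<in> B \<Longrightarrow> c t x * \<delta> t x = a (t, x)"
    and "\<And>t x. t \<in> T \<Longrightarrow> x \<in> frontier B \<Longrightarrow> cb t x * \<delta> t x = b (t, x)"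
  shows "integral T (\<lambda>t. pairing B (c t, cb t) (\<delta> t)) = JB a + JF b"
    "(\<lambda>t. pairing B (c t, cb t) (\<delta> t)) integrable_on T"
proof -
  have eq: "pairing B (c t, cb t) (\<delta> t) = integral B (\<lambda>x. a (t, x)) + boundary_integral B (\<lambda>x. b (t, x))"
    if "t \<in> T" for t
    unfolding pairing_def
    by (intro arg_cong2[of _ _ _ _ "(+)"] I.cong Ib.cong)
      (simp_all only: fst_conv snd_conv assms(3,4)[OF that])
  have int: "(\<lambda>t. integral B (\<lambda>x. a (t, x)) + boundary_integral B (\<lambda>x. b (t, x))) integrable_on T"
    by (intro integrable_add integrable_slices assms)
  show "(\<lambda>t. pairing B (c t, cb t) (\<delta> t)) integrable_on T"
    by (rule integrable_eq[OF int]) (simp add: eq)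
  have "integral T (\<lambda>t. pairing B (c t, cb t) (\<delta> t)) =
      integral T (\<lambda>t. integral B (\<lambda>x. a (t, x)) + boundary_integral B (\<lambda>x. b (t, x)))"
    by (rule integral_cong) (rule eq)
  then show "integral T (\<lambda>t. pairing B (c t, cb t) (\<delta> t)) = JB a + JF b"
    unfolding JB_def JF_def by (simp add: integral_add[OF integrable_slices(1) integrable_slices(2)] assms)
qed

text \<open>The open interval is dense in the closed one, so a weight that is zero only at the
  endpoints still has a dense set of nonzeros.\<close>

lemma time_closure: "{t0<..<t1} \<times> S \<subseteq> X \<Longrightarrow> T \<times> closure S \<subseteq> closure X"
  using closure_mono[of "{t0<..<t1} \<times> S" X] t by (simp add: closure_Times)

text \<open>The variational principles range over curves, while the integrals are computed with
  smooth extensions. Both a curve \<open>\<delta>\<close> and a representative \<open>d\<close> are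
  therefore quantified.\<close>

lemma weak_form_iff:
  assumes E: "smooth E" and Eb: "smooth Eb"
  shows "(\<forall>\<delta> d. smooth d \<longrightarrow> smooth_curve T B \<delta> \<longrightarrow> (\<forall>t\<in>T. \<forall>x\<in>B. \<delta> t x = d (t, x)) \<longrightarrow>
        \<delta> t0 = (\<lambda>x. 0) \<longrightarrow> \<delta> t1 = (\<lambda>x. 0) \<longrightarrow> JB (\<lambda>z. E z * d z) + JF (\<lambda>z. Eb z * d z) = 0) \<longleftrightarrow>
      (\<forall>t\<in>T. (\<forall>x\<in>B. E (t, x) = 0) \<and> (\<forall>x\<in>frontier B. Eb (t, x) = 0))" (is "?weak \<longleftrightarrow> ?strong")
proof
  assume weak: ?weak
  \<comment> \<open>Positive inside the time interval and zero at its ends: multiplication by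
    \<open>w\<close> makes any smooth function an admissible variation.\<close>
  define w :: "real \<times> (real^'m) \<Rightarrow> real" where "w z = (fst z - t0) * (t1 - fst z)" for z
  have w: "smooth w" unfolding w_def by (intro smooth_intros)
  have "(\<forall>z\<in>T \<times> B. E z = 0) \<and> (\<forall>z\<in>T \<times> frontier B. Eb z = 0)"
  proof (rule fundamental_lemma[OF JB.definite_functional_axioms JF.definite_functional_axioms _ E Eb w])
    show "T \<times> frontier B \<subseteq> T \<times> B" using frontier_in_B by blast
    show "0 \<le> w z" if "z \<in> T \<times> B" for z using that by (auto simp: w_def)
    have "T \<times> closure (B - frontier B) \<subseteq> closure {z \<in> T \<times> B - T \<times> frontier B. w z \<noteq> 0}"
      by (rule time_closure) (auto simp: w_def)
    then show "T \<times> B \<subseteq> closure {z \<in> T \<times> B - T \<times> frontier B. w z \<noteq> 0}"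
      using interior_dense by blast
    have "T \<times> closure (frontier B) \<subseteq> closure {z \<in> T \<times> frontier B. w z \<noteq> 0}"
      by (rule time_closure) (auto simp: w_def)
    then show "T \<times> frontier B \<subseteq> closure {z \<in> T \<times> frontier B. w z \<noteq> 0}"
      by simp
    fix d assume d: "smooth (d :: real \<times> (real^'m) \<Rightarrow> real)"
    have wd: "smooth (\<lambda>z. w z * d z)" by (intro smooth_intros w d)
    show "JB (\<lambda>z. E z * (w z * d z)) + JF (\<lambda>z. Eb z * (w z * d z)) = 0"
      by (rule weak[rule_format, OF wd smooth_curve_restr[OF wd]]) (auto simp: w_def restr_def)
  qed
  then show ?strong by blast
next
  assume strong: ?strong
  show ?weak
  proof (intro allI impI)
    fix d :: "real \<times> (real^'m) \<Rightarrow> real"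
    have "JB (\<lambda>z. E z * d z) = JB (\<lambda>z. 0)" by (rule JB.cong) (use strong in auto)
    moreover have "JF (\<lambda>z. Eb z * d z) = JF (\<lambda>z. 0)" by (rule JF.cong) (use strong in auto)
    ultimately show "JB (\<lambda>z. E z * d z) + JF (\<lambda>z. Eb z * d z) = 0" by (simp add: JB.zero JF.zero)
  qed
qed

lemma action_variation:
  assumes g: "smooth g" and n: "smooth n" and d: "smooth d" and e: "smooth e"
  shows "((\<lambda>\<epsilon>. JB (\<lambda>z. l (jet g n z + \<epsilon> *\<^sub>R jet d e z))) has_real_derivative
    JB (\<lambda>z. (D1 l g n z - xdiv (D3 l g n) z) * d z) + JB (\<lambda>z. D2 l g n z * e z) +
    JF (\<lambda>z. (D3 l g n z \<bullet> outward_normal B (snd z)) * d z)) (at 0)"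
proof -
  \<comment> \<open>The normal is replaced by a smooth extension so that the boundary integrand is
    smooth and its integral over the frontier is integrable in time.\<close>
  obtain N where N: "smooth N" "\<And>x. x \<in> frontier B \<Longrightarrow> N x = outward_normal B x"
    by (rule outward_normal_smooth[OF B], rule that)
  note D = smooth_D[OF l g n]
  have N': "smooth (\<lambda>z::real \<times> (real^'m). N (snd z))" by (intro smooth_compose[OF N(1)] smooth_intros)
  have sm: "smooth (\<lambda>z. (D1 l g n z - xdiv (D3 l g n) z) * d z)" "smooth (\<lambda>z. D2 l g n z * e z)"
    "smooth (\<lambda>z. (D3 l g n z \<bullet> N (snd z)) * d z)"
    by (intro smooth_intros D d e N' smooth_xdiv)+
  have "JB (\<lambda>z. frechet_derivative l (at (jet g n z)) (jet d e z)) =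
      integral T (\<lambda>t. integral B (\<lambda>x. (D1 l g n (t, x) - xdiv (D3 l g n) (t, x)) * d (t, x)) +
        integral B (\<lambda>x. D2 l g n (t, x) * e (t, x)) +
        boundary_integral B (\<lambda>x. (D3 l g n (t, x) \<bullet> N x) * d (t, x)))"
    unfolding JB_def
  proof (rule integral_cong)
    fix t
    have "boundary_integral B (\<lambda>x. (D3 l g n (t, x) \<bullet> outward_normal B x) * d (t, x)) =
        boundary_integral B (\<lambda>x. (D3 l g n (t, x) \<bullet> N x) * d (t, x))"
      by (rule Ib.cong) (simp add: N(2))
    then show "integral B (\<lambda>x. frechet_derivative l (at (jet g n (t, x))) (jet d e (t, x))) =
        integral B (\<lambda>x. (D1 l g n (t, x) - xdiv (D3 l g n) (t, x)) * d (t, x)) +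
        integral B (\<lambda>x. D2 l g n (t, x) * e (t, x)) +
        boundary_integral B (\<lambda>x. (D3 l g n (t, x) \<bullet> N x) * d (t, x))"
      unfolding first_variation[OF g n d e] by simp
  qed
  also have "\<dots> = JB (\<lambda>z. (D1 l g n z - xdiv (D3 l g n) z) * d z) + JB (\<lambda>z. D2 l g n z * e z) +
      JF (\<lambda>z. (D3 l g n z \<bullet> N (snd z)) * d z)"
    using integrable_slices(1)[OF sm(1)] integrable_slices(1)[OF sm(2)] integrable_slices(2)[OF sm(3)]
    unfolding JB_def JF_def by (simp add: integral_add integrable_add)
  also have "JF (\<lambda>z. (D3 l g n z \<bullet> N (snd z)) * d z) =
      JF (\<lambda>z. (D3 l g n z \<bullet> outward_normal B (snd z)) * d z)"
    by (rule JF.cong) (auto simp: N(2))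
  finally show ?thesis
    using JB.variation[OF l smooth_continuous[OF smooth_jet[OF g n]] smooth_continuous[OF smooth_jet[OF d e]]]
    by simp
qed

end

lemma Cinf_diff:
  assumes "f \<in> Cinf S" "g \<in> Cinf S"
  shows "(\<lambda>x. f x - g x) \<in> Cinf S"
proof -
  obtain f' where f': "smooth f'" "\<And>x. x \<in> S \<Longrightarrow> f x = f' x" by (rule Cinf_rep[OF assms(1)], rule that)
  obtain g' where g': "smooth g'" "\<And>x. x \<in> S \<Longrightarrow> g x = g' x" by (rule Cinf_rep[OF assms(2)], rule that)
  have "restr S (\<lambda>x. f x - g x) \<in> Cinf S"
    by (rule restr_Cinf[OF smooth_diff[OF f'(1) g'(1)]]) (simp add: f'(2) g'(2))
  moreover have "restr S (\<lambda>x. f x - g x) = (\<lambda>x. f x - g x)"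
    using assms by (auto simp: restr_def Cinf_def fun_eq_iff)
  ultimately show ?thesis by simp
qed

lemma Cinf_continuous: "f \<in> Cinf S \<Longrightarrow> continuous_on S f"
  by (metis Cinf_rep continuous_on_eq smooth_continuous)

section \<open>The equivalences\<close>

context forced_lagrangian_system
begin

lemma force_reps:
  assumes "smooth_curve T B \<phi>" "smooth_curve T B \<nu>"
  obtains f fb where "smooth f" "\<And>t x. t \<in> T \<Longrightarrow> x \<in> B \<Longrightarrow> F (\<phi> t) (\<nu> t) x = f (t, x)"
    "smooth fb" "\<And>t x. t \<in> T \<Longrightarrow> x \<in> frontier B \<Longrightarrow> Fb (\<phi> t) (\<nu> t) x = fb (t, x)"
proof -
  note c = smooth_force_curve[OF force assms]
  obtain f where "smooth f" "\<And>t x. t \<in> T \<Longrightarrow> x \<in> B \<Longrightarrow> F (\<phi> t) (\<nu> t) x = f (t, x)"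
    by (rule smooth_curve_rep[OF c(1)], rule that)
  moreover obtain fb where "smooth fb" "\<And>t x. t \<in> T \<Longrightarrow> x \<in> frontier B \<Longrightarrow> Fb (\<phi> t) (\<nu> t) x = fb (t, x)"
    by (rule smooth_curve_rep[OF c(2)], rule that)
  ultimately show thesis by (rule that)
qed

lemma normal_rep:
  obtains N :: "real \<times> (real^'m) \<Rightarrow> real^'m"
    where "smooth N" "\<And>z. snd z \<in> frontier B \<Longrightarrow> N z = outward_normal B (snd z)"
proof -
  obtain N where N: "smooth N" "\<And>x. x \<in> frontier B \<Longrightarrow> N x = outward_normal B x"
    by (rule outward_normal_smooth[OF B], rule that)
  show thesis
    by (rule that[of "\<lambda>z. N (snd z)"]) (auto intro!: smooth_compose[OF N(1)] smooth_intros simp: N(2))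
qed

text \<open>The principles assert that the action is differentiable along the variation. Once the
  derivative is computed, uniqueness leaves only the scalar equation.\<close>

lemma ex_derivative_iff:
  assumes "(h has_real_derivative r) (at x)"
  shows "(\<exists>r. (h has_real_derivative r) (at x) \<and> r + c = 0) \<longleftrightarrow> r + c = 0"
  using assms DERIV_unique by blast

text \<open>Both sides reduce to the vanishing of the same residuals: the principle through
  \<open>weak_form_iff\<close>, the equations by evaluation on extensions.\<close>

lemma LdA_iff:
  assumes \<phi>: "smooth_curve T B \<phi>"
  shows "LdA_principle B l F Fb t0 t1 \<phi> \<longleftrightarrow> LdA_equations B l F Fb t0 t1 \<phi>"
proof -
  obtain g where g: "smooth g" "\<And>t x. t \<in> T \<Longrightarrow> x \<in> B \<Longrightarrow> \<phi> t x = g (t, x)"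
    by (rule smooth_curve_rep[OF \<phi>], rule that)
  define \<phi>' where "\<phi>' = tder T \<phi>"
  define n where "n = tdiff g"
  have n: "smooth n" unfolding n_def by (rule smooth_tdiff[OF g(1)])
  have \<phi>': "\<phi>' t x = n (t, x)" if "t \<in> T" "x \<in> B" for t x
    unfolding \<phi>'_def n_def by (rule tder_eq[OF t that(1) g(1)]) (rule g(2)[OF _ that(2)])
  obtain f fb where f: "smooth f" "\<And>t x. t \<in> T \<Longrightarrow> x \<in> B \<Longrightarrow> F (\<phi> t) (\<phi>' t) x = f (t, x)"
    and fb: "smooth fb" "\<And>t x. t \<in> T \<Longrightarrow> x \<in> frontier B \<Longrightarrow> Fb (\<phi> t) (\<phi>' t) x = fb (t, x)"
    by (rule force_reps[OF \<phi> smooth_curve_tder[OF t \<phi>, folded \<phi>'_def]], rule that)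
  obtain N :: "real \<times> (real^'m) \<Rightarrow> real^'m"
    where N: "smooth N" "\<And>z. snd z \<in> frontier B \<Longrightarrow> N z = outward_normal B (snd z)"
    by (rule normal_rep, rule that)
  note D = smooth_D[OF l g(1) n]
  \<comment> \<open>\<open>P\<close> and \<open>Q\<close> represent the interior and boundary
    components of the functional derivative in \<open>\<phi>\<close>; \<open>E\<close> and
    \<open>Eb\<close> are the residuals of the two equations of motion.\<close>
  define P where "P z = D1 l g n z - xdiv (D3 l g n) z" for z
  define Q where "Q z = D3 l g n z \<bullet> N z" for z
  define E where "E z = P z - tdiff (D2 l g n) z + f z" for z
  define Eb where "Eb z = Q z + fb z" for z
  have P: "smooth P" unfolding P_def by (intro smooth_intros D smooth_xdiv)
  have Q: "smooth Q" unfolding Q_def by (intro smooth_intros D N)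
  have D2': "smooth (tdiff (D2 l g n))" by (intro smooth_tdiff D)
  have E: "smooth E" unfolding E_def by (intro smooth_intros P D2' f)
  have Eb: "smooth Eb" unfolding Eb_def by (intro smooth_intros Q fb)
  have body: "(\<exists>r. ((\<lambda>\<epsilon>. integral T (\<lambda>t. Lag B l (cadd \<phi> \<epsilon> \<delta> t) (tder T (cadd \<phi> \<epsilon> \<delta>) t)))
        has_real_derivative r) (at 0) \<and>
      r + integral T (\<lambda>t. pairing B (F (\<phi> t) (\<phi>' t), Fb (\<phi> t) (\<phi>' t)) (\<delta> t)) = 0) \<longleftrightarrow>
      JB (\<lambda>z. E z * d z) + JF (\<lambda>z. Eb z * d z) = 0"
    if d: "smooth d" "\<forall>t\<in>T. \<forall>x\<in>B. \<delta> t x = d (t, x)" and ends: "\<delta> t0 = (\<lambda>x. 0)" "\<delta> t1 = (\<lambda>x. 0)" for \<delta> d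
  proof -
    have cont: "continuous_on S (\<lambda>z. p z * d z)" if "smooth p" for S and p :: "real \<times> (real^'m) \<Rightarrow> real"
      by (intro smooth_continuous smooth_intros d that)
    have d0: "d (t0, x) = 0" "d (t1, x) = 0" if "x \<in> B" for x
      using d(2) ends that t by (metis atLeastAtMost_iff less_imp_le order_refl)+
    \<comment> \<open>The velocity of the varied curve is varied by \<open>tdiff d\<close>. This
      couples the second slot of the jet to the first and calls for integration by parts in
      time.\<close>
    have lag: "Lag B l (cadd \<phi> \<epsilon> \<delta> t) (tder T (cadd \<phi> \<epsilon> \<delta>) t) =
        integral B (\<lambda>x. l (jet g n (t, x) + \<epsilon> *\<^sub>R jet d (tdiff d) (t, x)))" if tT: "t \<in> T" for \<epsilon> t
      unfolding jet_add[OF g(1) d(1), symmetric]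
    proof (rule Lag_eq)
      show gd: "smooth (\<lambda>z. g z + \<epsilon> * d z)" by (intro smooth_intros g d)
      show "smooth (\<lambda>z. n z + \<epsilon> * tdiff d z)" by (intro smooth_intros n smooth_tdiff d)
      show c: "cadd \<phi> \<epsilon> \<delta> t x = g (t, x) + \<epsilon> * d (t, x)" if "x \<in> B" for x
        using g(2) d(2) tT that by (simp add: cadd_def fadd_def)
      show "tder T (cadd \<phi> \<epsilon> \<delta>) t x = n (t, x) + \<epsilon> * tdiff d (t, x)" if "x \<in> B" for x
        unfolding n_def tdiff_add[OF g(1) d(1), symmetric]
        by (rule tder_eq[OF t tT gd]) (use g(2) d(2) that in \<open>simp add: cadd_def fadd_def\<close>)
    qed
    have "(\<lambda>\<epsilon>. integral T (\<lambda>t. Lag B l (cadd \<phi> \<epsilon> \<delta> t) (tder T (cadd \<phi> \<epsilon> \<delta>) t))) =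
        (\<lambda>\<epsilon>. JB (\<lambda>z. l (jet g n z + \<epsilon> *\<^sub>R jet d (tdiff d) z)))"
      unfolding JB_def by (intro ext integral_cong lag)
    moreover have "JF (\<lambda>z. (D3 l g n z \<bullet> outward_normal B (snd z)) * d z) = JF (\<lambda>z. Q z * d z)"
      by (rule JF.cong) (auto simp: Q_def N(2))
    ultimately have deriv: "((\<lambda>\<epsilon>. integral T (\<lambda>t. Lag B l (cadd \<phi> \<epsilon> \<delta> t) (tder T (cadd \<phi> \<epsilon> \<delta>) t)))
        has_real_derivative JB (\<lambda>z. P z * d z) - JB (\<lambda>z. tdiff (D2 l g n) z * d z) + JF (\<lambda>z. Q z * d z)) (at 0)"
      using action_variation[OF g(1) n d(1) smooth_tdiff[OF d(1)]] time_parts_JB[OF D(2) d(1) d0]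
      by (simp add: P_def)
    have fc: "integral T (\<lambda>t. pairing B (F (\<phi> t) (\<phi>' t), Fb (\<phi> t) (\<phi>' t)) (\<delta> t)) =
        JB (\<lambda>z. f z * d z) + JF (\<lambda>z. fb z * d z)"
      by (rule pairing_time(1)) (use f fb d frontier_in_B in \<open>auto intro: smooth_intros\<close>)
    have "JB (\<lambda>z. E z * d z) = JB (\<lambda>z. P z * d z) - JB (\<lambda>z. tdiff (D2 l g n) z * d z) + JB (\<lambda>z. f z * d z)"
      unfolding E_def distrib_right left_diff_distrib
      by (subst JB.add[OF continuous_on_diff[OF cont[OF P] cont[OF D2']] cont[OF f(1)]],
          subst JB.diff[OF cont[OF P] cont[OF D2']]) (rule refl)
    moreover have "JF (\<lambda>z. Eb z * d z) = JF (\<lambda>z. Q z * d z) + JF (\<lambda>z. fb z * d z)"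
      unfolding Eb_def distrib_right by (rule JF.add[OF cont[OF Q] cont[OF fb(1)]])
    ultimately have "JB (\<lambda>z. E z * d z) + JF (\<lambda>z. Eb z * d z) =
        JB (\<lambda>z. P z * d z) - JB (\<lambda>z. tdiff (D2 l g n) z * d z) + JF (\<lambda>z. Q z * d z) +
        (JB (\<lambda>z. f z * d z) + JF (\<lambda>z. fb z * d z))" by simp
    then show ?thesis unfolding fc ex_derivative_iff[OF deriv] by simp
  qed
  have "LdA_principle B l F Fb t0 t1 \<phi> \<longleftrightarrow>
      (\<forall>t\<in>T. (\<forall>x\<in>B. E (t, x) = 0) \<and> (\<forall>x\<in>frontier B. Eb (t, x) = 0))"
    unfolding weak_form_iff[OF E Eb, symmetric] LdA_principle_def \<phi>'_def[symmetric]
  proof (intro iffI allI impI, goal_cases)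
    case (1 \<delta> d)
    then show ?case using body[of d \<delta>] by blast
  next
    case (2 \<delta>)
    obtain d where d: "smooth d" "\<And>t x. t \<in> T \<Longrightarrow> x \<in> B \<Longrightarrow> \<delta> t x = d (t, x)"
      using smooth_curve_rep[of T B \<delta>] 2(2) by blast
    then show ?case using body[of d \<delta>] 2 by blast
  qed
  also have "\<dots> \<longleftrightarrow> LdA_equations B l F Fb t0 t1 \<phi>"
    unfolding LdA_equations_def Let_def \<phi>'_def[symmetric]
  proof (intro ball_cong conj_cong refl)
    fix t x assume tT: "t \<in> T"
    have eqs: "d1 B l (\<phi> t) (\<phi>' t) x = D1 l g n (t, x)"
      "div_in B (d3 B l (\<phi> t) (\<phi>' t)) x = xdiv (D3 l g n) (t, x)"
      "d3 B l (\<phi> t) (\<phi>' t) x = D3 l g n (t, x)" if x: "x \<in> B"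
      by (rule d1_eq[OF g(1) n _ _ x] div_d3_eq[OF g(1) n _ _ x] d3_eq[OF g(1) n _ _ x];
          use g(2) \<phi>' tT in blast)+
    show "E (t, x) = 0 \<longleftrightarrow> tder T (\<lambda>s. d2 B l (\<phi> s) (\<phi>' s)) t x =
        d1 B l (\<phi> t) (\<phi>' t) x - div_in B (d3 B l (\<phi> t) (\<phi>' t)) x + F (\<phi> t) (\<phi>' t) x" if x: "x \<in> B"
    proof -
      have "tder T (\<lambda>s. d2 B l (\<phi> s) (\<phi>' s)) t x = tdiff (D2 l g n) (t, x)"
        by (rule tder_eq[OF t tT D(2)], rule d2_eq[OF g(1) n _ _ x]) (use g(2) \<phi>' in blast)+
      then show ?thesis using eqs(1,2)[OF x] f(2)[OF tT x] by (auto simp: E_def P_def)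
    qed
    show "Eb (t, x) = 0 \<longleftrightarrow> Fb (\<phi> t) (\<phi>' t) x = - (d3 B l (\<phi> t) (\<phi>' t) x \<bullet> outward_normal B x)"
      if x: "x \<in> frontier B"
      using eqs(3)[OF frontier_in_B[OF x]] fb(2)[OF tT x] N(2)[of "(t, x)"] x by (auto simp: Eb_def Q_def)
  qed
  finally show ?thesis .
qed

text \<open>Multiplication of two reals is taken as the density in \<open>variation\<close>.\<close>

lemma product_variation:
  fixes p q a b :: "real \<times> (real^'m) \<Rightarrow> real"
  assumes K: "definite_functional K J"
    and c: "continuous_on K p" "continuous_on K q" "continuous_on K a" "continuous_on K b"
  shows "((\<lambda>\<epsilon>. J (\<lambda>z. (p z + \<epsilon> * a z) * (q z + \<epsilon> * b z))) has_real_derivative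
    J (\<lambda>z. p z * b z + a z * q z)) (at 0)"
proof -
  interpret K: definite_functional K J by (rule K)
  have m: "smooth (\<lambda>y::real \<times> real. fst y * snd y)" by (intro smooth_intros)
  have "((\<lambda>y::real \<times> real. fst y * snd y) has_derivative (\<lambda>v. fst y * snd v + fst v * snd y)) (at y)" for y
    by (auto intro!: derivative_eq_intros)
  from frechet_derivative_at[OF this, symmetric]
  have D: "frechet_derivative (\<lambda>y::real \<times> real. fst y * snd y) (at y) v = fst y * snd v + fst v * snd y" for y v
    by simp
  show ?thesis
    using K.variation[OF m continuous_on_Pair[OF c(1,2)] continuous_on_Pair[OF c(3,4)]] by (simp add: D)
qed

text \<open>With \<open>\<nu>\<close>, \<open>\<alpha>\<close> and \<open>\<alpha>b\<close> varied
  independently of \<open>\<phi>\<close>, the derivative of the action splits into pairings of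
  residuals with the separate variations, and each of them can be isolated.\<close>

lemma LdAP_iff:
  assumes \<phi>: "smooth_curve T B \<phi>" and \<nu>: "smooth_curve T B \<nu>" and \<alpha>: "smooth_curve T B \<alpha>"
    and \<alpha>b: "smooth_curve T (frontier B) \<alpha>b"
  shows "LdAP_principle B l F Fb t0 t1 \<phi> \<nu> \<alpha> \<alpha>b \<longleftrightarrow> LdAP_equations B l F Fb t0 t1 \<phi> \<nu> \<alpha> \<alpha>b"
proof -
  obtain g where g: "smooth g" "\<And>t x. t \<in> T \<Longrightarrow> x \<in> B \<Longrightarrow> \<phi> t x = g (t, x)"
    by (rule smooth_curve_rep[OF \<phi>], rule that)
  obtain n where n: "smooth n" "\<And>t x. t \<in> T \<Longrightarrow> x \<in> B \<Longrightarrow> \<nu> t x = n (t, x)"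
    by (rule smooth_curve_rep[OF \<nu>], rule that)
  obtain a where a: "smooth a" "\<And>t x. t \<in> T \<Longrightarrow> x \<in> B \<Longrightarrow> \<alpha> t x = a (t, x)"
    by (rule smooth_curve_rep[OF \<alpha>], rule that)
  obtain ab where ab: "smooth ab" "\<And>t x. t \<in> T \<Longrightarrow> x \<in> frontier B \<Longrightarrow> \<alpha>b t x = ab (t, x)"
    by (rule smooth_curve_rep[OF \<alpha>b], rule that)
  obtain f fb where f: "smooth f" "\<And>t x. t \<in> T \<Longrightarrow> x \<in> B \<Longrightarrow> F (\<phi> t) (\<nu> t) x = f (t, x)"
    and fb: "smooth fb" "\<And>t x. t \<in> T \<Longrightarrow> x \<in> frontier B \<Longrightarrow> Fb (\<phi> t) (\<nu> t) x = fb (t, x)"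
    by (rule force_reps[OF \<phi> \<nu>], rule that)
  obtain N :: "real \<times> (real^'m) \<Rightarrow> real^'m"
    where N: "smooth N" "\<And>z. snd z \<in> frontier B \<Longrightarrow> N z = outward_normal B (snd z)"
    by (rule normal_rep, rule that)
  note D = smooth_D[OF l g(1) n(1)]
  define P where "P z = D1 l g n z - xdiv (D3 l g n) z" for z
  define Q where "Q z = D3 l g n z \<bullet> N z" for z
  \<comment> \<open>\<open>E\<close> and \<open>Eb\<close> belong to the variation of
    \<open>\<phi>\<close>, \<open>M\<close> to that of \<open>\<nu>\<close>, and \<open>R\<close> to
    those of the momenta. On the boundary the variation of \<open>\<nu>\<close> meets only
    \<open>- ab\<close>, since the Lagrangian contributes no such term.\<close>
  define E where "E z = P z - tdiff a z + f z" for z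
  define Eb where "Eb z = Q z - tdiff ab z + fb z" for z
  define M where "M z = D2 l g n z - a z" for z
  define R where "R z = tdiff g z - n z" for z
  have P: "smooth P" unfolding P_def by (intro smooth_intros D smooth_xdiv)
  have Q: "smooth Q" unfolding Q_def by (intro smooth_intros D N)
  have a': "smooth (tdiff a)" and ab': "smooth (tdiff ab)" by (intro smooth_tdiff a ab)+
  have E: "smooth E" unfolding E_def by (intro smooth_intros P a' f)
  have Eb: "smooth Eb" unfolding Eb_def by (intro smooth_intros Q ab' fb)
  have M: "smooth M" unfolding M_def by (intro smooth_intros D a)
  have R: "smooth R" unfolding R_def by (intro smooth_intros smooth_tdiff g n)
  have mab: "smooth (\<lambda>z. - ab z)" by (intro smooth_intros ab)
  have body: "(\<exists>r. ((\<lambda>\<epsilon>. pontryagin_action B l t0 t1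
        (cadd \<phi> \<epsilon> \<delta>\<phi>) (cadd \<nu> \<epsilon> \<delta>\<nu>) (cadd \<alpha> \<epsilon> \<delta>\<alpha>) (cadd \<alpha>b \<epsilon> \<delta>\<alpha>b)) has_real_derivative r) (at 0) \<and>
      r + integral T (\<lambda>t. pairing B (F (\<phi> t) (\<nu> t), Fb (\<phi> t) (\<nu> t)) (\<delta>\<phi> t)) = 0) \<longleftrightarrow>
      (JB (\<lambda>z. E z * d z) + JF (\<lambda>z. Eb z * d z)) + (JB (\<lambda>z. M z * e z) + JF (\<lambda>z. - ab z * e z)) +
      (JB (\<lambda>z. R z * p z) + JF (\<lambda>z. R z * pb z)) = 0"
    if d: "smooth d" "\<forall>t\<in>T. \<forall>x\<in>B. \<delta>\<phi> t x = d (t, x)"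
      and ends: "\<delta>\<phi> t0 = (\<lambda>x. 0)" "\<delta>\<phi> t1 = (\<lambda>x. 0)"
      and e: "smooth e" "\<forall>t\<in>T. \<forall>x\<in>B. \<delta>\<nu> t x = e (t, x)"
      and p: "smooth p" "\<forall>t\<in>T. \<forall>x\<in>B. \<delta>\<alpha> t x = p (t, x)"
      and pb: "smooth pb" "\<forall>t\<in>T. \<forall>x\<in>frontier B. \<delta>\<alpha>b t x = pb (t, x)"
    for \<delta>\<phi> \<delta>\<nu> \<delta>\<alpha> \<delta>\<alpha>b d e p pb
  proof -
    have cont: "continuous_on S (\<lambda>z. u z * v z)" if "smooth u" "smooth v"
      for S and u v :: "real \<times> (real^'m) \<Rightarrow> real"
      by (intro smooth_continuous smooth_intros that)
    have d': "smooth (tdiff d)" by (rule smooth_tdiff[OF d(1)])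
    have g': "smooth (tdiff g)" by (rule smooth_tdiff[OF g(1)])
    have d0: "d (t0, x) = 0" "d (t1, x) = 0" if "x \<in> B" for x
      using d(2) ends that t by (metis atLeastAtMost_iff less_imp_le order_refl)+
    have tderc: "tder T (cadd \<phi> \<epsilon> \<delta>\<phi>) t x = tdiff g (t, x) + \<epsilon> * tdiff d (t, x)"
      if "t \<in> T" "x \<in> B" for \<epsilon> t x
      unfolding tdiff_add[OF g(1) d(1), symmetric]
      by (rule tder_eq[OF t that(1)]) (use g d that in \<open>auto intro!: smooth_intros simp: cadd_def fadd_def\<close>)
    have lag: "Lag B l (cadd \<phi> \<epsilon> \<delta>\<phi> t) (cadd \<nu> \<epsilon> \<delta>\<nu> t) =
        integral B (\<lambda>x. l (jet g n (t, x) + \<epsilon> *\<^sub>R jet d e (t, x)))" if tT: "t \<in> T" for \<epsilon> t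
      unfolding jet_add[OF g(1) d(1), symmetric]
      by (rule Lag_eq)
        (use g n d e tT in \<open>auto intro!: smooth_intros simp: cadd_def fadd_def\<close>)
    have act: "pontryagin_action B l t0 t1
        (cadd \<phi> \<epsilon> \<delta>\<phi>) (cadd \<nu> \<epsilon> \<delta>\<nu>) (cadd \<alpha> \<epsilon> \<delta>\<alpha>) (cadd \<alpha>b \<epsilon> \<delta>\<alpha>b) =
        JB (\<lambda>z. l (jet g n z + \<epsilon> *\<^sub>R jet d e z)) +
        (JB (\<lambda>z. (a z + \<epsilon> * p z) * (R z + \<epsilon> * (tdiff d z - e z))) +
         JF (\<lambda>z. (ab z + \<epsilon> * pb z) * (R z + \<epsilon> * (tdiff d z - e z))))" for \<epsilon>
    proof -
      have s1: "smooth (\<lambda>z. (a z + \<epsilon> * p z) * (R z + \<epsilon> * (tdiff d z - e z)))"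
        "smooth (\<lambda>z. (ab z + \<epsilon> * pb z) * (R z + \<epsilon> * (tdiff d z - e z)))"
        by (intro smooth_intros a p R d' e ab pb)+
      have s2: "smooth (\<lambda>z. l (jet g n z + \<epsilon> *\<^sub>R jet d e z))"
        by (intro smooth_compose[OF l] smooth_intros g n d e)
      have 1: "(cadd \<alpha> \<epsilon> \<delta>\<alpha> t) x * (tder T (cadd \<phi> \<epsilon> \<delta>\<phi>) t x - cadd \<nu> \<epsilon> \<delta>\<nu> t x) =
          (a (t, x) + \<epsilon> * p (t, x)) * (R (t, x) + \<epsilon> * (tdiff d (t, x) - e (t, x)))" if "t \<in> T" "x \<in> B" for t x
        using that a(2) p(2) n(2) e(2) by (simp add: tderc) (simp add: cadd_def fadd_def R_def algebra_simps)
      have 2: "(cadd \<alpha>b \<epsilon> \<delta>\<alpha>b t) x * (tder T (cadd \<phi> \<epsilon> \<delta>\<phi>) t x - cadd \<nu> \<epsilon> \<delta>\<nu> t x) =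
          (ab (t, x) + \<epsilon> * pb (t, x)) * (R (t, x) + \<epsilon> * (tdiff d (t, x) - e (t, x)))"
        if "t \<in> T" "x \<in> frontier B" for t x
        using that ab(2) pb(2) n(2) e(2) frontier_in_B[OF that(2)]
        by (simp add: tderc) (simp add: cadd_def fadd_def R_def algebra_simps)
      have pt1: "integral T (\<lambda>t. pairing B (cadd \<alpha> \<epsilon> \<delta>\<alpha> t, cadd \<alpha>b \<epsilon> \<delta>\<alpha>b t)
            (\<lambda>x. tder T (cadd \<phi> \<epsilon> \<delta>\<phi>) t x - cadd \<nu> \<epsilon> \<delta>\<nu> t x)) =
          JB (\<lambda>z. (a z + \<epsilon> * p z) * (R z + \<epsilon> * (tdiff d z - e z))) +
          JF (\<lambda>z. (ab z + \<epsilon> * pb z) * (R z + \<epsilon> * (tdiff d z - e z)))"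
        by (rule pairing_time(1)[OF s1 1 2])
      have pt2: "(\<lambda>t. pairing B (cadd \<alpha> \<epsilon> \<delta>\<alpha> t, cadd \<alpha>b \<epsilon> \<delta>\<alpha>b t)
            (\<lambda>x. tder T (cadd \<phi> \<epsilon> \<delta>\<phi>) t x - cadd \<nu> \<epsilon> \<delta>\<nu> t x)) integrable_on T"
        by (rule pairing_time(2)[OF s1 1 2])
      have int: "(\<lambda>t. Lag B l (cadd \<phi> \<epsilon> \<delta>\<phi> t) (cadd \<nu> \<epsilon> \<delta>\<nu> t)) integrable_on T"
        by (rule integrable_eq[OF integrable_slices(1)[OF s2]]) (simp add: lag)
      have "integral T (\<lambda>t. Lag B l (cadd \<phi> \<epsilon> \<delta>\<phi> t) (cadd \<nu> \<epsilon> \<delta>\<nu> t)) =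
          JB (\<lambda>z. l (jet g n z + \<epsilon> *\<^sub>R jet d e z))"
        unfolding JB_def by (rule integral_cong) (rule lag)
      then show ?thesis
        unfolding pontryagin_action_def integral_add[OF int pt2] pt1 by simp
    qed
    have JFQ: "JF (\<lambda>z. (D3 l g n z \<bullet> outward_normal B (snd z)) * d z) = JF (\<lambda>z. Q z * d z)"
      by (rule JF.cong) (auto simp: Q_def N(2))
    \<comment> \<open>The derivative of the action before integration by parts in time removes
      \<open>tdiff d\<close> from the pairing terms.\<close>
    define W where "W = JB (\<lambda>z. P z * d z) + JB (\<lambda>z. D2 l g n z * e z) + JF (\<lambda>z. Q z * d z) +
        (JB (\<lambda>z. a z * (tdiff d z - e z) + p z * R z) + JF (\<lambda>z. ab z * (tdiff d z - e z) + pb z * R z))"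
    have deriv: "((\<lambda>\<epsilon>. pontryagin_action B l t0 t1
        (cadd \<phi> \<epsilon> \<delta>\<phi>) (cadd \<nu> \<epsilon> \<delta>\<nu>) (cadd \<alpha> \<epsilon> \<delta>\<alpha>) (cadd \<alpha>b \<epsilon> \<delta>\<alpha>b)) has_real_derivative W) (at 0)"
      unfolding act W_def P_def JFQ[symmetric]
      by (intro DERIV_add action_variation product_variation[OF JB.definite_functional_axioms]
          product_variation[OF JF.definite_functional_axioms] smooth_continuous smooth_diff g n d e a p R d' ab pb)
    have fc: "integral T (\<lambda>t. pairing B (F (\<phi> t) (\<nu> t), Fb (\<phi> t) (\<nu> t)) (\<delta>\<phi> t)) =
        JB (\<lambda>z. f z * d z) + JF (\<lambda>z. fb z * d z)"
      by (rule pairing_time(1)) (use f fb d frontier_in_B in \<open>auto intro: smooth_intros\<close>)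
    have "JB (\<lambda>z. E z * d z) = JB (\<lambda>z. P z * d z) - JB (\<lambda>z. tdiff a z * d z) + JB (\<lambda>z. f z * d z)"
      unfolding E_def distrib_right left_diff_distrib
      by (subst JB.add[OF continuous_on_diff[OF cont[OF P d(1)] cont[OF a' d(1)]] cont[OF f(1) d(1)]],
          subst JB.diff[OF cont[OF P d(1)] cont[OF a' d(1)]]) (rule refl)
    moreover have "JF (\<lambda>z. Eb z * d z) = JF (\<lambda>z. Q z * d z) - JF (\<lambda>z. tdiff ab z * d z) + JF (\<lambda>z. fb z * d z)"
      unfolding Eb_def distrib_right left_diff_distrib
      by (subst JF.add[OF continuous_on_diff[OF cont[OF Q d(1)] cont[OF ab' d(1)]] cont[OF fb(1) d(1)]],
          subst JF.diff[OF cont[OF Q d(1)] cont[OF ab' d(1)]]) (rule refl)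
    moreover have "JB (\<lambda>z. M z * e z) = JB (\<lambda>z. D2 l g n z * e z) - JB (\<lambda>z. a z * e z)"
      unfolding M_def left_diff_distrib by (rule JB.diff[OF cont[OF D(2) e(1)] cont[OF a(1) e(1)]])
    moreover have "JF (\<lambda>z. - ab z * e z) = - JF (\<lambda>z. ab z * e z)"
      using JF.minus[OF cont[OF ab(1) e(1)]] by simp
    moreover have "JB (\<lambda>z. a z * (tdiff d z - e z) + p z * R z) =
        JB (\<lambda>z. a z * tdiff d z) - JB (\<lambda>z. a z * e z) + JB (\<lambda>z. R z * p z)"
      unfolding right_diff_distrib mult.commute[of "p _"]
      by (subst JB.add[OF continuous_on_diff[OF cont[OF a(1) d'] cont[OF a(1) e(1)]] cont[OF R p(1)]],
          subst JB.diff[OF cont[OF a(1) d'] cont[OF a(1) e(1)]]) (rule refl)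
    moreover have "JF (\<lambda>z. ab z * (tdiff d z - e z) + pb z * R z) =
        JF (\<lambda>z. ab z * tdiff d z) - JF (\<lambda>z. ab z * e z) + JF (\<lambda>z. R z * pb z)"
      unfolding right_diff_distrib mult.commute[of "pb _"]
      by (subst JF.add[OF continuous_on_diff[OF cont[OF ab(1) d'] cont[OF ab(1) e(1)]] cont[OF R pb(1)]],
          subst JF.diff[OF cont[OF ab(1) d'] cont[OF ab(1) e(1)]]) (rule refl)
    ultimately have "W + (JB (\<lambda>z. f z * d z) + JF (\<lambda>z. fb z * d z)) =
        (JB (\<lambda>z. E z * d z) + JF (\<lambda>z. Eb z * d z)) + (JB (\<lambda>z. M z * e z) + JF (\<lambda>z. - ab z * e z)) +
        (JB (\<lambda>z. R z * p z) + JF (\<lambda>z. R z * pb z))"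
      unfolding W_def
      using time_parts_JB[OF a(1) d(1) d0] time_parts_JF[OF ab(1) d(1) d0] by simp
    then show ?thesis unfolding fc ex_derivative_iff[OF deriv] by simp
  qed
  \<comment> \<open>The residuals are grouped in pairs to fit \<open>weak_form_iff\<close>. For
    \<open>R\<close> the variation of \<open>\<alpha>b\<close> is set to zero, so the boundary
    residual is the zero function; vanishing of \<open>R\<close> on \<open>B\<close> includes the
    frontier.\<close>
  define strong where "strong \<longleftrightarrow> (\<forall>t\<in>T. (\<forall>x\<in>B. E (t, x) = 0) \<and> (\<forall>x\<in>frontier B. Eb (t, x) = 0)) \<and>
      (\<forall>t\<in>T. (\<forall>x\<in>B. M (t, x) = 0) \<and> (\<forall>x\<in>frontier B. - ab (t, x) = 0)) \<and>
      (\<forall>t\<in>T. (\<forall>x\<in>B. R (t, x) = 0) \<and> (\<forall>x\<in>frontier B. 0 = (0::real)))"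
  have z: "smooth (\<lambda>z::real \<times> (real^'m). 0::real)" by (rule smooth_const)
  note zc = smooth_curve_zero[of T B] smooth_curve_zero[of T "frontier B"]
  have "LdAP_principle B l F Fb t0 t1 \<phi> \<nu> \<alpha> \<alpha>b \<longleftrightarrow> strong"
  proof
    assume princ: "LdAP_principle B l F Fb t0 t1 \<phi> \<nu> \<alpha> \<alpha>b"
    show strong
      unfolding strong_def weak_form_iff[OF E Eb, symmetric] weak_form_iff[OF M mab, symmetric]
        weak_form_iff[OF R z, symmetric]
    proof (intro conjI allI impI)
      fix \<delta> d assume d: "smooth d" "smooth_curve T B \<delta>" "\<forall>t\<in>T. \<forall>x\<in>B. \<delta> t x = d (t, x)"
        and ends: "\<delta> t0 = (\<lambda>x. 0)" "\<delta> t1 = (\<lambda>x. 0)"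
      note ex = princ[unfolded LdAP_principle_def, rule_format]
      \<comment> \<open>One variation at a time is switched on, the others being zero.\<close>
      have "(JB (\<lambda>z. E z * d z) + JF (\<lambda>z. Eb z * d z)) + (JB (\<lambda>z. M z * 0) + JF (\<lambda>z. - ab z * 0)) +
          (JB (\<lambda>z. R z * 0) + JF (\<lambda>z. R z * 0)) = 0"
        by (rule iffD1[OF body[OF d(1,3) ends z _ z _ z]
              ex[of \<delta> "\<lambda>t x. 0" "\<lambda>t x. 0" "\<lambda>t x. 0"]]) (use d(2) ends zc in auto)
      then show "JB (\<lambda>z. E z * d z) + JF (\<lambda>z. Eb z * d z) = 0" by (simp add: JB.zero JF.zero)
      have "(JB (\<lambda>z. E z * 0) + JF (\<lambda>z. Eb z * 0)) + (JB (\<lambda>z. M z * d z) + JF (\<lambda>z. - ab z * d z)) +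
          (JB (\<lambda>z. R z * 0) + JF (\<lambda>z. R z * 0)) = 0"
        by (rule iffD1[OF body[OF z _ refl refl d(1,3) z _ z]
              ex[of "\<lambda>t x. 0" \<delta> "\<lambda>t x. 0" "\<lambda>t x. 0"]]) (use d(2) zc in auto)
      then show "JB (\<lambda>z. M z * d z) + JF (\<lambda>z. - ab z * d z) = 0" by (simp add: JB.zero JF.zero)
      have "(JB (\<lambda>z. E z * 0) + JF (\<lambda>z. Eb z * 0)) + (JB (\<lambda>z. M z * 0) + JF (\<lambda>z. - ab z * 0)) +
          (JB (\<lambda>z. R z * d z) + JF (\<lambda>z. R z * 0)) = 0"
        by (rule iffD1[OF body[OF z _ refl refl z _ d(1,3) z]
              ex[of "\<lambda>t x. 0" "\<lambda>t x. 0" \<delta> "\<lambda>t x. 0"]]) (use d(2) zc in auto)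
      then show "JB (\<lambda>z. R z * d z) + JF (\<lambda>z. 0 * d z) = 0" by (simp add: JB.zero JF.zero)
    qed
  next
    assume strong: strong
    have JB0: "JB (\<lambda>z. u z * v z) = 0" if "\<And>t x. t \<in> T \<Longrightarrow> x \<in> B \<Longrightarrow> u (t, x) = 0" for u v
      using JB.cong[of "\<lambda>z. u z * v z" "\<lambda>z. 0"] that JB.zero by auto
    have JF0: "JF (\<lambda>z. u z * v z) = 0" if "\<And>t x. t \<in> T \<Longrightarrow> x \<in> frontier B \<Longrightarrow> u (t, x) = 0" for u v
      using JF.cong[of "\<lambda>z. u z * v z" "\<lambda>z. 0"] that JF.zero by auto
    show "LdAP_principle B l F Fb t0 t1 \<phi> \<nu> \<alpha> \<alpha>b"
      unfolding LdAP_principle_def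
    proof (intro allI impI, elim conjE)
      fix \<delta>\<phi> \<delta>\<nu> \<delta>\<alpha> \<delta>\<alpha>b
      assume c: "smooth_curve T B \<delta>\<phi>" "smooth_curve T B \<delta>\<nu>" "smooth_curve T B \<delta>\<alpha>" "smooth_curve T (frontier B) \<delta>\<alpha>b"
        and ends: "\<delta>\<phi> t0 = (\<lambda>x. 0)" "\<delta>\<phi> t1 = (\<lambda>x. 0)"
      obtain d where d: "smooth d" "\<And>t x. t \<in> T \<Longrightarrow> x \<in> B \<Longrightarrow> \<delta>\<phi> t x = d (t, x)"
        by (rule smooth_curve_rep[OF c(1)], rule that)
      obtain e where e: "smooth e" "\<And>t x. t \<in> T \<Longrightarrow> x \<in> B \<Longrightarrow> \<delta>\<nu> t x = e (t, x)"
        by (rule smooth_curve_rep[OF c(2)], rule that)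
      obtain p where p: "smooth p" "\<And>t x. t \<in> T \<Longrightarrow> x \<in> B \<Longrightarrow> \<delta>\<alpha> t x = p (t, x)"
        by (rule smooth_curve_rep[OF c(3)], rule that)
      obtain pb where pb: "smooth pb" "\<And>t x. t \<in> T \<Longrightarrow> x \<in> frontier B \<Longrightarrow> \<delta>\<alpha>b t x = pb (t, x)"
        by (rule smooth_curve_rep[OF c(4)], rule that)
      show "\<exists>r. ((\<lambda>\<epsilon>. pontryagin_action B l t0 t1
          (cadd \<phi> \<epsilon> \<delta>\<phi>) (cadd \<nu> \<epsilon> \<delta>\<nu>) (cadd \<alpha> \<epsilon> \<delta>\<alpha>) (cadd \<alpha>b \<epsilon> \<delta>\<alpha>b)) has_real_derivative r) (at 0) \<and>
        r + integral T (\<lambda>t. pairing B (F (\<phi> t) (\<nu> t), Fb (\<phi> t) (\<nu> t)) (\<delta>\<phi> t)) = 0"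
      proof (rule iffD2[OF body[of d \<delta>\<phi> e \<delta>\<nu> p \<delta>\<alpha> pb \<delta>\<alpha>b]])
        have "JB (\<lambda>z. E z * d z) = 0" "JB (\<lambda>z. M z * e z) = 0" "JB (\<lambda>z. R z * p z) = 0"
          by (rule JB0, use strong in \<open>simp add: strong_def\<close>)+
        moreover have "JF (\<lambda>z. Eb z * d z) = 0" "JF (\<lambda>z. - ab z * e z) = 0" "JF (\<lambda>z. R z * pb z) = 0"
          by (rule JF0, use strong frontier_in_B in \<open>simp add: strong_def\<close>)+
        ultimately show "(JB (\<lambda>z. E z * d z) + JF (\<lambda>z. Eb z * d z)) + (JB (\<lambda>z. M z * e z) + JF (\<lambda>z. - ab z * e z)) +
            (JB (\<lambda>z. R z * p z) + JF (\<lambda>z. R z * pb z)) = 0" by simp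
      qed (use d e p pb ends in auto)
    qed
  qed
  also have "strong \<longleftrightarrow> LdAP_equations B l F Fb t0 t1 \<phi> \<nu> \<alpha> \<alpha>b"
  proof -
    have "LdAP_equations B l F Fb t0 t1 \<phi> \<nu> \<alpha> \<alpha>b \<longleftrightarrow>
      (\<forall>t\<in>T. (\<forall>x\<in>B. R (t, x) = 0 \<and> M (t, x) = 0 \<and> E (t, x) = 0) \<and>
        (\<forall>x\<in>frontier B. ab (t, x) = 0 \<and> Eb (t, x) = 0))"
      unfolding LdAP_equations_def
    proof (intro ball_cong conj_cong refl)
      fix t x assume tT: "t \<in> T"
      have eqs: "d1 B l (\<phi> t) (\<nu> t) x = D1 l g n (t, x)"
        "div_in B (d3 B l (\<phi> t) (\<nu> t)) x = xdiv (D3 l g n) (t, x)"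
        "d3 B l (\<phi> t) (\<nu> t) x = D3 l g n (t, x)"
        "d2 B l (\<phi> t) (\<nu> t) x = D2 l g n (t, x)" if x: "x \<in> B"
        by (rule d1_eq[OF g(1) n(1) _ _ x] div_d3_eq[OF g(1) n(1) _ _ x] d3_eq[OF g(1) n(1) _ _ x]
            d2_eq[OF g(1) n(1) _ _ x]; use g(2) n(2) tT in blast)+
      {
        assume x: "x \<in> B"
        have "tder T \<phi> t x = tdiff g (t, x)" "tder T \<alpha> t x = tdiff a (t, x)"
          by (rule tder_eq[OF t tT g(1)], use g(2) x in blast) (rule tder_eq[OF t tT a(1)], use a(2) x in blast)
        note e = this eqs(1,2,4)[OF x] f(2)[OF tT x] n(2)[OF tT x] a(2)[OF tT x]
        show "tder T \<phi> t x = \<nu> t x \<longleftrightarrow> R (t, x) = 0" by (simp add: e R_def)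
        show "\<alpha> t x = d2 B l (\<phi> t) (\<nu> t) x \<longleftrightarrow> M (t, x) = 0" by (auto simp: e M_def)
        show "tder T \<alpha> t x = d1 B l (\<phi> t) (\<nu> t) x - div_in B (d3 B l (\<phi> t) (\<nu> t)) x + F (\<phi> t) (\<nu> t) x \<longleftrightarrow>
          E (t, x) = 0" by (auto simp: e E_def P_def)
      }
      {
        assume x: "x \<in> frontier B"
        have "tder T \<alpha>b t x = tdiff ab (t, x)"
          by (rule tder_eq[OF t tT ab(1)]) (use ab(2) x in blast)
        note e = this eqs(3)[OF frontier_in_B[OF x]] fb(2)[OF tT x] ab(2)[OF tT x]
        show "\<alpha>b t x = 0 \<longleftrightarrow> ab (t, x) = 0" by (simp add: e)
        show "tder T \<alpha>b t x = d3 B l (\<phi> t) (\<nu> t) x \<bullet> outward_normal B x + Fb (\<phi> t) (\<nu> t) x \<longleftrightarrow>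
          Eb (t, x) = 0" using N(2)[of "(t, x)"] x by (auto simp: e Eb_def Q_def)
      }
    qed
    then show ?thesis unfolding strong_def by auto
  qed
  finally show ?thesis .
qed

text \<open>The statement is pointwise in time. Equality of base points gives the two constraints on
  the momenta, and equality of covectors, unfolded by nondegeneracy of the pairing, gives the
  evolution equations.\<close>

lemma Dirac_iff:
  assumes \<phi>: "smooth_curve T B \<phi>" and \<nu>: "smooth_curve T B \<nu>" and \<alpha>: "smooth_curve T B \<alpha>"
    and \<alpha>b: "smooth_curve T (frontier B) \<alpha>b"
  shows "LdAP_equations B l F Fb t0 t1 \<phi> \<nu> \<alpha> \<alpha>b \<longleftrightarrow> Lagrange_Dirac B l F Fb t0 t1 \<phi> \<nu> \<alpha> \<alpha>b"
  unfolding LdAP_equations_def Lagrange_Dirac_def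
proof (rule ball_cong[OF refl])
  fix t assume tT: "t \<in> T"
  obtain g where g: "smooth g" "\<And>t x. t \<in> T \<Longrightarrow> x \<in> B \<Longrightarrow> \<phi> t x = g (t, x)"
    by (rule smooth_curve_rep[OF \<phi>], rule that)
  obtain n where n: "smooth n" "\<And>t x. t \<in> T \<Longrightarrow> x \<in> B \<Longrightarrow> \<nu> t x = n (t, x)"
    by (rule smooth_curve_rep[OF \<nu>], rule that)
  define \<phi>' where "\<phi>' = tder T \<phi> t"
  define \<alpha>' where "\<alpha>' = tder T \<alpha> t"
  define \<alpha>b' where "\<alpha>b' = tder T \<alpha>b t"
  define f where "f = F (\<phi> t) (\<nu> t)"
  define fb where "fb = Fb (\<phi> t) (\<nu> t)"
  define p where "p = fst (fder_phi B l (\<phi> t) (\<nu> t))"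
  define q where "q = snd (fder_phi B l (\<phi> t) (\<nu> t))"
  \<comment> \<open>\<open>b\<close> and \<open>bb\<close> are the fibre components of the Dirac
    differential after subtraction of the force.\<close>
  define b where "b x = - p x - f x" for x
  define bb where "bb x = - q x - fb x" for x
  have C: "\<phi> t \<in> Cinf B" "\<nu> t \<in> Cinf B" "\<alpha> t \<in> Cinf B" "\<alpha>b t \<in> Cinf (frontier B)"
    "\<phi>' \<in> Cinf B" "\<alpha>' \<in> Cinf B" "\<alpha>b' \<in> Cinf (frontier B)" "f \<in> Cinf B" "fb \<in> Cinf (frontier B)"
    unfolding \<phi>'_def \<alpha>'_def \<alpha>b'_def f_def fb_def
    by (intro smooth_curve_Cinf[OF _ tT] smooth_curve_tder[OF t] smooth_force_curve[OF force] \<phi> \<nu> \<alpha> \<alpha>b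
        smooth_curve_Cinf[OF smooth_force_curve(1)[OF force \<phi> \<nu>] tT]
        smooth_curve_Cinf[OF smooth_force_curve(2)[OF force \<phi> \<nu>] tT])+
  have gt: "\<phi> t x = g (t, x)" and nt: "\<nu> t x = n (t, x)" if "x \<in> B" for x using g(2) n(2) tT that by blast+
  have pq: "fder_phi B l (\<phi> t) (\<nu> t) = (restr B (\<lambda>x. D1 l g n (t, x) - xdiv (D3 l g n) (t, x)),
      restr (frontier B) (\<lambda>x. D3 l g n (t, x) \<bullet> outward_normal B x))"
    by (rule fder_phi_eq[OF g(1) n(1) gt nt])
  have nu: "fder_nu B l (\<phi> t) (\<nu> t) = (restr B (\<lambda>x. D2 l g n (t, x)), \<lambda>x. 0)"
    by (rule fder_nu_eq[OF g(1) n(1) gt nt])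
  obtain N where N: "smooth N" "\<And>x. x \<in> frontier B \<Longrightarrow> N x = outward_normal B x"
    by (rule outward_normal_smooth[OF B], rule that)
  note D = smooth_D[OF l g(1) n(1)]
  have C': "p \<in> Cinf B" "q \<in> Cinf (frontier B)" "restr B (\<lambda>x. D2 l g n (t, x)) \<in> Cinf B"
    using restr_Cinf[OF smooth_diff[OF smooth_slice[OF D(1)] smooth_slice[OF smooth_xdiv[OF D(3)]]], of B]
      restr_Cinf[OF smooth_inner[OF smooth_slice[OF D(3)] N(1)], of "frontier B"]
      restr_Cinf[OF smooth_slice[OF D(2)], of B] N(2)
    by (auto simp: p_def q_def pq)
  have Cb: "b \<in> Cinf B" "bb \<in> Cinf (frontier B)"
    using Cinf_diff[OF Cinf_diff[OF Cinf_zero C'(1)] C(8)] Cinf_diff[OF Cinf_diff[OF Cinf_zero C'(2)] C(9)]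
    by (simp_all add: b_def[abs_def] bb_def[abs_def])
  have neg: "(\<lambda>x. - \<alpha>' x) \<in> Cinf B" "(\<lambda>x. - \<alpha>b' x) \<in> Cinf (frontier B)"
    using Cinf_diff[OF Cinf_zero C(6)] Cinf_diff[OF Cinf_zero C(7)] by simp_all
  have pairing_neg: "pairing B (\<lambda>x. - \<alpha>' x, \<lambda>x. - \<alpha>b' x) \<delta> = - pairing B (\<alpha>', \<alpha>b') \<delta>" if "\<delta> \<in> Cinf B" for \<delta>
  proof -
    have "continuous_on (frontier B) \<delta>"
      using continuous_on_subset[OF Cinf_continuous[OF that]] frontier_in_B by blast
    then show ?thesis
      using I.minus[OF continuous_on_mult[OF Cinf_continuous[OF C(6)] Cinf_continuous[OF that]]]
        Ib.minus[OF continuous_on_mult[OF Cinf_continuous[OF C(7)]]] by (simp add: pairing_def)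
  qed
  have pairing_0: "pairing B (\<lambda>x. 0, \<lambda>x. 0) u = 0" "pairing B a (\<lambda>x. 0) = 0" for a u
    by (simp_all add: pairing_def Ib.zero)
  have form: "(\<forall>Y \<in> Cinf B \<times> Vstar B. canonical_form B (\<phi>', \<alpha>', \<alpha>b') Y = cotangent_pairing B ((b, bb), \<nu> t) Y) \<longleftrightarrow>
      \<phi>' = \<nu> t \<and> (\<lambda>x. - \<alpha>' x) = b \<and> (\<lambda>x. - \<alpha>b' x) = bb" (is "?lhs \<longleftrightarrow> ?rhs")
  proof
    assume ?rhs
    then show ?lhs
      using pairing_neg by (auto simp: canonical_form_def cotangent_pairing_def)
  next
    assume lhs: ?lhs
    \<comment> \<open>Testing with \<open>\<phi>' - \<nu> t\<close> in the momentum direction yields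
      a vanishing integral of a square.\<close>
    have "pairing B (\<lambda>x. \<phi>' x - \<nu> t x, \<lambda>x. 0) \<phi>' = pairing B (\<lambda>x. \<phi>' x - \<nu> t x, \<lambda>x. 0) (\<nu> t)"
      using lhs[rule_format, of "(\<lambda>x. 0, (\<lambda>x. \<phi>' x - \<nu> t x, \<lambda>x. 0))"] Cinf_diff[OF C(5,2)]
      by (simp add: canonical_form_def cotangent_pairing_def Cinf_zero Vstar_def pairing_0)
    then have eq: "integral B (\<lambda>x. (\<phi>' x - \<nu> t x) * \<phi>' x) = integral B (\<lambda>x. (\<phi>' x - \<nu> t x) * \<nu> t x)"
      by (simp add: pairing_def)
    have c: "continuous_on B (\<lambda>x. (\<phi>' x - \<nu> t x) * \<phi>' x)" "continuous_on B (\<lambda>x. (\<phi>' x - \<nu> t x) * \<nu> t x)"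
      by (intro continuous_on_mult continuous_on_diff Cinf_continuous C)+
    have sq0: "integral B (\<lambda>x. (\<phi>' x - \<nu> t x) * (\<phi>' x - \<nu> t x)) = 0"
      unfolding right_diff_distrib I.diff[OF c] eq by simp
    have sqc: "continuous_on B (\<lambda>x. (\<phi>' x - \<nu> t x) * (\<phi>' x - \<nu> t x))"
      by (intro continuous_on_mult continuous_on_diff Cinf_continuous C)
    have "(\<phi>' x - \<nu> t x) * (\<phi>' x - \<nu> t x) = 0" if "x \<in> B" for x
      by (rule I.definite[OF sqc _ sq0 that]) simp
    then have "\<phi>' = \<nu> t" by (intro Cinf_eqI[OF C(5,2)]) simp
    \<comment> \<open>Test vectors with zero momentum component leave the pairings with
      \<open>\<delta>\<close>, which determine the covector.\<close>
    moreover have "(\<lambda>x. - \<alpha>' x, \<lambda>x. - \<alpha>b' x) = (b, bb)"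
    proof (rule pairing_inject)
      fix \<delta> assume \<delta>: "\<delta> \<in> Cinf B"
      then have "- pairing B (\<alpha>', \<alpha>b') \<delta> = pairing B (b, bb) \<delta>"
        using lhs[rule_format, of "(\<delta>, (\<lambda>x. 0, \<lambda>x. 0))"]
        by (simp add: canonical_form_def cotangent_pairing_def Cinf_zero Vstar_def pairing_0)
      then show "pairing B (\<lambda>x. - \<alpha>' x, \<lambda>x. - \<alpha>b' x) \<delta> = pairing B (b, bb) \<delta>"
        using pairing_neg[OF \<delta>] by simp
    qed (use neg Cb in \<open>auto simp: Vstar_def\<close>)
    ultimately show ?rhs by simp
  qed
  have diff: "fibre_diff (dirac_differential B l (\<phi> t) (\<nu> t)) (force_field B l F Fb (\<phi> t) (\<nu> t)) =
      ((\<phi> t, (restr B (\<lambda>x. D2 l g n (t, x)), \<lambda>x. 0)), ((b, bb), \<nu> t))"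
    by (simp add: fibre_diff_def dirac_differential_def force_field_def nu p_def[symmetric] q_def[symmetric]
        f_def[symmetric] fb_def[symmetric] b_def[abs_def] bb_def[abs_def])
  have "(((\<phi> t, (\<alpha> t, \<alpha>b t)), (\<phi>', (\<alpha>', \<alpha>b'))),
        fibre_diff (dirac_differential B l (\<phi> t) (\<nu> t)) (force_field B l F Fb (\<phi> t) (\<nu> t)))
      \<in> canonical_dirac B (\<phi> t, (\<alpha> t, \<alpha>b t)) \<longleftrightarrow>
      \<alpha> t = restr B (\<lambda>x. D2 l g n (t, x)) \<and> \<alpha>b t = (\<lambda>x. 0) \<and>
      (\<forall>Y \<in> Cinf B \<times> Vstar B. canonical_form B (\<phi>', \<alpha>', \<alpha>b') Y = cotangent_pairing B ((b, bb), \<nu> t) Y)"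
    unfolding diff canonical_dirac_def using C Cb by (auto simp: Vstar_def)
  also have "\<dots> \<longleftrightarrow> \<alpha> t = restr B (\<lambda>x. D2 l g n (t, x)) \<and> \<alpha>b t = (\<lambda>x. 0) \<and>
      \<phi>' = \<nu> t \<and> (\<lambda>x. - \<alpha>' x) = b \<and> (\<lambda>x. - \<alpha>b' x) = bb"
    unfolding form ..
  also have "\<dots> \<longleftrightarrow> (\<forall>x\<in>B. \<alpha> t x = D2 l g n (t, x)) \<and> (\<forall>x\<in>frontier B. \<alpha>b t x = 0) \<and>
      (\<forall>x\<in>B. \<phi>' x = \<nu> t x) \<and> (\<forall>x\<in>B. - \<alpha>' x = b x) \<and> (\<forall>x\<in>frontier B. - \<alpha>b' x = bb x)"
  proof -
    have ext: "u = v \<longleftrightarrow> (\<forall>x\<in>S. u x = v x)" if "u \<in> Cinf S" "v \<in> Cinf S" for u v and S :: "(real^'m) set"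
      using Cinf_eqI[OF that] by blast
    show ?thesis
      unfolding ext[OF C(3) C'(3)] ext[OF C(4) Cinf_zero] ext[OF C(5,2)] ext[OF neg(1) Cb(1)] ext[OF neg(2) Cb(2)]
      by simp
  qed
  also have "\<dots> \<longleftrightarrow> (\<forall>x\<in>B. \<phi>' x = \<nu> t x \<and> \<alpha> t x = d2 B l (\<phi> t) (\<nu> t) x \<and>
        \<alpha>' x = d1 B l (\<phi> t) (\<nu> t) x - div_in B (d3 B l (\<phi> t) (\<nu> t)) x + f x) \<and>
      (\<forall>x\<in>frontier B. \<alpha>b t x = 0 \<and> \<alpha>b' x = d3 B l (\<phi> t) (\<nu> t) x \<bullet> outward_normal B x + fb x)"
  proof -
    have "- \<alpha>' x = b x \<longleftrightarrow> \<alpha>' x = d1 B l (\<phi> t) (\<nu> t) x - div_in B (d3 B l (\<phi> t) (\<nu> t)) x + f x" if x: "x \<in> B" for x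
      using d1_eq[OF g(1) n(1) gt nt x] div_d3_eq[OF g(1) n(1) gt nt x] x by (auto simp: b_def p_def pq)
    moreover have "- \<alpha>b' x = bb x \<longleftrightarrow> \<alpha>b' x = d3 B l (\<phi> t) (\<nu> t) x \<bullet> outward_normal B x + fb x"
      if x: "x \<in> frontier B" for x
      using d3_eq[OF g(1) n(1) gt nt frontier_in_B[OF x]] x by (auto simp: bb_def q_def pq)
    moreover have "d2 B l (\<phi> t) (\<nu> t) x = D2 l g n (t, x)" if x: "x \<in> B" for x
      by (rule d2_eq[OF g(1) n(1) gt nt x])
    ultimately show ?thesis by auto
  qed
  finally show "((\<forall>x\<in>B. tder T \<phi> t x = \<nu> t x \<and> \<alpha> t x = d2 B l (\<phi> t) (\<nu> t) x \<and>
        tder T \<alpha> t x = d1 B l (\<phi> t) (\<nu> t) x - div_in B (d3 B l (\<phi> t) (\<nu> t)) x + F (\<phi> t) (\<nu> t) x) \<and>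
      (\<forall>x\<in>frontier B. \<alpha>b t x = 0 \<and>
        tder T \<alpha>b t x = d3 B l (\<phi> t) (\<nu> t) x \<bullet> outward_normal B x + Fb (\<phi> t) (\<nu> t) x)) \<longleftrightarrow>
      (((\<phi> t, (\<alpha> t, \<alpha>b t)), (tder T \<phi> t, (tder T \<alpha> t, tder T \<alpha>b t))),
        fibre_diff (dirac_differential B l (\<phi> t) (\<nu> t)) (force_field B l F Fb (\<phi> t) (\<nu> t)))
      \<in> canonical_dirac B (\<phi> t, (\<alpha> t, \<alpha>b t))"
    unfolding \<phi>'_def \<alpha>'_def \<alpha>b'_def f_def fb_def by blast
qed

text \<open>The implicit equations force \<open>\<nu>\<close> to be the velocity,
  \<open>\<alpha>\<close> the derivative of the density in the velocity, and
  \<open>\<alpha>b\<close> zero. Conversely, these choices complete any solution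
  \<open>\<phi>\<close>.\<close>

lemma LdA_equations_iff:
  assumes \<phi>: "smooth_curve T B \<phi>"
  shows "LdA_equations B l F Fb t0 t1 \<phi> \<longleftrightarrow>
    (\<exists>\<nu> \<alpha> \<alpha>b. smooth_curve T B \<nu> \<and> smooth_curve T B \<alpha> \<and> smooth_curve T (frontier B) \<alpha>b \<and>
      LdAP_equations B l F Fb t0 t1 \<phi> \<nu> \<alpha> \<alpha>b)" (is "_ \<longleftrightarrow> (\<exists>\<nu> \<alpha> \<alpha>b. ?P \<nu> \<alpha> \<alpha>b)")
proof
  assume eqs: "LdA_equations B l F Fb t0 t1 \<phi>"
  obtain g where g: "smooth g" "\<And>t x. t \<in> T \<Longrightarrow> x \<in> B \<Longrightarrow> \<phi> t x = g (t, x)"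
    by (rule smooth_curve_rep[OF \<phi>], rule that)
  define \<nu> where "\<nu> = tder T \<phi>"
  have \<nu>: "smooth_curve T B \<nu>" unfolding \<nu>_def by (rule smooth_curve_tder[OF t \<phi>])
  have n: "\<nu> t x = tdiff g (t, x)" if "t \<in> T" "x \<in> B" for t x
    unfolding \<nu>_def by (rule tder_eq[OF t that(1) g(1)]) (rule g(2)[OF _ that(2)])
  \<comment> \<open>The restriction makes the momentum zero outside \<open>B\<close>, as the
    representation of fields on \<open>B\<close> demands.\<close>
  define \<alpha> where "\<alpha> t = restr B (\<lambda>x. d2 B l (\<phi> t) (\<nu> t) x)" for t
  note D = smooth_D[OF l g(1) smooth_tdiff[OF g(1)]]
  have d2: "d2 B l (\<phi> t) (\<nu> t) x = D2 l g (tdiff g) (t, x)" if "t \<in> T" "x \<in> B" for t x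
    by (rule d2_eq[OF g(1) smooth_tdiff[OF g(1)] _ _ that(2)]) (use g(2) n that in blast)+
  have \<alpha>: "smooth_curve T B \<alpha>"
    by (rule smooth_curveI[OF D(2)]) (use d2 in \<open>auto simp: \<alpha>_def restr_def\<close>)
  have "tder T \<alpha> t x = tder T (\<lambda>s. d2 B l (\<phi> s) (\<nu> s)) t x" if tx: "t \<in> T" "x \<in> B" for t x
  proof -
    have "tder T \<alpha> t x = tdiff (D2 l g (tdiff g)) (t, x)"
      by (rule tder_eq[OF t tx(1) D(2)]) (use d2 tx(2) in \<open>simp add: \<alpha>_def\<close>)
    moreover have "tder T (\<lambda>s. d2 B l (\<phi> s) (\<nu> s)) t x = tdiff (D2 l g (tdiff g)) (t, x)"
      by (rule tder_eq[OF t tx(1) D(2)]) (rule d2[OF _ tx(2)])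
    ultimately show ?thesis by simp
  qed
  moreover have "tder T (\<lambda>t x. 0) t x = 0" if "t \<in> T" for t and x :: "real^'m"
    by (rule tder_eq_0[OF t that]) (rule refl)
  ultimately have "LdAP_equations B l F Fb t0 t1 \<phi> \<nu> \<alpha> (\<lambda>t x. 0)"
    using eqs unfolding LdA_equations_def LdAP_equations_def Let_def \<nu>_def[symmetric]
    by (simp add: \<alpha>_def)
  then show "\<exists>\<nu> \<alpha> \<alpha>b. ?P \<nu> \<alpha> \<alpha>b" using \<nu> \<alpha> smooth_curve_zero by blast
next
  assume "\<exists>\<nu> \<alpha> \<alpha>b. ?P \<nu> \<alpha> \<alpha>b"
  then obtain \<nu> \<alpha> \<alpha>b where \<nu>: "smooth_curve T B \<nu>" and \<alpha>: "smooth_curve T B \<alpha>"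
    and \<alpha>b: "smooth_curve T (frontier B) \<alpha>b" and eqs: "LdAP_equations B l F Fb t0 t1 \<phi> \<nu> \<alpha> \<alpha>b"
    by blast
  note e = eqs[unfolded LdAP_equations_def, rule_format]
  have \<nu>_eq: "tder T \<phi> t = \<nu> t" if "t \<in> T" for t
    by (rule Cinf_eqI[OF smooth_curve_Cinf[OF smooth_curve_tder[OF t \<phi>] that] smooth_curve_Cinf[OF \<nu> that]])
      (use e[OF that] in blast)
  obtain a where a: "smooth a" "\<And>t x. t \<in> T \<Longrightarrow> x \<in> B \<Longrightarrow> \<alpha> t x = a (t, x)"
    by (rule smooth_curve_rep[OF \<alpha>], rule that)
  have "tder T (\<lambda>s. d2 B l (\<phi> s) (tder T \<phi> s)) t x = tder T \<alpha> t x" if tx: "t \<in> T" "x \<in> B" for t x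
  proof -
    have "tder T (\<lambda>s. d2 B l (\<phi> s) (tder T \<phi> s)) t x = tdiff a (t, x)"
      by (rule tder_eq[OF t tx(1) a(1)]) (metis \<nu>_eq a(2) e tx(2))
    moreover have "tder T \<alpha> t x = tdiff a (t, x)"
      by (rule tder_eq[OF t tx(1) a(1)]) (rule a(2)[OF _ tx(2)])
    ultimately show ?thesis by simp
  qed
  note d2_eq = this
  \<comment> \<open>The equations make \<open>\<alpha>b\<close> vanish on the frontier, and the
    representation makes it vanish elsewhere. With zero time derivative, its evolution equation
    becomes the boundary condition of the Lagrange--d'Alembert equations.\<close>
  have b0: "tder T \<alpha>b t x = 0" if "t \<in> T" for t x
    by (rule tder_eq_0[OF t that]) (metis e smooth_curve_0[OF \<alpha>b])
  show "LdA_equations B l F Fb t0 t1 \<phi>"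
    unfolding LdA_equations_def Let_def
  proof (intro ballI conjI)
    fix t x assume tT: "t \<in> T"
    show "tder T (\<lambda>s. d2 B l (\<phi> s) (tder T \<phi> s)) t x = d1 B l (\<phi> t) (tder T \<phi> t) x -
        div_in B (d3 B l (\<phi> t) (tder T \<phi> t)) x + F (\<phi> t) (tder T \<phi> t) x" if x: "x \<in> B"
      unfolding d2_eq[OF tT x] \<nu>_eq[OF tT] using e[OF tT] x by blast
    show "Fb (\<phi> t) (tder T \<phi> t) x = - (d3 B l (\<phi> t) (tder T \<phi> t) x \<bullet> outward_normal B x)"
      if x: "x \<in> frontier B"
    proof -
      have "tder T \<alpha>b t x = d3 B l (\<phi> t) (\<nu> t) x \<bullet> outward_normal B x + Fb (\<phi> t) (\<nu> t) x"
        using e[OF tT] x by blast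
      then show ?thesis unfolding \<nu>_eq[OF tT] using b0[OF tT, of x] by linarith
    qed
  qed
qed

end

text \<open>The first two statements see only \<open>\<phi>\<close>, the other three the full curve.
  The last conjunct joins the groups by asking for a completion of \<open>\<phi>\<close> to a
  critical curve; such a completion is necessarily the one described at
  \<open>LdA_equations_iff\<close>.\<close>

theorem theorem3p21:
  fixes B :: "(real^'m) set"
    and l :: "real \<times> real \<times> (real^'m) \<Rightarrow> real"
    and F Fb :: "(real^'m \<Rightarrow> real) \<Rightarrow> (real^'m \<Rightarrow> real) \<Rightarrow> (real^'m \<Rightarrow> real)"
    and t0 t1 :: real
    and \<phi> \<nu> \<alpha> \<alpha>b :: "real \<Rightarrow> real^'m \<Rightarrow> real"
  assumes "smooth_domain B"
    and "smooth l"
    and "smooth_force B F Fb"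
    and "t0 < t1"
    and "smooth_curve {t0..t1} B \<phi>"
    and "smooth_curve {t0..t1} B \<nu>"
    and "smooth_curve {t0..t1} B \<alpha>"
    and "smooth_curve {t0..t1} (frontier B) \<alpha>b"
  shows "(LdA_principle B l F Fb t0 t1 \<phi> \<longleftrightarrow> LdA_equations B l F Fb t0 t1 \<phi>) \<and>
         (LdAP_principle B l F Fb t0 t1 \<phi> \<nu> \<alpha> \<alpha>b \<longleftrightarrow> LdAP_equations B l F Fb t0 t1 \<phi> \<nu> \<alpha> \<alpha>b) \<and>
         (LdAP_equations B l F Fb t0 t1 \<phi> \<nu> \<alpha> \<alpha>b \<longleftrightarrow> Lagrange_Dirac B l F Fb t0 t1 \<phi> \<nu> \<alpha> \<alpha>b) \<and>
         (LdA_principle B l F Fb t0 t1 \<phi> \<longleftrightarrow>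
            (\<exists>\<nu>' \<alpha>' \<alpha>b'. smooth_curve {t0..t1} B \<nu>' \<and> smooth_curve {t0..t1} B \<alpha>' \<and>
               smooth_curve {t0..t1} (frontier B) \<alpha>b' \<and>
               LdAP_principle B l F Fb t0 t1 \<phi> \<nu>' \<alpha>' \<alpha>b'))"
proof -
  interpret forced_lagrangian_system B l F Fb t0 t1
    by unfold_locales (fact assms(1-4))+
  note \<phi> = assms(5)
  show ?thesis
    using LdA_iff[OF \<phi>] LdAP_iff[OF assms(5-8)] Dirac_iff[OF assms(5-8)]
      LdA_equations_iff[OF \<phi>] LdAP_iff[OF \<phi>]
    by (intro conjI) (assumption | (simp only:, blast))+
qed

end
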